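(* Consider, for each $n$, a graph $G=G_n$ on the vertex set $\{1,\dots,n\}$ and let $k=k_n$ satisfy $|G_n| \asymp k_n n$. Assume that $k_n$ is at least of order $1$ (i.e. $k_n\succsim 1$) and that $\sum_{i=1}^n |G_i|^2 - \frac{4|G|^2}{n}$ is at least of order $k_n^2$ (i.e. $\sum_{i=1}^n |G_i|^2 - \frac{4|G|^2}{n} \succsim k_n^2$). Then, under the permutation null distribution, the sequence (indexed by $n$) of stochastic processes $\{Z_{\mathrm{diff}}(\lfloor nu\rfloor): 0<u<1\}$ is tight on the space $D[0+\epsilon,1-\epsilon]$, for any positive constant $\epsilon$.
   Context: Setting: observations $\mathbf{y}_1,\dots,\mathbf{y}_n$ are the nodes of a similarity graph $G$ (we use $G$ both for the graph and its edge set, so $|G|$ is the number of edges). $G_i$ denotes the subgraph of $G$ consisting of all edges incident to node $i$, so $|G_i|$ is the degree of node $i$. Permutation null distribution: the graph is fixed and the order (time labels) of the observations is a uniformly random permutation of $\{1,\dots,n\}$; all expectations, variances and probabilities are with respect to this randomness. For $t\in\{1,\dots,n-1\}$, let $g_i(t)=I_{i>t}$ (indicator that observation $i$ is observed after time $t$, in the permuted order). For an edge $e=(i,j)$, $J_e(t)=0$ if $g_i(t)\ne g_j(t)$, $J_e(t)=1$ if $g_i(t)=g_j(t)=0$, $J_e(t)=2$ if $g_i(t)=g_j(t)=1$. Let $R_1(t)=\sum_{e\in G} I_{J_e(t)=1}$ and $R_2(t)=\sum_{e\in G} I_{J_e(t)=2}$. Define $R_{\mathrm{diff}}(t)=R_1(t)-R_2(t)$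 and $Z_{\mathrm{diff}}(t)=\frac{R_{\mathrm{diff}}(t)-\mathbf{E}(R_{\mathrm{diff}}(t))}{\sqrt{\mathrm{Var}(R_{\mathrm{diff}}(t))}}$. $D[a,b]$ is the space of real functions on $[a,b]$ that are right-continuous with left-hand limits (cadlag). Notation: $f_n\succsim g_n$ means $f_n$ is bounded below by a positive constant times $g_n$ asymptotically; $f_n\asymp g_n$ means bounded above and below by constant multiples of $g_n$. *)

theory Defs
  imports "HOL-Analysis.Analysis"
begin

definition simple_graph_on :: "nat \<Rightarrow> nat set set \<Rightarrow> bool" where
  "simple_graph_on n E \<longleftrightarrow> (\<forall>e\<in>E. e \<subseteq> {1..n} \<and> card e = 2)"

definition degree :: "nat set set \<Rightarrow> nat \<Rightarrow> nat" where
  "degree E i = card {e\<in>E. i \<in> e}"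

(* Permutation null: sigma v is the (random) time label of node v, uniform over all
   permutations of {1..n}. *)
definition perms :: "nat \<Rightarrow> (nat \<Rightarrow> nat) set" where
  "perms n = {\<sigma>. \<sigma> permutes {1..n}}"

definition R1 :: "nat set set \<Rightarrow> (nat \<Rightarrow> nat) \<Rightarrow> nat \<Rightarrow> nat" where
  "R1 E \<sigma> t = card {e\<in>E. \<forall>v\<in>e. \<sigma> v \<le> t}"

definition R2 :: "nat set set \<Rightarrow> (nat \<Rightarrow> nat) \<Rightarrow> nat \<Rightarrow> nat" where
  "R2 E \<sigma> t = card {e\<in>E. \<forall>v\<in>e. \<sigma> v > t}"

definition Rdiff :: "nat set set \<Rightarrow> (nat \<Rightarrow> nat) \<Rightarrow> nat \<Rightarrow> real" where
  "Rdiff E \<sigma> t = real (R1 E \<sigma> t) - real (R2 E \<sigma> t)"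

definition perm_E :: "nat \<Rightarrow> ((nat \<Rightarrow> nat) \<Rightarrow> real) \<Rightarrow> real" where
  "perm_E n X = (\<Sum>\<sigma>\<in>perms n. X \<sigma>) / real (card (perms n))"

definition perm_Var :: "nat \<Rightarrow> ((nat \<Rightarrow> nat) \<Rightarrow> real) \<Rightarrow> real" where
  "perm_Var n X = perm_E n (\<lambda>\<sigma>. (X \<sigma> - perm_E n X)\<^sup>2)"

definition Zdiff :: "nat \<Rightarrow> nat set set \<Rightarrow> nat \<Rightarrow> (nat \<Rightarrow> nat) \<Rightarrow> real" where
  "Zdiff n E t \<sigma> =
     (Rdiff E \<sigma> t - perm_E n (\<lambda>\<tau>. Rdiff E \<tau> t)) / sqrt (perm_Var n (\<lambda>\<tau>. Rdiff E \<tau> t))"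

definition Zpath :: "nat \<Rightarrow> nat set set \<Rightarrow> real \<Rightarrow> real \<Rightarrow> (nat \<Rightarrow> nat) \<Rightarrow> real \<Rightarrow> real" where
  "Zpath n E a b \<sigma> = (\<lambda>u. if u \<in> {a..b} then Zdiff n E (nat \<lfloor>real n * u\<rfloor>) \<sigma> else 0)"

definition cadlag :: "real \<Rightarrow> real \<Rightarrow> (real \<Rightarrow> real) set" where
  "cadlag a b = {x. (\<forall>t. t \<notin> {a..b} \<longrightarrow> x t = 0)
                  \<and> (\<forall>t\<in>{a..<b}. (x \<longlongrightarrow> x t) (at_right t))
                  \<and> (\<forall>t\<in>{a<..b}. \<exists>l. (x \<longlongrightarrow> l) (at_left t))}"

definition time_changes :: "real \<Rightarrow> real \<Rightarrow> (real \<Rightarrow> real) set" where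
  "time_changes a b = {l. strict_mono_on {a..b} l \<and> continuous_on {a..b} l \<and> l ` {a..b} = {a..b}}"

definition skorokhod :: "real \<Rightarrow> real \<Rightarrow> (real \<Rightarrow> real) \<Rightarrow> (real \<Rightarrow> real) \<Rightarrow> real" where
  "skorokhod a b x y =
     Inf {max (SUP t\<in>{a..b}. \<bar>l t - t\<bar>) (SUP t\<in>{a..b}. \<bar>x t - y (l t)\<bar>) | l. l \<in> time_changes a b}"

definition skorokhod_topology :: "real \<Rightarrow> real \<Rightarrow> (real \<Rightarrow> real) topology" where
  "skorokhod_topology a b = Metric_space.mtopology (cadlag a b) (skorokhod a b)"

definition tight_perm :: "real \<Rightarrow> real \<Rightarrow> (nat \<Rightarrow> (nat \<Rightarrow> nat) \<Rightarrow> (real \<Rightarrow> real)) \<Rightarrow> bool" where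
  "tight_perm a b X \<longleftrightarrow>
     (\<forall>\<eta>>0. \<exists>K. compactin (skorokhod_topology a b) K \<and>
        (\<forall>n. real (card {\<sigma>\<in>perms n. X n \<sigma> \<in> K}) / real (card (perms n)) \<ge> 1 - \<eta>))"

end

theory Submission
  imports Defs "HOL-Complex_Analysis.Great_Picard"
begin

text \<open>
  Every edge contributes the number of its early endpoints minus one to \<open>R\<^sub>1(t) - R\<^sub>2(t)\<close>, so the
  statistic is the linear rank statistic \<open>\<Sum>v. deg(v) 1[\<sigma> v \<le> t]\<close> up to a constant. With degrees centred
  and normalised, \<open>Z(t)\<close> is a deterministic, asymptotically equicontinuous multiple of
  \<open>M t = n / (n - t) * S t\<close>, where \<open>S t\<close> is a partial sum of a randomly permuted sequence. \<open>M\<close> is a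
  martingale whose increments, on \<open>t \<le> (1 - \<epsilon>) n\<close>, have conditional variance at most
  \<open>1 / (\<epsilon>\<^sup>3 n)\<close>. Aldous' argument then applies: stop whenever \<open>M\<close> has moved by a fixed amount since the
  last stop. By Doob's inequality stops seldom follow each other closely, and since this bounds
  their expected number, with high probability no two stops are close at all. The stops form the
  partition required by Billingsley's characterisation of compact subsets of the Skorokhod space.
\<close>

section \<open>The Skorokhod metric\<close>

text \<open>A single node may carry almost all of the centred degree mass, as the hub of a star
  does. Only second moments appear for the same reason: the conditional variance of an increment is
  uniformly small, the increment itself is not. The window avoids the two ends for different
  reasons. Near time \<open>n\<close> the martingale factor \<open>n / (n - t)\<close> explodes;
  near 0 it is the factor that converts the martingale back into the standardised statistic, about
  \<open>sqrt ((1 - u) / u)\<close> with \<open>u = t / n\<close>. Conditional expectations are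
  written as sums over permutations weighted by functionals of the past, and they are computed from
  one symmetry: exchanging two later labels leaves the past unchanged. The lower bounds on
  \<open>k\<close> and on the degree variance make the normalisation possible for large
  \<open>n\<close>; after it, the estimates depend on the graph no more.\<close>

lemma cadlag_right:
  "x \<in> cadlag a b \<Longrightarrow> a \<le> t \<Longrightarrow> t < b \<Longrightarrow> (x \<longlongrightarrow> x t) (at_right t)"
  by (simp add: cadlag_def)

lemma cadlag_left:
  "x \<in> cadlag a b \<Longrightarrow> a < t \<Longrightarrow> t \<le> b \<Longrightarrow> \<exists>l. (x \<longlongrightarrow> l) (at_left t)"
  by (simp add: cadlag_def)

lemma cadlag_right_close:
  assumes "x \<in> cadlag a b" "a \<le> t" "t < b" "e > 0"
  obtains r where "r > t" "r \<le> b" "\<And>w. t \<le> w \<Longrightarrow> w < r \<Longrightarrow> \<bar>x w - x t\<bar> < e"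
proof -
  have "eventually (\<lambda>w. dist (x w) (x t) < e) (at_right t)"
    using cadlag_right[OF assms(1-3)] \<open>e > 0\<close> by (simp add: tendsto_iff)
  then obtain r where r: "r > t" "\<And>w. t < w \<Longrightarrow> w < r \<Longrightarrow> dist (x w) (x t) < e"
    by (auto simp: eventually_at_right_field)
  show ?thesis
  proof (rule that[of "min r b"])
    fix w assume "t \<le> w" "w < min r b"
    then show "\<bar>x w - x t\<bar> < e"
      using r(2)[of w] \<open>e > 0\<close> by (cases "t = w") (auto simp: dist_real_def)
  qed (use r \<open>t < b\<close> in auto)
qed

lemma cadlag_left_close:
  assumes "x \<in> cadlag a b" "a < t" "t \<le> b" "e > 0"
  obtains r where "a \<le> r" "r < t" "\<And>v w. r < v \<Longrightarrow> v < t \<Longrightarrow> r < w \<Longrightarrow> w < t \<Longrightarrow> \<bar>x w - x v\<bar> < e"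
proof -
  obtain l where "(x \<longlongrightarrow> l) (at_left t)"
    using cadlag_left[OF assms(1-3)] by blast
  then have "eventually (\<lambda>w. dist (x w) l < e / 2) (at_left t)"
    using \<open>e > 0\<close> by (intro tendstoD) auto
  then obtain r where r: "r < t" "\<And>w. r < w \<Longrightarrow> w < t \<Longrightarrow> dist (x w) l < e / 2"
    by (auto simp: eventually_at_left_field)
  show ?thesis
  proof (rule that[of "max a r"])
    fix v w assume "max a r < v" "v < t" "max a r < w" "w < t"
    then show "\<bar>x w - x v\<bar> < e"
      using r(2)[of w] r(2)[of v] unfolding dist_real_def by linarith
  qed (use r \<open>a < t\<close> in auto)
qed

text \<open>With \<open>\<delta> > 0\<close>, a chain of such steps from \<open>a\<close> to \<open>b\<close> is a partition witnessing
  that Billingsley's cadlag modulus of \<open>x\<close> at \<open>\<delta>\<close> is essentially at most \<open>e\<close>.\<close>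

definition osc_step :: "(real \<Rightarrow> real) \<Rightarrow> real \<Rightarrow> real \<Rightarrow> real \<Rightarrow> real \<Rightarrow> bool" where
  "osc_step x \<delta> e s u \<longleftrightarrow> s + \<delta> \<le> u \<and> (\<forall>w\<in>{s..<u}. \<bar>x w - x s\<bar> \<le> e)"

lemma osc_chain_mono:
  assumes "(osc_step x \<delta> e)\<^sup>*\<^sup>* s u" "\<delta>' \<le> \<delta>"
  shows "(osc_step x \<delta>' e)\<^sup>*\<^sup>* s u"
proof -
  have "osc_step x \<delta> e \<le> osc_step x \<delta>' e"
    using assms(2) by (auto simp: osc_step_def)
  then show ?thesis
    using rtranclp_mono assms(1) by blast
qed

text \<open>Around every point the one-sided limits give a step ending at the point and a step
  starting there; since steps are half-open, a jump at the end of a step does not count. Bisection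
  glues finitely many of them, and \<delta> is the least of their lengths.\<close>

lemma cadlag_osc_chain:
  assumes x: "x \<in> cadlag a b" and "a \<le> b" "e > 0"
  shows "\<exists>\<delta>>0. (osc_step x \<delta> e)\<^sup>*\<^sup>* a b"
proof -
  \<comment> \<open>\<open>R\<close> is \<open>osc_step\<close> without a common minimal length,
    which is available only once the finite chain has been found.\<close>
  define R where "R s u \<longleftrightarrow> s < u \<and> (\<forall>w\<in>{s..<u}. \<bar>x w - x s\<bar> \<le> e)" for s u
  have "a \<le> a \<longrightarrow> b \<le> b \<longrightarrow> R\<^sup>*\<^sup>* a b"
    using \<open>a \<le> b\<close>
  proof (induction rule: Bolzano[where P="\<lambda>u v. a \<le> u \<longrightarrow> v \<le> b \<longrightarrow> R\<^sup>*\<^sup>* u v"])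
    case (trans u v w)
    then show ?case by (meson order_trans rtranclp_trans)
  next
    case (local t)
    obtain r1 where r1: "r1 < t" "\<And>u. a \<le> u \<Longrightarrow> r1 < u \<Longrightarrow> u \<le> t \<Longrightarrow> R\<^sup>*\<^sup>* u t"
    proof (cases "a < t")
      case True
      then obtain r where "a \<le> r" "r < t"
        "\<And>v w. r < v \<Longrightarrow> v < t \<Longrightarrow> r < w \<Longrightarrow> w < t \<Longrightarrow> \<bar>x w - x v\<bar> < e"
        using cadlag_left_close[OF x True _ \<open>e > 0\<close>] local by metis
      then have "R\<^sup>*\<^sup>* u t" if "r < u" "u \<le> t" for u
        using that unfolding R_def
        by (cases "u = t") (auto intro!: r_into_rtranclp less_imp_le)
      then show ?thesis using that \<open>r < t\<close> by blast
    next
      case False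
      then show ?thesis proof (intro that[of "t - 1"])
        fix u assume "a \<le> u" "u \<le> t"
        then have "u = t" using False by simp
        then show "R\<^sup>*\<^sup>* u t" by simp
      qed simp
    qed
    obtain r2 where r2: "r2 > t" "\<And>u. u \<le> b \<Longrightarrow> u < r2 \<Longrightarrow> t \<le> u \<Longrightarrow> R\<^sup>*\<^sup>* t u"
    proof (cases "t < b")
      case True
      then obtain r where "r > t" "r \<le> b" "\<And>w. t \<le> w \<Longrightarrow> w < r \<Longrightarrow> \<bar>x w - x t\<bar> < e"
        using cadlag_right_close[OF x _ True \<open>e > 0\<close>] local by metis
      then have "R\<^sup>*\<^sup>* t u" if "u < r" "t \<le> u" for u
        using that unfolding R_def
        by (cases "u = t") (auto intro!: r_into_rtranclp less_imp_le)
      then show ?thesis using that \<open>r > t\<close> by blast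
    next
      case False
      then show ?thesis proof (intro that[of "t + 1"])
        fix u assume "u \<le> b" "t \<le> u"
        then have "u = t" using False by simp
        then show "R\<^sup>*\<^sup>* t u" by simp
      qed simp
    qed
    show ?case
    proof (intro exI[of _ "min (t - r1) (r2 - t)"] conjI allI impI, goal_cases)
      case (2 u v)
      then show ?case using r1(2)[of u] r2(2)[of v] by (auto intro: rtranclp_trans)
    qed (use r1 r2 in auto)
  qed
  then have "R\<^sup>*\<^sup>* a b" by simp
  then show ?thesis
  proof induction
    case base
    then show ?case by (auto intro: exI[of _ 1])
  next
    case (step s u)
    then obtain \<delta> where \<delta>: "\<delta> > 0" "(osc_step x \<delta> e)\<^sup>*\<^sup>* a s" by blast
    let ?d = "min \<delta> (u - s)"
    have "(osc_step x ?d e)\<^sup>*\<^sup>* a s" "osc_step x ?d e s u"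
      using osc_chain_mono[OF \<delta>(2)] \<open>R s u\<close> by (auto simp: R_def osc_step_def)
    then show ?case
      using \<delta> \<open>R s u\<close> by (intro exI[of _ ?d]) (auto simp: R_def)
  qed
qed

text \<open>Within a step of a chain with oscillation 1 the values stay within 1 of the left one.
  The value at the right end is counted separately, as it may follow a jump.\<close>

lemma cadlag_bounded:
  assumes "x \<in> cadlag a b" "a \<le> b"
  obtains B where "\<And>t. \<bar>x t\<bar> \<le> B"
proof -
  obtain \<delta> where "\<delta> > 0" and ch: "(osc_step x \<delta> 1)\<^sup>*\<^sup>* a b"
    using cadlag_osc_chain[OF assms, of 1] by auto
  have "\<exists>B. \<forall>t\<in>{a..b}. \<bar>x t\<bar> \<le> B"
    using ch
  proof induction
    case base
    show ?case by (rule exI[of _ "\<bar>x a\<bar>"]) auto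
  next
    case (step s u)
    then obtain B where B: "\<forall>t\<in>{a..s}. \<bar>x t\<bar> \<le> B" by blast
    have st: "\<bar>x w - x s\<bar> \<le> 1" if "s \<le> w" "w < u" for w
      using step(2) that by (simp add: osc_step_def)
    have "\<bar>x t\<bar> \<le> max B (max (\<bar>x s\<bar> + 1) \<bar>x u\<bar>)" if t: "t \<in> {a..u}" for t
    proof (cases "t \<le> s")
      case True
      then have "\<bar>x t\<bar> \<le> B" using B t by auto
      then show ?thesis by simp
    next
      case False
      show ?thesis
      proof (cases "t = u")
        case False
        then have "\<bar>x t - x s\<bar> \<le> 1" using st[of t] \<open>\<not> t \<le> s\<close> t by auto
        then show ?thesis by linarith
      qed simp
    qed
    then show ?case by blast
  qed
  then obtain B where B: "\<forall>t\<in>{a..b}. \<bar>x t\<bar> \<le> B" by blast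
  show ?thesis
  proof (rule that[of B])
    fix t
    show "\<bar>x t\<bar> \<le> B"
    proof (cases "t \<in> {a..b}")
      case False
      then have "x t = 0" using assms(1) by (simp add: cadlag_def)
      then show ?thesis using B assms(2) by (force intro: order_trans[of 0 "\<bar>x a\<bar>"])
    qed (use B in auto)
  qed
qed

section \<open>Time changes: fixed end points, composition and inversion\<close>

lemma time_changes_endpoints:
  assumes "l \<in> time_changes a b" "a \<le> b"
  shows "l a = a" "l b = b"
proof -
  have m: "strict_mono_on {a..b} l" and im: "l ` {a..b} = {a..b}"
    using assms by (auto simp: time_changes_def)
  have mono: "l s \<le> l t" if "a \<le> s" "s \<le> t" "t \<le> b" for s t
    using m that by (intro strict_mono_on_leD[OF m]) auto
  obtain s where s: "s \<in> {a..b}" "l s = a" using im assms(2) by (auto simp: set_eq_iff image_iff dest: spec[of _ a])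
  obtain t where t: "t \<in> {a..b}" "l t = b" using im assms(2) by (auto simp: set_eq_iff image_iff dest: spec[of _ b])
  have "l a \<in> {a..b}" "l b \<in> {a..b}" using im assms(2) by auto
  then show "l a = a" "l b = b"
    using mono[of a s] mono[of t b] s t by auto
qed

lemma time_changes_in: "l \<in> time_changes a b \<Longrightarrow> t \<in> {a..b} \<Longrightarrow> l t \<in> {a..b}"
  by (auto simp: time_changes_def)

lemma time_changes_id: "(\<lambda>t. t) \<in> time_changes a b"
  by (auto simp: time_changes_def strict_mono_on_ident)

lemma time_changes_comp:
  assumes "l \<in> time_changes a b" "m \<in> time_changes a b"
  shows "(\<lambda>t. m (l t)) \<in> time_changes a b"
proof -
  have sl: "strict_mono_on {a..b} l" "continuous_on {a..b} l" "l ` {a..b} = {a..b}"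
    and sm: "strict_mono_on {a..b} m" "continuous_on {a..b} m" "m ` {a..b} = {a..b}"
    using assms unfolding time_changes_def by blast+
  have "strict_mono_on {a..b} (\<lambda>t. m (l t))"
  proof (rule strict_mono_onI)
    fix r s assume "r \<in> {a..b}" "s \<in> {a..b}" "r < s"
    then show "m (l r) < m (l s)"
      using strict_mono_onD[OF sl(1), of r s] time_changes_in[OF assms(1)]
      by (intro strict_mono_onD[OF sm(1)]) blast+
  qed
  moreover have "continuous_on {a..b} (\<lambda>t. m (l t))"
    using sl sm by (auto intro: continuous_on_compose2[of "{a..b}" m "{a..b}" l])
  moreover have "(\<lambda>t. m (l t)) ` {a..b} = {a..b}"
    using sl sm by (metis image_image)
  ultimately show ?thesis by (simp add: time_changes_def)
qed

lemma time_changes_inverse: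
  assumes "l \<in> time_changes a b"
  obtains m where "m \<in> time_changes a b"
    "\<And>t. t \<in> {a..b} \<Longrightarrow> m (l t) = t" "\<And>t. t \<in> {a..b} \<Longrightarrow> l (m t) = t"
proof
  let ?m = "the_inv_into {a..b} l"
  have s: "strict_mono_on {a..b} l" and c: "continuous_on {a..b} l" and im: "l ` {a..b} = {a..b}"
    using assms by (auto simp: time_changes_def)
  have inj: "inj_on l {a..b}" using s by (rule strict_mono_on_imp_inj_on)
  show ml: "?m (l t) = t" if "t \<in> {a..b}" for t
    using the_inv_into_f_f[OF inj that] .
  show lm: "l (?m t) = t" if "t \<in> {a..b}" for t
    using f_the_inv_into_f[OF inj, of t] im that by simp
  have mi: "?m t \<in> {a..b}" if "t \<in> {a..b}" for t
    using the_inv_into_into[OF inj, of t] im that by blast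
  have "?m ` {a..b} = {a..b}"
    using the_inv_into_onto[OF inj] im by simp
  moreover have "strict_mono_on {a..b} ?m"
    using s mi lm by (intro strict_mono_onI) (metis strict_mono_on_less)
  moreover have "continuous_on {a..b} ?m"
    using continuous_on_inv_into[OF c _ inj] im by simp
  ultimately show "?m \<in> time_changes a b" by (simp add: time_changes_def)
qed

lemma skorokhod_set_nonneg:
  assumes "a \<le> b" "l \<in> time_changes a b"
  shows "0 \<le> max (SUP t\<in>{a..b}. \<bar>l t - t\<bar>) (SUP t\<in>{a..b}. \<bar>x t - y (l t)\<bar> :: real)"
proof -
  \<comment> \<open>Nonnegativity is required for arbitrary \<open>x\<close> and \<open>y\<close>,
    for which the second supremum may be over an unbounded set and carry no information; the first
    one decides.\<close>
  have "bdd_above ((\<lambda>t. \<bar>l t - t\<bar>) ` {a..b})"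
    using time_changes_in[OF assms(2)] by (intro bdd_aboveI[of _ "b - a"]) force
  then have "\<bar>l a - a\<bar> \<le> (SUP t\<in>{a..b}. \<bar>l t - t\<bar>)"
    using assms(1) by (intro cSUP_upper) auto
  then show ?thesis by linarith
qed

lemma skorokhod_bdd_below:
  assumes "a \<le> b"
  shows "bdd_below {max (SUP t\<in>{a..b}. \<bar>l t - t\<bar>) (SUP t\<in>{a..b}. \<bar>x t - y (l t)\<bar> :: real) | l. l \<in> time_changes a b}"
  using skorokhod_set_nonneg[OF assms] by (intro bdd_belowI[of _ 0]) blast

lemma skorokhod_nonneg: "a \<le> b \<Longrightarrow> 0 \<le> skorokhod a b x y"
  unfolding skorokhod_def
  using skorokhod_set_nonneg time_changes_id by (intro cInf_greatest) blast+

lemma skorokhod_le: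
  assumes "a \<le> b" "l \<in> time_changes a b"
    and "\<And>t. t \<in> {a..b} \<Longrightarrow> \<bar>l t - t\<bar> \<le> c" "\<And>t. t \<in> {a..b} \<Longrightarrow> \<bar>x t - y (l t)\<bar> \<le> c"
  shows "skorokhod a b x y \<le> c"
proof -
  have "skorokhod a b x y \<le> max (SUP t\<in>{a..b}. \<bar>l t - t\<bar>) (SUP t\<in>{a..b}. \<bar>x t - y (l t)\<bar>)"
    unfolding skorokhod_def
    using assms(2) by (intro cInf_lower skorokhod_bdd_below[OF assms(1)]) blast
  also have "\<dots> \<le> c"
    using assms by (intro max.boundedI cSUP_least) auto
  finally show ?thesis .
qed

lemma skorokhod_less:
  assumes "a \<le> b" "x \<in> cadlag a b" "y \<in> cadlag a b" "skorokhod a b x y < c"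
  obtains l where "l \<in> time_changes a b"
    "\<And>t. t \<in> {a..b} \<Longrightarrow> \<bar>l t - t\<bar> < c" "\<And>t. t \<in> {a..b} \<Longrightarrow> \<bar>x t - y (l t)\<bar> < c"
proof -
  have "\<exists>z\<in>{max (SUP t\<in>{a..b}. \<bar>l t - t\<bar>) (SUP t\<in>{a..b}. \<bar>x t - y (l t)\<bar>) | l. l \<in> time_changes a b}. z < c"
    using assms(4) time_changes_id[of a b] unfolding skorokhod_def
    by (intro cInf_lessD) auto
  then obtain l where l: "l \<in> time_changes a b"
    and c: "(SUP t\<in>{a..b}. \<bar>l t - t\<bar>) < c" "(SUP t\<in>{a..b}. \<bar>x t - y (l t)\<bar>) < c"
    by auto
  obtain B where B: "\<And>t. \<bar>x t\<bar> \<le> B" using cadlag_bounded[OF assms(2,1)] by blast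
  obtain B' where B': "\<And>t. \<bar>y t\<bar> \<le> B'" using cadlag_bounded[OF assms(3,1)] by blast
  have b1: "bdd_above ((\<lambda>t. \<bar>l t - t\<bar>) ` {a..b})"
    using time_changes_in[OF l] by (intro bdd_aboveI[of _ "b - a"]) force
  have "\<bar>x t - y (l t)\<bar> \<le> B + B'" for t
    using B[of t] B'[of "l t"] by linarith
  then have b2: "bdd_above ((\<lambda>t. \<bar>x t - y (l t)\<bar>) ` {a..b})"
    by (intro bdd_aboveI[of _ "B + B'"]) auto
  show ?thesis
    using cSUP_upper[OF _ b1] cSUP_upper[OF _ b2] c
    by (intro that[OF l]) (meson le_less_trans)+
qed

text \<open>Passing to the inverse time change only reindexes the two families of values. The image
  sets coincide, so the suprema agree even over unbounded sets, and symmetry holds for arbitrary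
  functions.\<close>

lemma skorokhod_set_commute_subset:
  assumes "a \<le> b"
  shows "{max (SUP t\<in>{a..b}. \<bar>l t - t\<bar>) (SUP t\<in>{a..b}. \<bar>x t - y (l t)\<bar> :: real) | l. l \<in> time_changes a b}
     \<subseteq> {max (SUP t\<in>{a..b}. \<bar>l t - t\<bar>) (SUP t\<in>{a..b}. \<bar>y t - x (l t)\<bar>) | l. l \<in> time_changes a b}"
proof clarify
  fix l assume l: "l \<in> time_changes a b"
  obtain m where m: "m \<in> time_changes a b"
    and ml: "\<And>t. t \<in> {a..b} \<Longrightarrow> m (l t) = t" and lm: "\<And>t. t \<in> {a..b} \<Longrightarrow> l (m t) = t"
    using time_changes_inverse[OF l] by metis
  have im: "m ` {a..b} = {a..b}" using m by (simp add: time_changes_def)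
  have "(\<lambda>t. \<bar>m t - t\<bar>) ` {a..b} = (\<lambda>t. \<bar>l t - t\<bar>) ` m ` {a..b}"
    unfolding image_image by (rule image_cong) (auto simp: lm)
  moreover have "(\<lambda>t. \<bar>y t - x (m t)\<bar>) ` {a..b} = (\<lambda>t. \<bar>x t - y (l t)\<bar>) ` m ` {a..b}"
    unfolding image_image by (rule image_cong) (auto simp: lm)
  ultimately show "\<exists>m. max (SUP t\<in>{a..b}. \<bar>l t - t\<bar>) (SUP t\<in>{a..b}. \<bar>x t - y (l t)\<bar>)
      = max (SUP t\<in>{a..b}. \<bar>m t - t\<bar>) (SUP t\<in>{a..b}. \<bar>y t - x (m t)\<bar>) \<and> m \<in> time_changes a b"
    using m im by (intro exI[of _ m]) simp
qed

text \<open>Time changes fix \<open>b\<close>. At an earlier \<open>t\<close> the comparison is made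
  slightly to its right, where by right continuity both functions are nearly constant and a small
  time shift does no harm.\<close>

lemma skorokhod_eqI:
  assumes "a \<le> b" "x \<in> cadlag a b" "y \<in> cadlag a b" "skorokhod a b x y = 0"
  shows "x = y"
proof
  fix t
  consider "t \<notin> {a..b}" | "t = b" | "a \<le> t" "t < b" by force
  then show "x t = y t"
  proof cases
    case 1
    then show ?thesis using assms by (simp add: cadlag_def)
  next
    case 2
    have "\<bar>x b - y b\<bar> \<le> e" if "e > 0" for e
    proof -
      obtain l where "l \<in> time_changes a b" "\<And>t. t \<in> {a..b} \<Longrightarrow> \<bar>x t - y (l t)\<bar> < e"
        using skorokhod_less[OF assms(1-3), of e] \<open>e > 0\<close> assms(4) by metis
      then show ?thesis
        using time_changes_endpoints(2)[of l a b] assms(1) by (metis atLeastAtMost_iff less_imp_le order_refl)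
    qed
    then have "\<bar>x b - y b\<bar> \<le> 0" by (rule field_le_epsilon[of _ 0, simplified])
    then show ?thesis using 2 by simp
  next
    case 3
    have "\<bar>x t - y t\<bar> \<le> e" if "e > 0" for e
    proof -
      obtain r1 where r1: "r1 > t" "r1 \<le> b" "\<And>w. t \<le> w \<Longrightarrow> w < r1 \<Longrightarrow> \<bar>x w - x t\<bar> < e / 3"
        using cadlag_right_close[OF assms(2) 3, of "e/3"] \<open>e > 0\<close> by auto
      obtain r2 where r2: "r2 > t" "r2 \<le> b" "\<And>w. t \<le> w \<Longrightarrow> w < r2 \<Longrightarrow> \<bar>y w - y t\<bar> < e / 3"
        using cadlag_right_close[OF assms(3) 3, of "e/3"] \<open>e > 0\<close> by auto
      define r where "r = min r1 r2 - t"
      have r: "r > 0" "t + r \<le> r1" "t + r \<le> r2" using r1 r2 by (auto simp: r_def)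
      obtain l where l: "l \<in> time_changes a b"
        "\<And>t. t \<in> {a..b} \<Longrightarrow> \<bar>l t - t\<bar> < min (r/4) (e/3)" "\<And>t. t \<in> {a..b} \<Longrightarrow> \<bar>x t - y (l t)\<bar> < min (r/4) (e/3)"
        using skorokhod_less[OF assms(1-3), of "min (r/4) (e/3)"] \<open>e > 0\<close> r assms(4) by auto
      \<comment> \<open>The midpoint of an interval of length \<open>r\<close>: a displacement below
        \<open>r / 4\<close> keeps \<open>l w\<close> inside the interval.\<close>
      define w where "w = t + r/2"
      have w: "w \<in> {a..b}" "t \<le> w" "w < r1" using 3 r r1 by (auto simp: w_def)
      have "\<bar>l w - w\<bar> < r/4" using l(2)[OF w(1)] by simp
      then have lw: "t \<le> l w" "l w < r2" using r unfolding w_def by linarith+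
      show ?thesis
        using r1(3)[OF w(2,3)] r2(3)[OF lw] l(3)[OF w(1)] by linarith
    qed
    then have "\<bar>x t - y t\<bar> \<le> 0" by (rule field_le_epsilon[of _ 0, simplified])
    then show ?thesis by simp
  qed
qed

lemma Metric_space_skorokhod:
  assumes "a \<le> b"
  shows "Metric_space (cadlag a b) (skorokhod a b)"
proof
  fix x y z :: "real \<Rightarrow> real"
  show "0 \<le> skorokhod a b x y" using assms by (rule skorokhod_nonneg)
  show "skorokhod a b x y = skorokhod a b y x"
    unfolding skorokhod_def
    by (intro arg_cong[of _ _ Inf] equalityI skorokhod_set_commute_subset[OF assms])
  assume xy: "x \<in> cadlag a b" "y \<in> cadlag a b"
  have "skorokhod a b x x \<le> 0"
    by (rule skorokhod_le[OF assms time_changes_id]) auto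
  then show "skorokhod a b x y = 0 \<longleftrightarrow> x = y"
    using skorokhod_eqI[OF assms xy] skorokhod_nonneg[OF assms, of x x] by auto
  assume z: "z \<in> cadlag a b"
  show "skorokhod a b x z \<le> skorokhod a b x y + skorokhod a b y z"
  proof (rule field_le_epsilon)
    fix e :: real assume "e > 0"
    obtain l where l: "l \<in> time_changes a b"
      "\<And>t. t \<in> {a..b} \<Longrightarrow> \<bar>l t - t\<bar> < skorokhod a b x y + e/2"
      "\<And>t. t \<in> {a..b} \<Longrightarrow> \<bar>x t - y (l t)\<bar> < skorokhod a b x y + e/2"
      using skorokhod_less[OF assms xy, of "skorokhod a b x y + e/2"] \<open>e > 0\<close> by auto
    obtain m where m: "m \<in> time_changes a b"
      "\<And>t. t \<in> {a..b} \<Longrightarrow> \<bar>m t - t\<bar> < skorokhod a b y z + e/2"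
      "\<And>t. t \<in> {a..b} \<Longrightarrow> \<bar>y t - z (m t)\<bar> < skorokhod a b y z + e/2"
      using skorokhod_less[OF assms xy(2) z, of "skorokhod a b y z + e/2"] \<open>e > 0\<close> by auto
    show "skorokhod a b x z \<le> skorokhod a b x y + skorokhod a b y z + e"
    proof (rule skorokhod_le[OF assms time_changes_comp[OF l(1) m(1)]])
      fix t assume t: "t \<in> {a..b}"
      then have lt: "l t \<in> {a..b}" using time_changes_in[OF l(1)] by blast
      show "\<bar>m (l t) - t\<bar> \<le> skorokhod a b x y + skorokhod a b y z + e"
        using l(2)[OF t] m(2)[OF lt] by linarith
      show "\<bar>x t - z (m (l t))\<bar> \<le> skorokhod a b x y + skorokhod a b y z + e"
        using l(3)[OF t] m(3)[OF lt] by linarith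
    qed
  qed
qed

section \<open>Relative compactness in the Skorokhod topology\<close>

text \<open>The finite chain is continued constantly at \<open>b\<close>, so that partitions with
  different numbers of knots share one index set, as the extraction of subsequences
  requires.\<close>

lemma osc_chain_sequence:
  assumes "(osc_step x \<delta> e)\<^sup>*\<^sup>* a b" "\<delta> > 0"
  shows "\<exists>t. t 0 = a \<and> (\<forall>i. a \<le> t i \<and> t i \<le> b \<and> (t i < b \<longrightarrow> osc_step x \<delta> e (t i) (t (Suc i))))"
proof -
  obtain m f where f: "f 0 = a" "f m = b" "\<And>i. i < m \<Longrightarrow> osc_step x \<delta> e (f i) (f (Suc i))"
    using rtranclp_imp_relpowp[OF assms(1)] by (auto simp: relpowp_fun_conv)
  have inc: "f i \<le> f (Suc i)" if "i < m" for i
    using f(3)[OF that] \<open>\<delta> > 0\<close> by (auto simp: osc_step_def)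
  have lo: "a \<le> f i" if "i \<le> m" for i
    using that
  proof (induction i)
    case (Suc i)
    then show ?case using inc[of i] by simp
  qed (simp add: f)
  have hi: "f i \<le> b" if "i \<le> m" for i
    using that
  proof (induction rule: inc_induct)
    case (step i)
    then show ?case using inc[of i] by simp
  qed (simp add: f)
  show ?thesis
  proof (intro exI[of _ "\<lambda>i. f (min i m)"] conjI allI impI)
    fix i assume "f (min i m) < b"
    then have "i < m" using f(2) by (cases "i < m") auto
    then show "osc_step x \<delta> e (f (min i m)) (f (min (Suc i) m))"
      using f(3) by simp
  qed (use lo hi f in auto)
qed

section \<open>Locating points in a partition and moving its knots\<close>

lemma partition_locate:
  fixes t :: "nat \<Rightarrow> real"
  assumes "t 0 \<le> u" "u < t m"
  obtains i where "i < m" "t i \<le> u" "u < t (Suc i)"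
proof -
  define k where "k = (LEAST i. u < t i)"
  have k: "u < t k" "k \<le> m"
    using assms(2) by (auto simp: k_def intro: LeastI Least_le)
  then obtain i where i: "k = Suc i" using assms(1) by (cases k) auto
  have "\<not> u < t i" using not_less_Least[of i "\<lambda>i. u < t i"] i by (simp add: k_def)
  then show ?thesis using that[of i] k i by simp
qed

lemma partition_locate_left:
  fixes t :: "nat \<Rightarrow> real"
  assumes "t 0 < u" "u \<le> t m"
  obtains i where "i < m" "t i < u" "u \<le> t (Suc i)"
proof -
  define k where "k = (LEAST i. u \<le> t i)"
  have k: "u \<le> t k" "k \<le> m"
    using assms(2) by (auto simp: k_def intro: LeastI Least_le)
  then obtain i where i: "k = Suc i" using assms(1) by (cases k) auto
  have "\<not> u \<le> t i" using not_less_Least[of i "\<lambda>i. u \<le> t i"] i by (simp add: k_def)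
  then show ?thesis using that[of i] k i by simp
qed

text \<open>The time change moves the knots \<open>t i\<close> to \<open>T i\<close> by adding hat functions of width
  \<open>\<delta>\<close>; it is strictly increasing because the total displacement is less than \<open>\<delta>\<close>.\<close>

lemma time_change_moving_knots:
  fixes t T :: "nat \<Rightarrow> real"
  assumes "\<delta> > 0" and ends: "t 0 = a" "T 0 = a" "t m = b" "T m = b"
    and gap: "\<And>i. i < m \<Longrightarrow> t i + \<delta> \<le> t (Suc i)"
    and small: "(\<Sum>i\<le>m. \<bar>T i - t i\<bar>) < \<delta>"
  obtains l where "l \<in> time_changes a b" "\<And>i. i \<le> m \<Longrightarrow> l (t i) = T i"
    "\<And>u. \<bar>l u - u\<bar> \<le> (\<Sum>i\<le>m. \<bar>T i - t i\<bar>)"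
proof -
  define hat where "hat v = max 0 (1 - \<bar>v\<bar>)" for v :: real
  define c where "c i = T i - t i" for i
  define g where "g u = (\<Sum>i\<le>m. c i * hat ((u - t i) / \<delta>))" for u
  define l where "l u = u + g u" for u
  have hat_lip: "\<bar>hat v - hat w\<bar> \<le> \<bar>v - w\<bar>" for v w
    unfolding hat_def by linarith
  have hat01: "0 \<le> hat v" "hat v \<le> 1" for v
    unfolding hat_def by auto
  have sep: "t i + \<delta> \<le> t j" if "i < j" "j \<le> m" for i j
    using that
  proof (induction j)
    case (Suc j)
    then show ?case using gap[of j] \<open>\<delta> > 0\<close> by (cases "i = j") auto
  qed simp
  have hat_knot: "hat ((t j - t i) / \<delta>) = (if i = j then 1 else 0)" if "i \<le> m" "j \<le> m" for i j
  proof (cases "i = j")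
    case False
    then have "\<delta> \<le> \<bar>t j - t i\<bar>"
      using sep[of i j] sep[of j i] that by (cases "i < j") auto
    then have "1 \<le> \<bar>(t j - t i) / \<delta>\<bar>"
      using \<open>\<delta> > 0\<close> by (simp add: field_simps)
    then show ?thesis using False by (simp add: hat_def)
  qed (simp add: hat_def)
  have l_knot: "l (t j) = T j" if "j \<le> m" for j
  proof -
    have "g (t j) = (\<Sum>i\<le>m. if i = j then c i else 0)"
      unfolding g_def using that by (intro sum.cong) (auto simp: hat_knot)
    also have "\<dots> = c j" using that by simp
    finally show ?thesis by (simp add: l_def c_def)
  qed
  define s where "s = (\<Sum>i\<le>m. \<bar>c i\<bar>)"
  have g_small: "\<bar>g u\<bar> \<le> s" for u
    unfolding g_def s_def
    by (intro order_trans[OF sum_abs] sum_mono) (auto simp: abs_mult hat01 intro!: mult_left_le)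
  have g_lip: "\<bar>g v - g w\<bar> \<le> s * (\<bar>v - w\<bar> / \<delta>)" for v w
  proof -
    have "g v - g w = (\<Sum>i\<le>m. c i * (hat ((v - t i) / \<delta>) - hat ((w - t i) / \<delta>)))"
      unfolding g_def by (simp add: sum_subtractf right_diff_distrib)
    also have "\<bar>\<dots>\<bar> \<le> (\<Sum>i\<le>m. \<bar>c i\<bar> * (\<bar>v - w\<bar> / \<delta>))"
    proof (intro order_trans[OF sum_abs] sum_mono)
      fix i
      have "\<bar>hat ((v - t i) / \<delta>) - hat ((w - t i) / \<delta>)\<bar> \<le> \<bar>(v - t i) / \<delta> - (w - t i) / \<delta>\<bar>"
        by (rule hat_lip)
      also have "\<dots> = \<bar>v - w\<bar> / \<delta>"
        using \<open>\<delta> > 0\<close> by (simp flip: diff_divide_distrib)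
      finally show "\<bar>c i * (hat ((v - t i) / \<delta>) - hat ((w - t i) / \<delta>))\<bar> \<le> \<bar>c i\<bar> * (\<bar>v - w\<bar> / \<delta>)"
        unfolding abs_mult by (intro mult_left_mono) auto
    qed
    also have "\<dots> = s * (\<bar>v - w\<bar> / \<delta>)"
      unfolding s_def by (rule sum_distrib_right[symmetric])
    finally show ?thesis .
  qed
  have "s < \<delta>" using small by (simp add: s_def c_def)
  have mono: "l v < l w" if "v < w" for v w
  proof -
    have "\<bar>g v - g w\<bar> \<le> (s / \<delta>) * (w - v)" using g_lip[of v w] that by (simp add: field_simps)
    also have "\<dots> < 1 * (w - v)"
      using that \<open>s < \<delta>\<close> \<open>\<delta> > 0\<close> by (intro mult_strict_right_mono) auto
    finally have "\<bar>g v - g w\<bar> < w - v" by simp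
    then show ?thesis unfolding l_def by linarith
  qed
  have cont: "continuous_on {a..b} l"
    unfolding l_def g_def hat_def using \<open>\<delta> > 0\<close> by (intro continuous_intros) auto
  have la: "l a = a" using l_knot[of 0] ends by simp
  have lb: "l b = b" using l_knot[of m] ends by simp
  have mono_le: "l v \<le> l w" if "v \<le> w" for v w
    using mono[of v w] that by (cases "v = w") auto
  have ab: "a \<le> b"
    using sep[of 0 m] ends \<open>\<delta> > 0\<close> by (cases "m = 0") auto
  have "l ` {a..b} = {a..b}"
  proof
    show "l ` {a..b} \<subseteq> {a..b}"
    proof clarify
      fix v assume v: "v \<in> {a..b}"
      show "l v \<in> {a..b}"
        using mono_le[of a v] mono_le[of v b] v la lb by simp
    qed
    show "{a..b} \<subseteq> l ` {a..b}"
    proof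
      fix v assume v: "v \<in> {a..b}"
      then obtain w where "a \<le> w" "w \<le> b" "l w = v"
        using IVT'[of l a v b] la lb ab cont by auto
      then show "v \<in> l ` {a..b}" by auto
    qed
  qed
  then have "l \<in> time_changes a b"
    using mono cont by (auto simp: time_changes_def intro!: strict_mono_onI)
  moreover have "\<bar>l u - u\<bar> \<le> (\<Sum>i\<le>m. \<bar>T i - t i\<bar>)" for u
    using g_small[of u] by (simp add: l_def s_def c_def)
  ultimately show ?thesis using that l_knot by blast
qed

lemma left_limit_exists:
  fixes x :: "real \<Rightarrow> real"
  assumes "\<And>e. e > 0 \<Longrightarrow> \<exists>s<u. \<forall>v w. s < v \<and> v < u \<and> s < w \<and> w < u \<longrightarrow> \<bar>x v - x w\<bar> < e"
  shows "\<exists>l. (x \<longlongrightarrow> l) (at_left u)"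
proof -
  have "cauchy_filter (filtermap x (at_left u))"
    unfolding cauchy_filter_metric_filtermap
  proof (intro allI impI)
    fix e :: real assume "e > 0"
    then obtain s where s: "s < u" "\<forall>v w. s < v \<and> v < u \<and> s < w \<and> w < u \<longrightarrow> \<bar>x v - x w\<bar> < e"
      using assms by blast
    have "eventually (\<lambda>v. s < v \<and> v < u) (at_left u)"
      using s(1) by (auto simp: eventually_at_left_field)
    then show "\<exists>P. eventually P (at_left u) \<and> (\<forall>v w. P v \<and> P w \<longrightarrow> dist (x v) (x w) < e)"
      using s(2) by (intro exI[of _ "\<lambda>v. s < v \<and> v < u"]) (auto simp: dist_real_def)
  qed
  then have "\<exists>l. filtermap x (at_left u) \<le> nhds l"
    by (rule cauchy_filter_complete_converges[where A=UNIV]) (auto simp: filtermap_bot_iff complete_UNIV)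
  then show ?thesis by (simp add: filterlim_def)
qed

text \<open>Along a subsequence, all partition points and all values of \<open>y n\<close> at them converge. The
  limiting values pin down the limit function up to \<open>e j\<close> on the intervals of the \<open>j\<close>-th limiting
  partition, so no completeness of the metric is needed.\<close>

lemma osc_chain_convergent_subsequence:
  fixes y :: "nat \<Rightarrow> real \<Rightarrow> real"
  assumes ab: "a < b" and bd: "\<And>n u. u \<in> {a..b} \<Longrightarrow> \<bar>y n u\<bar> \<le> L"
    and \<delta>: "\<And>j. \<delta> j > 0" and e: "e \<longlonglongrightarrow> 0"
    and chain: "\<And>n j. (osc_step (y n) (\<delta> j) (e j))\<^sup>*\<^sup>* a b"
  obtains x r where "x \<in> cadlag a b" "strict_mono r" "(\<lambda>n. skorokhod a b (y (r n)) x) \<longlonglongrightarrow> 0"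
proof -
  have "\<forall>n j. \<exists>t. t 0 = a \<and> (\<forall>i. a \<le> t i \<and> t i \<le> b \<and>
      (t i < b \<longrightarrow> osc_step (y n) (\<delta> j) (e j) (t i) (t (Suc i))))"
    using osc_chain_sequence[OF chain \<delta>] by blast
  then obtain t0 where t0: "\<And>n j. t0 n j 0 = a" "\<And>n j i. a \<le> t0 n j i" "\<And>n j i. t0 n j i \<le> b"
    "\<And>n j i. t0 n j i < b \<Longrightarrow> osc_step (y n) (\<delta> j) (e j) (t0 n j i) (t0 n j (Suc i))"
    by metis
  \<comment> \<open>Knots and values at knots are packed into one bounded family over a countable
    index type, so a single diagonal extraction makes all of them converge.\<close>
  define f where "f n p = (case p of (j, i, c) \<Rightarrow> if c then t0 n j i else y n (t0 n j i))"
    for n and p :: "nat \<times> nat \<times> bool"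
  have f_bd: "norm (f n p) \<le> max (max \<bar>a\<bar> \<bar>b\<bar>) L" for n p
  proof (cases p)
    case (fields j i c)
    have "\<bar>t0 n j i\<bar> \<le> max \<bar>a\<bar> \<bar>b\<bar>" "\<bar>y n (t0 n j i)\<bar> \<le> L"
      using t0(2,3)[of n j i] bd[of "t0 n j i" n] by auto
    then show ?thesis by (auto simp: f_def fields le_max_iff_disj)
  qed
  obtain r where r: "strict_mono (r :: nat \<Rightarrow> nat)" "\<And>p. \<exists>l. (\<lambda>n. f (r n) p) \<longlonglongrightarrow> l"
    by (rule function_convergent_subsequence[of UNIV f, OF _ f_bd]) auto
  define t where "t n = t0 (r n)" for n
  define z where "z n = y (r n)" for n
  have "\<exists>l. (\<lambda>n. t n j i) \<longlonglongrightarrow> l" for j i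
    using r(2)[of "(j, i, True)"] by (simp add: f_def t_def)
  then obtain T where T: "\<And>j i. (\<lambda>n. t n j i) \<longlonglongrightarrow> T j i" by metis
  have "\<exists>l. (\<lambda>n. z n (t n j i)) \<longlonglongrightarrow> l" for j i
    using r(2)[of "(j, i, False)"] by (simp add: f_def t_def z_def)
  then obtain V where V: "\<And>j i. (\<lambda>n. z n (t n j i)) \<longlonglongrightarrow> V j i" by metis
  have t: "t n j 0 = a" "a \<le> t n j i" "t n j i \<le> b" for n j i
    using t0 by (auto simp: t_def)
  have t_step: "t n j i + \<delta> j \<le> t n j (Suc i)"
    and t_osc: "\<And>w. t n j i \<le> w \<Longrightarrow> w < t n j (Suc i) \<Longrightarrow> \<bar>z n w - z n (t n j i)\<bar> \<le> e j"
    if "t n j i < b" for n j i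
    using t0(4)[of "r n" j i] that by (auto simp: t_def z_def osc_step_def)
  have T0: "T j 0 = a" for j
    using LIMSEQ_unique[OF T[of j 0]] t(1) by simp
  have T_ge: "a \<le> T j i" and T_le: "T j i \<le> b" for j i
    using LIMSEQ_le_const[OF T[of j i], of a] LIMSEQ_le_const2[OF T[of j i], of b] t by auto
  have T_step: "T j i + \<delta> j \<le> T j (Suc i)" if "T j i < b" for j i
  proof (rule tendsto_le[OF _ T tendsto_add[OF T tendsto_const]])
    have "eventually (\<lambda>n. t n j i < b) sequentially"
      using order_tendstoD(2)[OF T that] .
    then show "eventually (\<lambda>n. t n j i + \<delta> j \<le> t n j (Suc i)) sequentially"
      by (rule eventually_mono) (rule t_step)
  qed simp
  \<comment> \<open>Within \<open>\<delta> j\<close> of \<open>b\<close> there is no room for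
    another step, so a knot converging to \<open>b\<close> is equal to \<open>b\<close> for large
    \<open>n\<close>. Thus the \<open>n\<close>-th and the limiting partition eventually have
    equally many intervals.\<close>
  have T_eq_b: "eventually (\<lambda>n. t n j i = b) sequentially" if "T j i = b" for j i
  proof -
    have "eventually (\<lambda>n. b - \<delta> j < t n j i) sequentially"
      using \<delta> that by (intro order_tendstoD(1)[OF T]) auto
    then show ?thesis
    proof (rule eventually_mono)
      fix n assume "b - \<delta> j < t n j i"
      then show "t n j i = b"
        using t_step[of n j i] t(3)[of n j i] t(3)[of n j "Suc i"] by linarith
    qed
  qed
  have "\<exists>i. T j i = b" for j
  proof (rule ccontr)
    assume "\<nexists>i. T j i = b"
    then have lt: "T j i < b" for i using T_le[of j i] by (metis less_le)
    have "a + real i * \<delta> j \<le> T j i" for i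
    proof (induction i)
      case (Suc i)
      then show ?case using T_step[OF lt, of i] by (simp add: algebra_simps)
    qed (simp add: T0)
    moreover obtain i where "b - a < real i * \<delta> j"
      using reals_Archimedean3[OF \<delta>[of j]] by blast
    ultimately show False using lt[of i] by (smt (verit))
  qed
  then have m_ex: "\<exists>m. T j m = b \<and> (\<forall>i<m. T j i \<noteq> b)" for j
    using exists_least_iff[of "\<lambda>i. T j i = b"] by auto
  then obtain m where m: "\<And>j. T j (m j) = b" "\<And>j i. i < m j \<Longrightarrow> T j i \<noteq> b" by metis
  have m_less: "T j i < b" if "i < m j" for j i
    using m(2)[OF that] T_le[of j i] by simp
  have near: "\<bar>V j i - V j' i'\<bar> \<le> e j + e j'"
    if h: "i < m j" "T j i \<le> u" "u < T j (Suc i)" "i' < m j'" "T j' i' \<le> u" "u < T j' (Suc i')" for u j i j' i'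
  proof -
    \<comment> \<open>The point \<open>u\<close> may be a limiting knot and lie in a neighbouring
      interval of the \<open>n\<close>-th partition for every \<open>n\<close>. A point strictly
      inside both limiting intervals does not, once \<open>n\<close> is large.\<close>
    obtain w where w: "u < w" "w < min (T j (Suc i)) (T j' (Suc i'))"
      using dense[of u "min (T j (Suc i)) (T j' (Suc i'))"] h by auto
    have wb: "w < b" using w T_le[of j "Suc i"] by simp
    have "eventually (\<lambda>n. t n j i < w) sequentially" "eventually (\<lambda>n. w < t n j (Suc i)) sequentially"
      "eventually (\<lambda>n. t n j' i' < w) sequentially" "eventually (\<lambda>n. w < t n j' (Suc i')) sequentially"
      using w h by (auto intro!: order_tendstoD[OF T])
    then have "eventually (\<lambda>n. \<bar>z n (t n j i) - z n (t n j' i')\<bar> \<le> e j + e j') sequentially"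
    proof eventually_elim
      case (elim n)
      then show ?case
        using t_osc[of n j i w] t_osc[of n j' i' w] wb by linarith
    qed
    then show ?thesis
      by (intro tendsto_upperbound[OF tendsto_rabs[OF tendsto_diff[OF V V]]]) auto
  qed
  \<comment> \<open>The value at \<open>u\<close> is the limit over \<open>j\<close> of the values
    on the intervals that contain \<open>u\<close>; these are Cauchy by \<open>near\<close>, as
    \<open>e\<close> tends to 0.\<close>
  have "\<exists>c. \<forall>j i. i < m j \<and> T j i \<le> u \<and> u < T j (Suc i) \<longrightarrow> \<bar>c - V j i\<bar> \<le> e j"
    if u: "a \<le> u" "u < b" for u
  proof -
    have "\<forall>j. \<exists>i. i < m j \<and> T j i \<le> u \<and> u < T j (Suc i)"
    proof
      fix j
      show "\<exists>i. i < m j \<and> T j i \<le> u \<and> u < T j (Suc i)"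
        using partition_locate[of "T j" u "m j"] u T0 m(1) by metis
    qed
    then obtain \<iota> where \<iota>: "\<And>j. \<iota> j < m j" "\<And>j. T j (\<iota> j) \<le> u" "\<And>j. u < T j (Suc (\<iota> j))"
      by metis
    have "Cauchy (\<lambda>j. V j (\<iota> j))"
    proof (rule metric_CauchyI)
      fix s :: real assume "s > 0"
      then obtain N where N: "\<And>j. j \<ge> N \<Longrightarrow> e j < s / 2"
        using order_tendstoD(2)[OF e, of "s/2"] by (auto simp: eventually_sequentially)
      have "dist (V j (\<iota> j)) (V k (\<iota> k)) < s" if "j \<ge> N" "k \<ge> N" for j k
        using near[of "\<iota> j" j u "\<iota> k" k] \<iota> N[OF that(1)] N[OF that(2)]
        by (auto simp: dist_real_def)
      then show "\<exists>N. \<forall>j\<ge>N. \<forall>k\<ge>N. dist (V j (\<iota> j)) (V k (\<iota> k)) < s" by blast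
    qed
    then obtain c where c: "(\<lambda>j. V j (\<iota> j)) \<longlonglongrightarrow> c"
      using Cauchy_convergent_iff convergent_def by blast
    have "\<bar>c - V j i\<bar> \<le> e j" if "i < m j" "T j i \<le> u" "u < T j (Suc i)" for j i
    proof -
      have "(\<lambda>k. e k + e j) \<longlonglongrightarrow> 0 + e j" by (intro tendsto_intros e)
      moreover have "(\<lambda>k. \<bar>V k (\<iota> k) - V j i\<bar>) \<longlonglongrightarrow> \<bar>c - V j i\<bar>" by (intro tendsto_intros c)
      moreover have "\<forall>k. \<bar>V k (\<iota> k) - V j i\<bar> \<le> e k + e j" using near \<iota> that by blast
      ultimately show ?thesis by (auto intro: LIMSEQ_le)
    qed
    then show ?thesis by blast
  qed
  then obtain X where X: "\<And>u j i. a \<le> u \<Longrightarrow> u < b \<Longrightarrow> i < m j \<Longrightarrow> T j i \<le> u \<Longrightarrow> u < T j (Suc i) \<Longrightarrow> \<bar>X u - V j i\<bar> \<le> e j"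
    by metis
  \<comment> \<open>The half-open limiting intervals leave out \<open>b\<close>. Every
    \<open>j\<close> yields the same value there, the limit of \<open>z n b\<close>, so the index 0
    is an arbitrary choice.\<close>
  define x where "x u = (if u = b then V 0 (m 0) else if a \<le> u \<and> u < b then X u else 0)" for u
  have xV: "\<bar>x u - V j i\<bar> \<le> e j" if "i < m j" "T j i \<le> u" "u < T j (Suc i)" for u j i
    using X[of u i j] that T_ge[of j i] T_le[of j "Suc i"] by (simp add: x_def)
  have xb: "x b = V j (m j)" for j
  proof -
    have "(\<lambda>n. z n b) \<longlonglongrightarrow> V j (m j)" for j
    proof (rule Lim_transform_eventually[OF V[of j "m j"]])
      show "\<forall>\<^sub>F n in sequentially. z n (t n j (m j)) = z n b"
        using T_eq_b[OF m(1)[of j]] by (rule eventually_mono) simp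
    qed
    then have "V 0 (m 0) = V j (m j)" using LIMSEQ_unique by blast
    then show ?thesis by (simp add: x_def)
  qed
  have "x \<in> cadlag a b"
    unfolding cadlag_def
  proof (intro CollectI conjI ballI allI impI)
    fix u assume "u \<notin> {a..b}" then show "x u = 0" using ab by (auto simp: x_def)
  next
    fix u assume u: "u \<in> {a..<b}"
    show "(x \<longlongrightarrow> x u) (at_right u)"
    proof (rule tendstoI)
      fix s :: real assume "s > 0"
      then obtain j where j: "e j < s / 2"
        using order_tendstoD(2)[OF e, of "s/2"] by (auto simp: eventually_sequentially)
      obtain i where i: "i < m j" "T j i \<le> u" "u < T j (Suc i)"
        using partition_locate[of "T j" u "m j"] u T0 m(1) by auto
      have "dist (x w) (x u) < s" if "u < w" "w < T j (Suc i)" for w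
        using xV[OF i] xV[of i j w] i that j by (auto simp: dist_real_def)
      then show "eventually (\<lambda>w. dist (x w) (x u) < s) (at_right u)"
        using i(3) by (auto simp: eventually_at_right_field)
    qed
  next
    fix u assume u: "u \<in> {a<..b}"
    show "\<exists>l. (x \<longlongrightarrow> l) (at_left u)"
    proof (rule left_limit_exists)
      fix s :: real assume "s > 0"
      then obtain j where j: "e j < s / 2"
        using order_tendstoD(2)[OF e, of "s/2"] by (auto simp: eventually_sequentially)
      obtain i where i: "i < m j" "T j i < u" "u \<le> T j (Suc i)"
        using partition_locate_left[of "T j" u "m j"] u T0 m(1) by auto
      have "\<bar>x v - x w\<bar> < s" if "T j i < v" "v < u" "T j i < w" "w < u" for v w
        using xV[of i j v] xV[of i j w] i that j by auto
      then show "\<exists>p<u. \<forall>v w. p < v \<and> v < u \<and> p < w \<and> w < u \<longrightarrow> \<bar>x v - x w\<bar> < s"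
        using i(2) by blast
    qed
  qed
  moreover have "(\<lambda>n. skorokhod a b (z n) x) \<longlonglongrightarrow> 0"
  proof (rule tendstoI)
    fix s :: real assume "s > 0"
    \<comment> \<open>The comparison below spends \<open>e j\<close> twice and a knot error of
      \<open>s / 4\<close>, together less than \<open>s / 2\<close>.\<close>
    then obtain j where j: "e j < s / 8"
      using order_tendstoD(2)[OF e, of "s/8"] by (auto simp: eventually_sequentially)
    have "(\<lambda>n. \<Sum>i\<le>m j. \<bar>T j i - t n j i\<bar>) \<longlonglongrightarrow> (\<Sum>i\<le>m j. \<bar>T j i - T j i\<bar>)"
      by (intro tendsto_intros T)
    then have "eventually (\<lambda>n. (\<Sum>i\<le>m j. \<bar>T j i - t n j i\<bar>) < min (\<delta> j) (s / 2)) sequentially"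
      using \<delta> \<open>s > 0\<close> by (intro order_tendstoD(2)) auto
    moreover have "eventually (\<lambda>n. \<forall>i\<in>{..m j}. \<bar>z n (t n j i) - V j i\<bar> < s / 4) sequentially"
    proof (rule eventually_ball_finite)
      show "\<forall>i\<in>{..m j}. eventually (\<lambda>n. \<bar>z n (t n j i) - V j i\<bar> < s / 4) sequentially"
        using tendstoD[OF V, of "s/4"] \<open>s > 0\<close> by (simp add: dist_real_def)
    qed simp
    moreover have "eventually (\<lambda>n. \<forall>i\<in>{..<m j}. t n j i < b) sequentially"
      by (rule eventually_ball_finite) (auto intro: order_tendstoD(2)[OF T m_less])
    moreover have "eventually (\<lambda>n. t n j (m j) = b) sequentially"
      by (rule T_eq_b[OF m(1)])
    ultimately show "eventually (\<lambda>n. dist (skorokhod a b (z n) x) 0 < s) sequentially"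
    proof eventually_elim
      case (elim n)
      \<comment> \<open>\<open>l\<close> carries the \<open>n\<close>-th partition onto the limiting
        one, so that \<open>u\<close> and \<open>l u\<close> lie in intervals of the same
        index.\<close>
      obtain l where l: "l \<in> time_changes a b" "\<And>i. i \<le> m j \<Longrightarrow> l (t n j i) = T j i"
        "\<And>u. \<bar>l u - u\<bar> \<le> (\<Sum>i\<le>m j. \<bar>T j i - t n j i\<bar>)"
        using time_change_moving_knots[of "\<delta> j" "t n j" a "T j" "m j" b] \<delta> t(1) T0 m(1) elim t_step
        by auto
      have mono: "l v \<le> l w" if "a \<le> v" "v \<le> w" "w \<le> b" for v w
        using l(1) that unfolding time_changes_def by (auto intro: strict_mono_on_leD)
      have smono: "l v < l w" if "a \<le> v" "v < w" "w \<le> b" for v w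
        using l(1) that unfolding time_changes_def by (auto intro: strict_mono_onD)
      have "skorokhod a b (z n) x \<le> s / 2"
      proof (rule skorokhod_le[OF _ l(1)])
        show "a \<le> b" using ab by simp
        fix u assume u: "u \<in> {a..b}"
        show "\<bar>l u - u\<bar> \<le> s / 2" using l(3)[of u] elim(1) by linarith
        show "\<bar>z n u - x (l u)\<bar> \<le> s / 2"
        proof (cases "u = b")
          case True
          then have "l u = b" using l(2)[of "m j"] elim(4) m(1) by simp
          moreover have "\<bar>z n b - V j (m j)\<bar> < s / 4" using elim(2,4) by fastforce
          ultimately show ?thesis using xb[of j] True \<open>s > 0\<close> by simp
        next
          case False
          then obtain i where i: "i < m j" "t n j i \<le> u" "u < t n j (Suc i)"
            using partition_locate[of "t n j" u "m j"] u t(1) elim(4) by auto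
          have "T j i \<le> l u" "l u < T j (Suc i)"
            using mono[of "t n j i" u] smono[of u "t n j (Suc i)"] i l(2)[of i] l(2)[of "Suc i"] t u by auto
          then have "\<bar>x (l u) - V j i\<bar> \<le> e j" using xV i by blast
          moreover have "\<bar>z n u - z n (t n j i)\<bar> \<le> e j" using t_osc i elim(3) by blast
          moreover have "\<bar>z n (t n j i) - V j i\<bar> < s / 4" using elim(2) i by auto
          ultimately show ?thesis using j by linarith
        qed
      qed
      then show ?case
        using \<open>s > 0\<close> skorokhod_nonneg[of a b "z n" x] ab by (simp add: dist_real_def)
    qed
  qed
  ultimately show ?thesis using that r(1) unfolding z_def by blast
qed

text \<open>The limit of a subsequence is only known to be cadlag, not to lie in \<open>A\<close>,
  hence the closure. What makes \<open>A\<close> relatively compact is that \<delta> and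
  \<open>e\<close> depend on \<open>j\<close> alone and not on the function.\<close>

lemma compactin_closure_osc_chain:
  assumes "a < b" and \<delta>: "\<And>j. \<delta> j > 0" and e: "e \<longlonglongrightarrow> 0"
    and A: "A \<subseteq> {x \<in> cadlag a b. (\<forall>u\<in>{a..b}. \<bar>x u\<bar> \<le> L) \<and> (\<forall>j::nat. (osc_step x (\<delta> j) (e j))\<^sup>*\<^sup>* a b)}"
  shows "compactin (skorokhod_topology a b) (skorokhod_topology a b closure_of A)"
proof -
  interpret Metric_space "cadlag a b" "skorokhod a b"
    using assms by (intro Metric_space_skorokhod) auto
  have "\<exists>l r. l \<in> cadlag a b \<and> strict_mono r \<and> limitin mtopology (\<sigma> \<circ> r) l sequentially"
    if "range \<sigma> \<subseteq> A" for \<sigma> :: "nat \<Rightarrow> real \<Rightarrow> real"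
  proof -
    have \<sigma>: "\<sigma> n \<in> cadlag a b" "u \<in> {a..b} \<Longrightarrow> \<bar>\<sigma> n u\<bar> \<le> L" "(osc_step (\<sigma> n) (\<delta> j) (e j))\<^sup>*\<^sup>* a b" for n u j
      using that A by blast+
    obtain x r where "x \<in> cadlag a b" "strict_mono r" "(\<lambda>n. skorokhod a b (\<sigma> (r n)) x) \<longlonglongrightarrow> 0"
      by (rule osc_chain_convergent_subsequence[OF \<open>a < b\<close> _ \<delta> e \<sigma>(3)]) (rule \<sigma>(2))
    then show ?thesis
      using \<sigma>(1) by (auto simp: limitin_metric_dist_null o_def)
  qed
  moreover have "A \<subseteq> cadlag a b" using A by blast
  ultimately show ?thesis
    unfolding skorokhod_topology_def compact_closure_of_eq_Bolzano_Weierstrass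
    using Bolzano_Weierstrass_property[of A "cadlag a b"] by blast
qed

section \<open>A tightness criterion\<close>

lemma finite_perms: "finite (perms n)"
  by (simp add: perms_def finite_permutations)

lemma card_perms_pos: "card (perms n) > 0"
proof -
  have "id \<in> perms n" by (simp add: perms_def permutes_id)
  then show ?thesis using finite_perms by (auto simp: card_gt_0_iff)
qed

lemma card_perms_mono:
  assumes "\<And>\<sigma>. \<sigma> \<in> perms n \<Longrightarrow> P \<sigma> \<Longrightarrow> Q \<sigma>"
  shows "card {\<sigma>\<in>perms n. P \<sigma>} \<le> card {\<sigma>\<in>perms n. Q \<sigma>}"
  using assms finite_perms by (intro card_mono) auto

lemma finite_uniform_real:
  fixes P :: "'a \<Rightarrow> real \<Rightarrow> bool"
  assumes "finite F" "\<And>p. p \<in> F \<Longrightarrow> \<exists>c>0. P p c" and mono: "\<And>p c c'. P p c \<Longrightarrow> c' \<le> c \<Longrightarrow> P p c'"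
  shows "\<exists>c>0. \<forall>p\<in>F. P p c"
  using assms(1,2)
proof (induction F)
  case empty
  then show ?case by (auto intro: exI[of _ 1])
next
  case (insert q F)
  then obtain c c' where "c > 0" "\<forall>p\<in>F. P p c" "c' > 0" "P q c'" by blast
  then show ?case by (intro exI[of _ "min c c'"]) (auto intro: mono)
qed

text \<open>Bounds for large \<open>n\<close> suffice: the remaining \<open>n\<close> involve
  finitely many paths, each of them bounded and with an oscillation chain of its own, so it is
  enough to enlarge \<open>L\<close> and shrink \<delta>.\<close>

lemma tight_permI:
  assumes ab: "a < b" and X: "\<And>n \<sigma>. \<sigma> \<in> perms n \<Longrightarrow> X n \<sigma> \<in> cadlag a b"
    and bdd: "\<And>\<eta>. \<eta> > 0 \<Longrightarrow> \<exists>L. \<forall>\<^sub>F n in sequentially.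
      real (card {\<sigma>\<in>perms n. \<not> (\<forall>u\<in>{a..b}. \<bar>X n \<sigma> u\<bar> \<le> L)}) \<le> \<eta> * real (card (perms n))"
    and osc: "\<And>e \<eta>. e > 0 \<Longrightarrow> \<eta> > 0 \<Longrightarrow> \<exists>\<delta>>0. \<forall>\<^sub>F n in sequentially.
      real (card {\<sigma>\<in>perms n. \<not> (osc_step (X n \<sigma>) \<delta> e)\<^sup>*\<^sup>* a b}) \<le> \<eta> * real (card (perms n))"
  shows "tight_perm a b X"
proof -
  have bdd_all: "\<exists>L. \<forall>n. real (card {\<sigma>\<in>perms n. \<not> (\<forall>u\<in>{a..b}. \<bar>X n \<sigma> u\<bar> \<le> L)}) \<le> \<eta> * real (card (perms n))"
    if \<eta>: "\<eta> > 0" for \<eta> :: real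
  proof -
    obtain L N where N: "\<And>n. n \<ge> N \<Longrightarrow>
        real (card {\<sigma>\<in>perms n. \<not> (\<forall>u\<in>{a..b}. \<bar>X n \<sigma> u\<bar> \<le> L)}) \<le> \<eta> * real (card (perms n))"
      using bdd[OF \<eta>] by (auto simp: eventually_sequentially)
    have "\<exists>B. \<forall>u. \<bar>X n \<sigma> u\<bar> \<le> B" if "\<sigma> \<in> perms n" for n \<sigma>
      using cadlag_bounded[OF X[OF that]] ab by (metis less_imp_le)
    then have "\<forall>n \<sigma>. \<exists>B. \<sigma> \<in> perms n \<longrightarrow> (\<forall>u. \<bar>X n \<sigma> u\<bar> \<le> B)" by blast
    then obtain B where B: "\<And>n \<sigma> u. \<sigma> \<in> perms n \<Longrightarrow> \<bar>X n \<sigma> u\<bar> \<le> B n \<sigma>"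
      unfolding choice_iff by blast
    define L' where "L' = \<bar>L\<bar> + (\<Sum>n<N. \<Sum>\<sigma>\<in>perms n. \<bar>B n \<sigma>\<bar>)"
    have L': "L \<le> L'"
      by (auto simp: L'_def intro!: add_increasing2 sum_nonneg)
    have small: "\<bar>X n \<sigma> u\<bar> \<le> L'" if "n < N" "\<sigma> \<in> perms n" for n \<sigma> u
    proof -
      have "\<bar>X n \<sigma> u\<bar> \<le> \<bar>B n \<sigma>\<bar>" using B[OF that(2), of u] by linarith
      also have "\<dots> \<le> (\<Sum>\<sigma>\<in>perms n. \<bar>B n \<sigma>\<bar>)"
        using that finite_perms by (intro member_le_sum) auto
      also have "\<dots> \<le> (\<Sum>n<N. \<Sum>\<sigma>\<in>perms n. \<bar>B n \<sigma>\<bar>)"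
        using that by (intro member_le_sum[where f="\<lambda>n. \<Sum>\<sigma>\<in>perms n. \<bar>B n \<sigma>\<bar>"]) (auto intro: sum_nonneg)
      finally show ?thesis by (simp add: L'_def)
    qed
    show ?thesis
    proof (intro exI[of _ L'] allI)
      fix n
      show "real (card {\<sigma>\<in>perms n. \<not> (\<forall>u\<in>{a..b}. \<bar>X n \<sigma> u\<bar> \<le> L')}) \<le> \<eta> * real (card (perms n))"
      proof (cases "n < N")
        case True
        then have "{\<sigma>\<in>perms n. \<not> (\<forall>u\<in>{a..b}. \<bar>X n \<sigma> u\<bar> \<le> L')} = {}" using small by blast
        then show ?thesis using \<eta> by (simp only: card.empty) simp
      next
        case False
        have "card {\<sigma>\<in>perms n. \<not> (\<forall>u\<in>{a..b}. \<bar>X n \<sigma> u\<bar> \<le> L')}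
            \<le> card {\<sigma>\<in>perms n. \<not> (\<forall>u\<in>{a..b}. \<bar>X n \<sigma> u\<bar> \<le> L)}"
          using L' by (intro card_perms_mono) (meson order_trans)
        then show ?thesis using N[of n] False by linarith
      qed
    qed
  qed
  have osc_all: "\<exists>\<delta>>0. \<forall>n. real (card {\<sigma>\<in>perms n. \<not> (osc_step (X n \<sigma>) \<delta> e)\<^sup>*\<^sup>* a b}) \<le> \<eta> * real (card (perms n))"
    if \<eta>: "e > 0" "\<eta> > 0" for e \<eta> :: real
  proof -
    obtain \<delta> N where \<delta>: "\<delta> > 0" and N: "\<And>n. n \<ge> N \<Longrightarrow>
        real (card {\<sigma>\<in>perms n. \<not> (osc_step (X n \<sigma>) \<delta> e)\<^sup>*\<^sup>* a b}) \<le> \<eta> * real (card (perms n))"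
      using osc[OF \<eta>] by (auto simp: eventually_sequentially)
    have "\<exists>c>0. \<forall>p\<in>Sigma {..<N} perms. (osc_step (X (fst p) (snd p)) c e)\<^sup>*\<^sup>* a b"
    proof (rule finite_uniform_real)
      show "finite (Sigma {..<N} perms)" using finite_perms by blast
      show "\<exists>c>0. (osc_step (X (fst p) (snd p)) c e)\<^sup>*\<^sup>* a b" if "p \<in> Sigma {..<N} perms" for p
        using that ab \<eta> by (intro cadlag_osc_chain X) auto
    qed (rule osc_chain_mono)
    then obtain c where c: "c > 0" "\<And>n \<sigma>. n < N \<Longrightarrow> \<sigma> \<in> perms n \<Longrightarrow> (osc_step (X n \<sigma>) c e)\<^sup>*\<^sup>* a b"
      by auto
    show ?thesis
    proof (intro exI[of _ "min c \<delta>"] conjI allI)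
      fix n
      show "real (card {\<sigma>\<in>perms n. \<not> (osc_step (X n \<sigma>) (min c \<delta>) e)\<^sup>*\<^sup>* a b}) \<le> \<eta> * real (card (perms n))"
      proof (cases "n < N")
        case True
        then have "{\<sigma>\<in>perms n. \<not> (osc_step (X n \<sigma>) (min c \<delta>) e)\<^sup>*\<^sup>* a b} = {}"
          using c osc_chain_mono[OF _ min.cobounded1] by blast
        then show ?thesis using \<eta> by (simp only: card.empty) simp
      next
        case False
        have "card {\<sigma>\<in>perms n. \<not> (osc_step (X n \<sigma>) (min c \<delta>) e)\<^sup>*\<^sup>* a b}
            \<le> card {\<sigma>\<in>perms n. \<not> (osc_step (X n \<sigma>) \<delta> e)\<^sup>*\<^sup>* a b}"
          using osc_chain_mono[OF _ min.cobounded2] by (intro card_perms_mono) blast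
        then show ?thesis using N[of n] False by linarith
      qed
    qed (use \<delta> c in auto)
  qed
  show ?thesis
    unfolding tight_perm_def
  proof (intro allI impI)
    fix \<eta> :: real assume \<eta>: "\<eta> > 0"
    obtain L where L: "\<And>n. real (card {\<sigma>\<in>perms n. \<not> (\<forall>u\<in>{a..b}. \<bar>X n \<sigma> u\<bar> \<le> L)}) \<le> \<eta> / 2 * real (card (perms n))"
      using bdd_all[of "\<eta> / 2"] \<eta> by auto
    define e where "e j = inverse (real (Suc j))" for j
    \<comment> \<open>Half of \<eta> is spent on boundedness; these geometric weights sum to the
      other half.\<close>
    have "\<forall>j. \<exists>\<delta>>0. \<forall>n. real (card {\<sigma>\<in>perms n. \<not> (osc_step (X n \<sigma>) \<delta> (e j))\<^sup>*\<^sup>* a b})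
        \<le> (\<eta> / 4 * (1 / 2) ^ j) * real (card (perms n))"
      using \<eta> by (intro allI osc_all) (auto simp: e_def)
    from choice[OF this] obtain \<delta> where \<delta>: "\<And>j. \<delta> j > 0"
      and bad: "\<And>j n. real (card {\<sigma>\<in>perms n. \<not> (osc_step (X n \<sigma>) (\<delta> j) (e j))\<^sup>*\<^sup>* a b})
        \<le> (\<eta> / 4 * (1 / 2) ^ j) * real (card (perms n))"
      by blast
    define A where "A = {x \<in> cadlag a b. (\<forall>u\<in>{a..b}. \<bar>x u\<bar> \<le> L) \<and> (\<forall>j. (osc_step x (\<delta> j) (e j))\<^sup>*\<^sup>* a b)}"
    define K where "K = skorokhod_topology a b closure_of A"
    have K: "compactin (skorokhod_topology a b) K"
      unfolding K_def
    proof (rule compactin_closure_osc_chain[of a b \<delta> e _ L])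
      show "e \<longlonglongrightarrow> 0" unfolding e_def by (rule LIMSEQ_inverse_real_of_nat)
    qed (use ab \<delta> in \<open>auto simp: A_def\<close>)
    have "A \<subseteq> K"
      unfolding K_def skorokhod_topology_def
      using Metric_space.topspace_mtopology[OF Metric_space_skorokhod, of a b] ab
      by (intro closure_of_subset) (auto simp: A_def)
    have "1 - \<eta> \<le> real (card {\<sigma>\<in>perms n. X n \<sigma> \<in> K}) / real (card (perms n))" for n
    proof -
      let ?N = "real (card (perms n))"
      define B where "B j = {\<sigma>\<in>perms n. \<not> (osc_step (X n \<sigma>) (\<delta> j) (e j))\<^sup>*\<^sup>* a b}" for j
      define B0 where "B0 = {\<sigma>\<in>perms n. \<not> (\<forall>u\<in>{a..b}. \<bar>X n \<sigma> u\<bar> \<le> L)}"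
      have finB: "finite (B j)" "finite B0" for j
        using finite_perms by (auto simp: B_def B0_def)
      have "finite (\<Union>j. B j)"
        by (rule finite_subset[OF _ finite_perms[of n]]) (auto simp: B_def)
      \<comment> \<open>On a finite sample space the countable union of bad events is already a
        finite one, so finite subadditivity suffices.\<close>
      then have "\<exists>J. finite J \<and> (\<Union>j. B j) \<subseteq> (\<Union>j\<in>J. B j)"
      proof -
        assume fin: "finite (\<Union>j. B j)"
        have "\<forall>\<sigma>\<in>(\<Union>j. B j). \<exists>j. \<sigma> \<in> B j" by blast
        then obtain f where "\<forall>\<sigma>\<in>(\<Union>j. B j). \<sigma> \<in> B (f \<sigma>)" by metis
        then show ?thesis using fin by (intro exI[of _ "f ` (\<Union>j. B j)"]) blast
      qed
      then obtain J where J: "finite J" "(\<Union>j. B j) \<subseteq> (\<Union>j\<in>J. B j)" by blast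
      obtain k where k: "J \<subseteq> {..<k}" using \<open>finite J\<close> finite_nat_iff_bounded by blast
      have "{\<sigma>\<in>perms n. X n \<sigma> \<notin> K} \<subseteq> B0 \<union> (\<Union>j<k. B j)"
      proof
        fix \<sigma> assume \<sigma>: "\<sigma> \<in> {\<sigma>\<in>perms n. X n \<sigma> \<notin> K}"
        then have "X n \<sigma> \<notin> A" "\<sigma> \<in> perms n" using \<open>A \<subseteq> K\<close> by auto
        then have "\<sigma> \<in> B0 \<union> (\<Union>j. B j)"
          using X[of \<sigma> n] by (auto simp: A_def B_def B0_def)
        then show "\<sigma> \<in> B0 \<union> (\<Union>j<k. B j)" using J k by blast
      qed
      then have "card {\<sigma>\<in>perms n. X n \<sigma> \<notin> K} \<le> card (B0 \<union> (\<Union>j<k. B j))"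
        using finB by (intro card_mono) auto
      also have "\<dots> \<le> card B0 + (\<Sum>j<k. card (B j))"
        by (rule order_trans[OF card_Un_le add_left_mono[OF card_UN_le]]) simp
      finally have "real (card {\<sigma>\<in>perms n. X n \<sigma> \<notin> K}) \<le> real (card B0) + (\<Sum>j<k. real (card (B j)))"
        by (simp only: flip: of_nat_sum of_nat_add)
      also have "\<dots> \<le> \<eta> / 2 * ?N + (\<Sum>j<k. (\<eta> / 4 * (1 / 2) ^ j) * ?N)"
        using L bad by (intro add_mono sum_mono) (auto simp: B0_def B_def)
      also have "\<dots> = \<eta> / 2 * ?N + \<eta> / 4 * ?N * (\<Sum>j<k. (1 / 2) ^ j)"
        by (simp add: sum_distrib_left mult_ac)
      also have "\<dots> \<le> \<eta> / 2 * ?N + \<eta> / 4 * ?N * 2"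
        using \<eta> by (intro add_left_mono mult_left_mono) (auto simp: sum_gp_strict)
      also have "\<dots> = \<eta> * ?N" by simp
      finally have "real (card {\<sigma>\<in>perms n. X n \<sigma> \<notin> K}) \<le> \<eta> * ?N" .
      moreover have "card (perms n) = card {\<sigma>\<in>perms n. X n \<sigma> \<in> K} + card {\<sigma>\<in>perms n. X n \<sigma> \<notin> K}"
        using finite_perms by (subst card_Un_disjoint[symmetric]) (auto intro: arg_cong[of _ _ card])
      ultimately have "(1 - \<eta>) * ?N \<le> real (card {\<sigma>\<in>perms n. X n \<sigma> \<in> K})"
        by (simp add: algebra_simps)
      then show ?thesis using card_perms_pos[of n] by (simp add: pos_le_divide_eq)
    qed
    then show "\<exists>K. compactin (skorokhod_topology a b) K \<and>
        (\<forall>n. 1 - \<eta> \<le> real (card {\<sigma>\<in>perms n. X n \<sigma> \<in> K}) / real (card (perms n)))"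
      using K by blast
  qed
qed

section \<open>Finite martingales with bounded conditional variances\<close>

text \<open>The \<open>\<sigma>\<close>-algebra at time \<open>k\<close> is represented by the functionals \<open>\<Phi>\<close> of the path stopped at \<open>k\<close>.\<close>

locale finite_martingale =
  fixes \<Omega> :: "'a set" and M :: "nat \<Rightarrow> 'a \<Rightarrow> real" and K :: nat and q :: real
  assumes finite: "finite \<Omega>"
    and mart_step: "\<And>k \<Phi>. k < K \<Longrightarrow>
      (\<Sum>\<omega>\<in>\<Omega>. \<Phi> (\<lambda>i. M (min i k) \<omega>) * (M (Suc k) \<omega> - M k \<omega>)) = (0::real)"
    and var_step: "\<And>k \<Phi>. k < K \<Longrightarrow> (\<And>p. 0 \<le> \<Phi> p) \<Longrightarrow>
      (\<Sum>\<omega>\<in>\<Omega>. \<Phi> (\<lambda>i. M (min i k) \<omega>) * (M (Suc k) \<omega> - M k \<omega>)\<^sup>2)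
        \<le> q * (\<Sum>\<omega>\<in>\<Omega>. \<Phi> (\<lambda>i. M (min i k) \<omega>) :: real)"
begin

definition hist :: "nat \<Rightarrow> 'a \<Rightarrow> nat \<Rightarrow> real" where
  "hist k \<omega> = (\<lambda>i. M (min i k) \<omega>)"

lemma hist_apply: "i \<le> k \<Longrightarrow> hist k \<omega> i = M i \<omega>"
  by (simp add: hist_def)

lemma hist_restrict: "k \<le> m \<Longrightarrow> (\<lambda>i. hist m \<omega> (min i k)) = hist k \<omega>"
  by (auto simp: hist_def fun_eq_iff min_def)

lemma mart:
  assumes "k \<le> m" "m \<le> K"
  shows "(\<Sum>\<omega>\<in>\<Omega>. \<Phi> (hist k \<omega>) * (M m \<omega> - M k \<omega>)) = (0::real)"
  using assms
proof (induction m rule: dec_induct)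
  case (step m)
  \<comment> \<open>A functional of the history up to \<open>k\<close> is also one of the longer
    history up to \<open>m\<close>, which it truncates.\<close>
  have "(\<Sum>\<omega>\<in>\<Omega>. \<Phi> (hist k \<omega>) * (M (Suc m) \<omega> - M m \<omega>)) = 0"
    using mart_step[of m "\<lambda>p. \<Phi> (\<lambda>i. p (min i k))"] step hist_restrict[of k m]
    by (simp flip: hist_def)
  moreover have "(\<Sum>\<omega>\<in>\<Omega>. \<Phi> (hist k \<omega>) * (M (Suc m) \<omega> - M k \<omega>)) =
      (\<Sum>\<omega>\<in>\<Omega>. \<Phi> (hist k \<omega>) * (M (Suc m) \<omega> - M m \<omega>)) + (\<Sum>\<omega>\<in>\<Omega>. \<Phi> (hist k \<omega>) * (M m \<omega> - M k \<omega>))"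
    by (simp add: algebra_simps flip: sum.distrib)
  ultimately show ?case using step by simp
qed simp

text \<open>Successive increments are orthogonal given the past, so their conditional variances add
  up.\<close>

lemma var:
  assumes "k \<le> m" "m \<le> K" and nonneg: "\<And>p. 0 \<le> \<Phi> p"
  shows "(\<Sum>\<omega>\<in>\<Omega>. \<Phi> (hist k \<omega>) * (M m \<omega> - M k \<omega>)\<^sup>2) \<le> q * real (m - k) * (\<Sum>\<omega>\<in>\<Omega>. \<Phi> (hist k \<omega>))"
  using assms(1,2)
proof (induction m rule: dec_induct)
  case (step m)
  let ?S = "\<Sum>\<omega>\<in>\<Omega>. \<Phi> (hist k \<omega>)"
  have 1: "(\<Sum>\<omega>\<in>\<Omega>. \<Phi> (hist k \<omega>) * (M (Suc m) \<omega> - M m \<omega>)\<^sup>2) \<le> q * ?S"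
    using var_step[of m "\<lambda>p. \<Phi> (\<lambda>i. p (min i k))"] step hist_restrict[of k m] nonneg
    by (simp flip: hist_def)
  have 2: "(\<Sum>\<omega>\<in>\<Omega>. \<Phi> (hist k \<omega>) * (M m \<omega> - M k \<omega>) * (M (Suc m) \<omega> - M m \<omega>)) = 0"
    using mart_step[of m "\<lambda>p. \<Phi> (\<lambda>i. p (min i k)) * (p m - p k)"] step hist_restrict[of k m]
    by (simp add: hist_apply flip: hist_def)
  have "(\<Sum>\<omega>\<in>\<Omega>. \<Phi> (hist k \<omega>) * (M (Suc m) \<omega> - M k \<omega>)\<^sup>2) =
      (\<Sum>\<omega>\<in>\<Omega>. \<Phi> (hist k \<omega>) * (M m \<omega> - M k \<omega>)\<^sup>2)
      + 2 * (\<Sum>\<omega>\<in>\<Omega>. \<Phi> (hist k \<omega>) * (M m \<omega> - M k \<omega>) * (M (Suc m) \<omega> - M m \<omega>))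
      + (\<Sum>\<omega>\<in>\<Omega>. \<Phi> (hist k \<omega>) * (M (Suc m) \<omega> - M m \<omega>)\<^sup>2)"
    unfolding sum_distrib_left sum.distrib[symmetric]
    by (intro sum.cong) (simp_all add: algebra_simps power2_eq_square)
  also have "\<dots> \<le> q * real (m - k) * ?S + q * ?S"
    using step 1 2 by simp
  also have "\<dots> = q * real (Suc m - k) * ?S"
    using step by (simp add: Suc_diff_le algebra_simps)
  finally show ?case .
qed simp

text \<open>Doob's inequality conditional on an event \<open>A\<close> at time \<open>k\<close>.
  Split by the first time \<open>j\<close> at which the displacement reaches \<open>e\<close>: this
  is decided by the history up to \<open>j\<close>, so the increment after \<open>j\<close> is
  orthogonal to the displacement so far and can only increase the second moment.\<close>

lemma maximal_inequality:
  assumes "k \<le> m" "m \<le> K" "e > 0"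
  shows "e\<^sup>2 * real (card {\<omega>\<in>\<Omega>. A (hist k \<omega>) \<and> (\<exists>j. k < j \<and> j \<le> m \<and> e \<le> \<bar>M j \<omega> - M k \<omega>\<bar>)})
    \<le> q * real (m - k) * real (card {\<omega>\<in>\<Omega>. A (hist k \<omega>)})"
proof -
  \<comment> \<open>The event \<open>F j\<close> as a predicate of the history alone, the form that
    \<open>mart\<close> accepts.\<close>
  define Q where "Q j p \<longleftrightarrow> A (\<lambda>i. p (min i k)) \<and> e \<le> \<bar>p j - p k\<bar> \<and> (\<forall>i. k < i \<and> i < j \<longrightarrow> \<bar>p i - p k\<bar> < e)"
    for j and p :: "nat \<Rightarrow> real"
  define F where "F j = {\<omega>\<in>\<Omega>. A (hist k \<omega>) \<and> e \<le> \<bar>M j \<omega> - M k \<omega>\<bar> \<and> (\<forall>i. k < i \<and> i < j \<longrightarrow> \<bar>M i \<omega> - M k \<omega>\<bar> < e)}" for j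
  have finF: "finite (F j)" for j using finite by (simp add: F_def)
  have F_Q: "F j = {\<omega>\<in>\<Omega>. Q j (hist j \<omega>)}" if "k < j" for j
    using that hist_restrict[of k j] by (auto simp: F_def Q_def hist_apply)
  have F_le: "e\<^sup>2 * real (card (F j)) \<le> (\<Sum>\<omega>\<in>F j. (M m \<omega> - M k \<omega>)\<^sup>2)" if j: "k < j" "j \<le> m" for j
  proof -
    have "e\<^sup>2 * real (card (F j)) = (\<Sum>\<omega>\<in>F j. e\<^sup>2)" by simp
    also have "\<dots> \<le> (\<Sum>\<omega>\<in>F j. (M j \<omega> - M k \<omega>)\<^sup>2)"
    proof (rule sum_mono)
      fix \<omega> assume "\<omega> \<in> F j"
      then have "e \<le> \<bar>M j \<omega> - M k \<omega>\<bar>" by (simp add: F_def)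
      then show "e\<^sup>2 \<le> (M j \<omega> - M k \<omega>)\<^sup>2"
        using \<open>e > 0\<close> by (metis abs_of_pos power2_abs power_mono less_imp_le)
    qed
    also have "\<dots> \<le> (\<Sum>\<omega>\<in>F j. (M j \<omega> - M k \<omega>)\<^sup>2 + (M m \<omega> - M j \<omega>)\<^sup>2)"
      by (rule sum_mono) simp
    also have "\<dots> = (\<Sum>\<omega>\<in>F j. (M m \<omega> - M k \<omega>)\<^sup>2) - 2 * (\<Sum>\<omega>\<in>F j. (M j \<omega> - M k \<omega>) * (M m \<omega> - M j \<omega>))"
      unfolding sum_distrib_left sum_subtractf[symmetric]
      by (intro sum.cong) (simp_all add: algebra_simps power2_eq_square)
    also have "(\<Sum>\<omega>\<in>F j. (M j \<omega> - M k \<omega>) * (M m \<omega> - M j \<omega>)) =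
        (\<Sum>\<omega>\<in>\<Omega>. (of_bool (Q j (hist j \<omega>)) * (hist j \<omega> j - hist j \<omega> k)) * (M m \<omega> - M j \<omega>))"
      using j finite unfolding F_Q[OF j(1)]
      by (intro sum.mono_neutral_cong_left) (auto simp: hist_apply)
    also have "\<dots> = 0"
      using mart[of j m "\<lambda>p. of_bool (Q j p) * (p j - p k)"] j assms by simp
    finally show ?thesis by simp
  qed
  have disj: "F i \<inter> F j = {}" if "i \<in> {k<..m}" "j \<in> {k<..m}" "i \<noteq> j" for i j
    using that by (cases i j rule: linorder_cases) (force simp: F_def)+
  have "{\<omega>\<in>\<Omega>. A (hist k \<omega>) \<and> (\<exists>j. k < j \<and> j \<le> m \<and> e \<le> \<bar>M j \<omega> - M k \<omega>\<bar>)} \<subseteq> (\<Union>j\<in>{k<..m}. F j)"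
  proof clarify
    fix \<omega> j assume h: "\<omega> \<in> \<Omega>" "A (hist k \<omega>)" "k < j" "j \<le> m" "e \<le> \<bar>M j \<omega> - M k \<omega>\<bar>"
    define n where "n = (LEAST j. k < j \<and> e \<le> \<bar>M j \<omega> - M k \<omega>\<bar>)"
    have n: "k < n \<and> e \<le> \<bar>M n \<omega> - M k \<omega>\<bar>" "n \<le> j"
      unfolding n_def using h LeastI[of "\<lambda>j. k < j \<and> e \<le> \<bar>M j \<omega> - M k \<omega>\<bar>" j]
      by (auto intro: Least_le)
    have "\<bar>M i \<omega> - M k \<omega>\<bar> < e" if "k < i" "i < n" for i
      using not_less_Least[of i "\<lambda>j. k < j \<and> e \<le> \<bar>M j \<omega> - M k \<omega>\<bar>"] that by (auto simp: n_def)
    then show "\<omega> \<in> (\<Union>j\<in>{k<..m}. F j)"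
      using n h by (intro UN_I[of n]) (auto simp: F_def)
  qed
  then have "card {\<omega>\<in>\<Omega>. A (hist k \<omega>) \<and> (\<exists>j. k < j \<and> j \<le> m \<and> e \<le> \<bar>M j \<omega> - M k \<omega>\<bar>)} \<le> card (\<Union>j\<in>{k<..m}. F j)"
    using finF by (intro card_mono) auto
  also have "\<dots> \<le> (\<Sum>j\<in>{k<..m}. card (F j))"
    by (rule card_UN_le) simp
  finally have "e\<^sup>2 * real (card {\<omega>\<in>\<Omega>. A (hist k \<omega>) \<and> (\<exists>j. k < j \<and> j \<le> m \<and> e \<le> \<bar>M j \<omega> - M k \<omega>\<bar>)})
      \<le> e\<^sup>2 * real (\<Sum>j\<in>{k<..m}. card (F j))"
    by (intro mult_left_mono of_nat_mono) auto
  also have "\<dots> = (\<Sum>j\<in>{k<..m}. e\<^sup>2 * real (card (F j)))"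
    by (simp add: sum_distrib_left)
  also have "\<dots> \<le> (\<Sum>j\<in>{k<..m}. \<Sum>\<omega>\<in>F j. (M m \<omega> - M k \<omega>)\<^sup>2)"
    using F_le by (intro sum_mono) auto
  also have "\<dots> = (\<Sum>\<omega>\<in>(\<Union>j\<in>{k<..m}. F j). (M m \<omega> - M k \<omega>)\<^sup>2)"
    using finF disj by (subst sum.UNION_disjoint) auto
  also have "\<dots> \<le> (\<Sum>\<omega>\<in>{\<omega>\<in>\<Omega>. A (hist k \<omega>)}. (M m \<omega> - M k \<omega>)\<^sup>2)"
    using finite by (intro sum_mono2) (auto simp: F_def)
  also have "\<dots> = (\<Sum>\<omega>\<in>\<Omega>. of_bool (A (hist k \<omega>)) * (M m \<omega> - M k \<omega>)\<^sup>2)"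
    using finite by (intro sum.mono_neutral_cong_left) auto
  also have "\<dots> \<le> q * real (m - k) * (\<Sum>\<omega>\<in>\<Omega>. of_bool (A (hist k \<omega>)))"
    using assms by (intro var) auto
  also have "(\<Sum>\<omega>\<in>\<Omega>. of_bool (A (hist k \<omega>))) = real (card {\<omega>\<in>\<Omega>. A (hist k \<omega>)})"
    using finite by (simp add: sum_of_bool_eq Collect_conj_eq)
  finally show ?thesis .
qed

end

text \<open>\<open>last_stop p k\<close> is the last time \<open>j \<le> k\<close> at which either the path has moved by at least \<open>e\<close>
  since the previous stop or \<open>D\<close> time units have passed; all times up to \<open>K0\<close> are stops.\<close>

primrec last_stop :: "nat \<Rightarrow> real \<Rightarrow> nat \<Rightarrow> (nat \<Rightarrow> real) \<Rightarrow> nat \<Rightarrow> nat" where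
  "last_stop K0 e D p 0 = 0"
| "last_stop K0 e D p (Suc k) =
    (if Suc k \<le> K0 \<or> e \<le> \<bar>p (Suc k) - p (last_stop K0 e D p k)\<bar> \<or> D \<le> Suc k - last_stop K0 e D p k
     then Suc k else last_stop K0 e D p k)"

lemma last_stop_le: "last_stop K0 e D p k \<le> k"
  by (induction k) auto

text \<open>The purpose of making all times up to \<open>K0\<close> stops: the window opens with a
  stop, and no interval between later stops reaches back before it.\<close>

lemma last_stop_ge: "K0 \<le> k \<Longrightarrow> K0 \<le> last_stop K0 e D p k"
proof (induction k)
  case (Suc k)
  then show ?case by (cases "K0 = Suc k") auto
qed simp

text \<open>The stopping property: whether \<open>k\<close> is a stop is decided by the path up to
  \<open>k\<close>.\<close>

lemma last_stop_cong:
  assumes "\<And>i. i \<le> k \<Longrightarrow> p i = p' i"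
  shows "last_stop K0 e D p k = last_stop K0 e D p' k"
  using assms
proof (induction k)
  case (Suc k)
  have "last_stop K0 e D p k = last_stop K0 e D p' k" using Suc by simp
  moreover have "last_stop K0 e D p' k \<le> Suc k" using last_stop_le[of K0 e D p' k] by simp
  ultimately show ?case using Suc.prems by simp
qed simp

lemma last_stop_between:
  "last_stop K0 e D p k \<le> j \<Longrightarrow> j \<le> k \<Longrightarrow> last_stop K0 e D p j = last_stop K0 e D p k"
proof (induction k)
  case (Suc k)
  then show ?case by (cases "j = Suc k") (auto split: if_splits)
qed simp

lemma last_stop_close:
  assumes "e > 0" "D > 0" "last_stop K0 e D p k \<le> j" "j \<le> k"
  shows "\<bar>p j - p (last_stop K0 e D p k)\<bar> < e \<and> j - last_stop K0 e D p k < D"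
proof (cases "j = last_stop K0 e D p k")
  case False
  then obtain i where i: "j = Suc i" using assms by (cases j) auto
  have j: "last_stop K0 e D p j = last_stop K0 e D p k" using last_stop_between assms by blast
  have "last_stop K0 e D p i = last_stop K0 e D p k" using last_stop_between[of K0 e D p k i] assms i False by auto
  then show ?thesis using j False unfolding i by (auto split: if_splits)
qed (use assms in auto)

lemma last_stop_stays:
  assumes "K0 \<le> k" "last_stop K0 e D p k = k" "k \<le> j" "j - k < D" "\<And>i. k < i \<Longrightarrow> i \<le> j \<Longrightarrow> \<bar>p i - p k\<bar> < e"
  shows "last_stop K0 e D p j = k"
  using assms(3-)
proof (induction j rule: dec_induct)
  case (step j)
  have "last_stop K0 e D p j = k" using step by auto
  then show ?case using step.prems(2)[of "Suc j"] step.prems(1) step.hyps assms(1) by auto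
qed (use assms in auto)

section \<open>Counting stops and close pairs of stops\<close>

context finite_martingale
begin

abbreviation stop :: "nat \<Rightarrow> real \<Rightarrow> nat \<Rightarrow> 'a \<Rightarrow> nat \<Rightarrow> bool" where
  "stop K0 e D \<omega> k \<equiv> last_stop K0 e D (\<lambda>i. M i \<omega>) k = k"

text \<open>As \<open>d \<le> D\<close>, a further stop within \<open>d\<close> cannot be explained
  by elapsed time alone, so the path has moved by \<open>e\<close> since \<open>k\<close>. The
  maximal inequality, conditional on a stop at \<open>k\<close>, bounds the chance of that.\<close>

lemma short_gap:
  assumes "K0 \<le> k" "k \<le> K" "e > 0" "d \<le> D" "q \<ge> 0"
  shows "e\<^sup>2 * real (card {\<omega>\<in>\<Omega>. stop K0 e D \<omega> k \<and> (\<exists>j. k < j \<and> j < k + d \<and> j \<le> K \<and> stop K0 e D \<omega> j)})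
    \<le> q * real d * real (card {\<omega>\<in>\<Omega>. stop K0 e D \<omega> k})"
proof -
  let ?A = "\<lambda>p. last_stop K0 e D p k = k"
  define m where "m = min K (k + d)"
  have hist_stop: "?A (hist k \<omega>) \<longleftrightarrow> stop K0 e D \<omega> k" for \<omega>
    using last_stop_cong[of k "hist k \<omega>" "\<lambda>i. M i \<omega>"] by (simp add: hist_apply)
  have "card {\<omega>\<in>\<Omega>. stop K0 e D \<omega> k \<and> (\<exists>j. k < j \<and> j < k + d \<and> j \<le> K \<and> stop K0 e D \<omega> j)}
      \<le> card {\<omega>\<in>\<Omega>. ?A (hist k \<omega>) \<and> (\<exists>j. k < j \<and> j \<le> m \<and> e \<le> \<bar>M j \<omega> - M k \<omega>\<bar>)}"
  proof (intro card_mono subsetI CollectI)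
    fix \<omega> assume "\<omega> \<in> {\<omega>\<in>\<Omega>. stop K0 e D \<omega> k \<and> (\<exists>j. k < j \<and> j < k + d \<and> j \<le> K \<and> stop K0 e D \<omega> j)}"
    then obtain j where j: "\<omega> \<in> \<Omega>" "stop K0 e D \<omega> k" "k < j" "j < k + d" "j \<le> K" "stop K0 e D \<omega> j" by blast
    have "\<exists>i. k < i \<and> i \<le> j \<and> e \<le> \<bar>M i \<omega> - M k \<omega>\<bar>"
    proof (rule ccontr)
      assume "\<nexists>i. k < i \<and> i \<le> j \<and> e \<le> \<bar>M i \<omega> - M k \<omega>\<bar>"
      then have "last_stop K0 e D (\<lambda>i. M i \<omega>) j = k"
        by (intro last_stop_stays[OF assms(1) j(2)]) (use j assms in \<open>auto simp: not_le\<close>)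
      then show False using j by simp
    qed
    then show "\<omega> \<in> \<Omega> \<and> ?A (hist k \<omega>) \<and> (\<exists>j. k < j \<and> j \<le> m \<and> e \<le> \<bar>M j \<omega> - M k \<omega>\<bar>)"
      using j hist_stop by (fastforce simp: m_def)
  qed (use finite in auto)
  then have "e\<^sup>2 * real (card {\<omega>\<in>\<Omega>. stop K0 e D \<omega> k \<and> (\<exists>j. k < j \<and> j < k + d \<and> j \<le> K \<and> stop K0 e D \<omega> j)})
      \<le> e\<^sup>2 * real (card {\<omega>\<in>\<Omega>. ?A (hist k \<omega>) \<and> (\<exists>j. k < j \<and> j \<le> m \<and> e \<le> \<bar>M j \<omega> - M k \<omega>\<bar>)})"
    by (intro mult_left_mono) auto
  also have "\<dots> \<le> q * real (m - k) * real (card {\<omega>\<in>\<Omega>. ?A (hist k \<omega>)})"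
    using assms by (intro maximal_inequality) (auto simp: m_def)
  also have "\<dots> \<le> q * real d * real (card {\<omega>\<in>\<Omega>. ?A (hist k \<omega>)})"
    using assms by (intro mult_right_mono mult_left_mono) (auto simp: m_def)
  finally show ?thesis by (simp add: hist_stop)
qed

text \<open>Blocks of length \<open>D\<close> starting at the points of \<open>S\<close> are
  disjoint and fit into \<open>{K0..<K + D}\<close>.\<close>

lemma card_separated_le:
  fixes S :: "nat set"
  assumes "S \<subseteq> {K0..K}" "\<And>i j. i \<in> S \<Longrightarrow> j \<in> S \<Longrightarrow> i < j \<Longrightarrow> i + D \<le> j" "K0 \<le> K"
  shows "D * card S \<le> K - K0 + D"
proof (cases "D = 0")
  case False
  have fin: "finite S" using assms(1) finite_subset by blast
  have "D * card S = (\<Sum>i\<in>S. card {i..<i + D})" by simp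
  also have "\<dots> = card (\<Union>i\<in>S. {i..<i + D})"
  proof (rule card_UN_disjoint[symmetric])
    show "\<forall>i\<in>S. \<forall>j\<in>S. i \<noteq> j \<longrightarrow> {i..<i + D} \<inter> {j..<j + D} = {}"
    proof (intro ballI impI)
      fix i j assume "i \<in> S" "j \<in> S" "i \<noteq> j"
      then have "i + D \<le> j \<or> j + D \<le> i" using assms(2)[of i j] assms(2)[of j i] by linarith
      then show "{i..<i + D} \<inter> {j..<j + D} = {}" by auto
    qed
  qed (use fin in auto)
  also have "\<dots> \<le> card {K0..<K + D}"
    using assms(1) False by (intro card_mono) (auto simp: subset_iff)
  also have "\<dots> = K - K0 + D" using assms(3) by simp
  finally show ?thesis .
qed simp

text \<open>A stop is followed by another one within time \<open>D\<close> with conditional probability at most a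
  half, and the stops that are not are \<open>D\<close>-separated.\<close>

lemma expected_stops:
  assumes "K0 \<le> K" "e > 0" "D > 0" "q \<ge> 0" "q * real D \<le> e\<^sup>2 / 2"
  shows "(\<Sum>k\<in>{K0..K}. real (card {\<omega>\<in>\<Omega>. stop K0 e D \<omega> k})) \<le> 2 * (real (K - K0) / real D + 1) * real (card \<Omega>)"
proof -
  define S where "S k = {\<omega>\<in>\<Omega>. stop K0 e D \<omega> k}" for k
  define Sh where "Sh k = {\<omega>\<in>\<Omega>. stop K0 e D \<omega> k \<and> (\<exists>j. k < j \<and> j < k + D \<and> j \<le> K \<and> stop K0 e D \<omega> j)}" for k
  define Lo where "Lo k = {\<omega>\<in>\<Omega>. stop K0 e D \<omega> k \<and> \<not> (\<exists>j. k < j \<and> j < k + D \<and> j \<le> K \<and> stop K0 e D \<omega> j)}" for k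
  have Sh: "real (card (Sh k)) \<le> real (card (S k)) / 2" if "k \<in> {K0..K}" for k
  proof -
    have "e\<^sup>2 * real (card (Sh k)) \<le> q * real D * real (card (S k))"
      unfolding Sh_def S_def using that assms by (intro short_gap) auto
    also have "\<dots> \<le> e\<^sup>2 / 2 * real (card (S k))"
      using assms by (intro mult_right_mono) auto
    finally show ?thesis using assms by simp
  qed
  have split: "real (card (S k)) = real (card (Sh k)) + real (card (Lo k))" for k
  proof -
    have "S k = Sh k \<union> Lo k" "Sh k \<inter> Lo k = {}" "finite (Sh k)" "finite (Lo k)"
      using finite by (auto simp: S_def Sh_def Lo_def)
    then show ?thesis by (simp add: card_Un_disjoint)
  qed
  have "(\<Sum>k\<in>{K0..K}. card (Lo k)) = (\<Sum>k\<in>{K0..K}. \<Sum>\<omega>\<in>\<Omega>. of_bool (\<omega> \<in> Lo k))"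
    using finite by (intro sum.cong) (auto simp: Lo_def of_bool_def sum.If_cases intro!: arg_cong[of _ _ card])
  also have "\<dots> = (\<Sum>\<omega>\<in>\<Omega>. \<Sum>k\<in>{K0..K}. of_bool (\<omega> \<in> Lo k))"
    by (rule sum.swap)
  also have "\<dots> = (\<Sum>\<omega>\<in>\<Omega>. card {k\<in>{K0..K}. \<omega> \<in> Lo k})"
    by (intro sum.cong) (auto simp: of_bool_def sum.If_cases intro!: arg_cong[of _ _ card])
  finally have "real D * (\<Sum>k\<in>{K0..K}. real (card (Lo k))) = real (\<Sum>\<omega>\<in>\<Omega>. D * card {k\<in>{K0..K}. \<omega> \<in> Lo k})"
    by (simp add: sum_distrib_left flip: of_nat_sum of_nat_mult)
  also have "\<dots> \<le> real (\<Sum>\<omega>\<in>\<Omega>. K - K0 + D)"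
  proof (intro of_nat_mono sum_mono card_separated_le)
    fix \<omega> i j assume "i \<in> {k\<in>{K0..K}. \<omega> \<in> Lo k}" "j \<in> {k\<in>{K0..K}. \<omega> \<in> Lo k}" "i < j"
    then show "i + D \<le> j" by (auto simp: Lo_def not_less)
  qed (use assms in auto)
  also have "\<dots> = real (card \<Omega>) * (real (K - K0) + real D)" by simp
  finally have Lo: "(\<Sum>k\<in>{K0..K}. real (card (Lo k))) \<le> (real (K - K0) / real D + 1) * real (card \<Omega>)"
    using assms by (simp add: field_simps)
  have "(\<Sum>k\<in>{K0..K}. real (card (S k))) = (\<Sum>k\<in>{K0..K}. real (card (Sh k))) + (\<Sum>k\<in>{K0..K}. real (card (Lo k)))"
    by (simp add: split sum.distrib)
  \<comment> \<open>Half of the sum reappears on the right and is absorbed, whence the factor 2 of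
    the bound.\<close>
  also have "\<dots> \<le> (\<Sum>k\<in>{K0..K}. real (card (S k)) / 2) + (real (K - K0) / real D + 1) * real (card \<Omega>)"
    using Sh Lo by (intro add_mono sum_mono)
  also have "(\<Sum>k\<in>{K0..K}. real (card (S k)) / 2) = (\<Sum>k\<in>{K0..K}. real (card (S k))) / 2"
    by (rule sum_divide_distrib[symmetric])
  finally have "(\<Sum>k\<in>{K0..K}. real (card (S k))) \<le> 2 * ((real (K - K0) / real D + 1) * real (card \<Omega>))"
    by simp
  then show ?thesis by (simp only: S_def mult.assoc)
qed

text \<open>The union bound over \<open>k\<close> is weighted by the probability that
  \<open>k\<close> is a stop. A plain sum over all times would cost a factor of order
  \<open>K\<close>; the expected number of stops costs only about \<open>K / D\<close>.\<close>

lemma some_short_gap: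
  assumes "K0 \<le> K" "e > 0" "D > 0" "q \<ge> 0" "q * real D \<le> e\<^sup>2 / 2" "d \<le> D"
  shows "e\<^sup>2 * real (card {\<omega>\<in>\<Omega>. \<exists>k j. K0 \<le> k \<and> k < j \<and> j < k + d \<and> j \<le> K \<and> stop K0 e D \<omega> k \<and> stop K0 e D \<omega> j})
    \<le> q * real d * (2 * (real (K - K0) / real D + 1) * real (card \<Omega>))"
proof -
  define B where "B k = {\<omega>\<in>\<Omega>. stop K0 e D \<omega> k \<and> (\<exists>j. k < j \<and> j < k + d \<and> j \<le> K \<and> stop K0 e D \<omega> j)}" for k
  have "card {\<omega>\<in>\<Omega>. \<exists>k j. K0 \<le> k \<and> k < j \<and> j < k + d \<and> j \<le> K \<and> stop K0 e D \<omega> k \<and> stop K0 e D \<omega> j}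
      \<le> card (\<Union>k\<in>{K0..K}. B k)"
    using finite by (intro card_mono) (fastforce simp: B_def)+
  also have "\<dots> \<le> (\<Sum>k\<in>{K0..K}. card (B k))" by (rule card_UN_le) simp
  finally have "e\<^sup>2 * real (card {\<omega>\<in>\<Omega>. \<exists>k j. K0 \<le> k \<and> k < j \<and> j < k + d \<and> j \<le> K \<and> stop K0 e D \<omega> k \<and> stop K0 e D \<omega> j})
      \<le> e\<^sup>2 * real (\<Sum>k\<in>{K0..K}. card (B k))"
    by (intro mult_left_mono of_nat_mono) auto
  also have "\<dots> = (\<Sum>k\<in>{K0..K}. e\<^sup>2 * real (card (B k)))"
    by (simp add: sum_distrib_left)
  also have "\<dots> \<le> (\<Sum>k\<in>{K0..K}. q * real d * real (card {\<omega>\<in>\<Omega>. stop K0 e D \<omega> k}))"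
    unfolding B_def using assms by (intro sum_mono short_gap) auto
  also have "\<dots> = q * real d * (\<Sum>k\<in>{K0..K}. real (card {\<omega>\<in>\<Omega>. stop K0 e D \<omega> k}))"
    by (simp add: sum_distrib_left)
  also have "\<dots> \<le> q * real d * (2 * (real (K - K0) / real D + 1) * real (card \<Omega>))"
    using assms by (intro mult_left_mono expected_stops) auto
  finally show ?thesis .
qed

lemma weaken:
  assumes "q \<le> q'"
  shows "finite_martingale \<Omega> M K q'"
proof
  fix k and \<Phi> :: "(nat \<Rightarrow> real) \<Rightarrow> real"
  assume k: "k < K" and nonneg: "\<And>p. 0 \<le> \<Phi> p"
  have "q * (\<Sum>\<omega>\<in>\<Omega>. \<Phi> (\<lambda>i. M (min i k) \<omega>)) \<le> q' * (\<Sum>\<omega>\<in>\<Omega>. \<Phi> (\<lambda>i. M (min i k) \<omega>))"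
    using assms nonneg by (intro mult_right_mono sum_nonneg)
  then show "(\<Sum>\<omega>\<in>\<Omega>. \<Phi> (\<lambda>i. M (min i k) \<omega>) * (M (Suc k) \<omega> - M k \<omega>)\<^sup>2)
      \<le> q' * (\<Sum>\<omega>\<in>\<Omega>. \<Phi> (\<lambda>i. M (min i k) \<omega>))"
    using var_step[OF k, of \<Phi>] nonneg by (meson order_trans)
qed (use finite mart_step in auto)

end

declare One_nat_def [simp del]

section \<open>Partial sums of a randomly permuted sequence\<close>

text \<open>\<open>inv \<sigma> j\<close> is the node observed at time \<open>j\<close>, so the
  weights of the first \<open>t\<close> observations are collected.\<close>

definition psum :: "(nat \<Rightarrow> real) \<Rightarrow> (nat \<Rightarrow> nat) \<Rightarrow> nat \<Rightarrow> real" where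
  "psum a \<sigma> t = (\<Sum>j\<in>{1..t}. a (inv \<sigma> j))"

lemma psum_0: "psum a \<sigma> 0 = 0"
  by (simp add: psum_def)

lemma psum_Suc: "psum a \<sigma> (Suc t) = psum a \<sigma> t + a (inv \<sigma> (Suc t))"
  by (simp add: psum_def)

lemma inv_transpose_comp:
  assumes "\<sigma> \<in> perms n"
  shows "inv (Transposition.transpose i j \<circ> \<sigma>) l = inv \<sigma> (Transposition.transpose i j l)"
proof -
  have "bij \<sigma>" using assms by (simp add: perms_def permutes_bij)
  then show ?thesis by (subst o_inv_distrib) (auto intro: o_bij[where g="Transposition.transpose i j"])
qed

lemma psum_transpose:
  assumes "\<sigma> \<in> perms n" "t < i" "t < j"
  shows "psum a (Transposition.transpose i j \<circ> \<sigma>) t = psum a \<sigma> t"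
  unfolding psum_def using assms
  by (intro sum.cong) (auto simp: inv_transpose_comp Transposition.transpose_def)

lemma sum_inv_perm:
  assumes "\<sigma> \<in> perms n"
  shows "(\<Sum>j\<in>{1..n}. f (inv \<sigma> j)) = (\<Sum>v\<in>{1..n}. f v)"
  using sum.permute[of "inv \<sigma>" "{1..n}" f] assms permutes_inv[of \<sigma> "{1..n}"] by (simp add: perms_def o_def)

text \<open>Functions that are invariant under transpositions of labels in \<open>{k<..n}\<close> play the role of
  the variables measurable with respect to the first \<open>k\<close> observations.\<close>

lemma exchangeable_average:
  fixes Y :: "(nat \<Rightarrow> nat) \<Rightarrow> real"
  assumes Y: "\<And>\<sigma> i j. \<sigma> \<in> perms n \<Longrightarrow> i \<in> {k<..n} \<Longrightarrow> j \<in> {k<..n} \<Longrightarrow> Y (Transposition.transpose i j \<circ> \<sigma>) = Y \<sigma>"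
    and i: "i \<in> {k<..n}"
  shows "real (n - k) * (\<Sum>\<sigma>\<in>perms n. Y \<sigma> * f (inv \<sigma> i)) = (\<Sum>\<sigma>\<in>perms n. Y \<sigma> * (\<Sum>j\<in>{k<..n}. f (inv \<sigma> j)))"
proof -
  have "(\<Sum>\<sigma>\<in>perms n. Y \<sigma> * f (inv \<sigma> i)) = (\<Sum>\<sigma>\<in>perms n. Y \<sigma> * f (inv \<sigma> j))" if j: "j \<in> {k<..n}" for j
  proof -
    have "Transposition.transpose i j permutes {1..n}" using i j by (intro permutes_swap_id) auto
    then have "(\<Sum>\<sigma>\<in>perms n. Y \<sigma> * f (inv \<sigma> i)) =
        (\<Sum>\<sigma>\<in>perms n. Y (Transposition.transpose i j \<circ> \<sigma>) * f (inv (Transposition.transpose i j \<circ> \<sigma>) i))"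
      unfolding perms_def by (rule setum_permutations_compose_left)
    also have "\<dots> = (\<Sum>\<sigma>\<in>perms n. Y \<sigma> * f (inv \<sigma> j))"
      using Y i j by (intro sum.cong) (auto simp: inv_transpose_comp)
    finally show ?thesis .
  qed
  then have "(\<Sum>j\<in>{k<..n}. \<Sum>\<sigma>\<in>perms n. Y \<sigma> * f (inv \<sigma> i)) = (\<Sum>j\<in>{k<..n}. \<Sum>\<sigma>\<in>perms n. Y \<sigma> * f (inv \<sigma> j))"
    by (rule sum.cong[OF refl])
  also have "\<dots> = (\<Sum>\<sigma>\<in>perms n. Y \<sigma> * (\<Sum>j\<in>{k<..n}. f (inv \<sigma> j)))"
    by (subst sum.swap) (simp add: sum_distrib_left)
  finally show ?thesis by simp
qed

lemma sum_tail_perm: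
  assumes "\<sigma> \<in> perms n" "k \<le> n"
  shows "(\<Sum>j\<in>{k<..n}. f (inv \<sigma> j)) = (\<Sum>v\<in>{1..n}. f v) - (psum f \<sigma> k :: real)"
proof -
  have "{1..n} = {1..k} \<union> {k<..n}" using assms(2) by auto
  moreover have "(\<Sum>j\<in>{1..k} \<union> {k<..n}. f (inv \<sigma> j)) = (\<Sum>j\<in>{1..k}. f (inv \<sigma> j)) + (\<Sum>j\<in>{k<..n}. f (inv \<sigma> j))"
    by (rule sum.union_disjoint) auto
  ultimately have "(\<Sum>j\<in>{1..n}. f (inv \<sigma> j)) = (\<Sum>j\<in>{1..k}. f (inv \<sigma> j)) + (\<Sum>j\<in>{k<..n}. f (inv \<sigma> j))"
    by simp
  then show ?thesis using sum_inv_perm[OF assms(1), of f] by (simp add: psum_def)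
qed

locale centered_weights =
  fixes n :: nat and a :: "nat \<Rightarrow> real"
  assumes sum_a: "(\<Sum>v\<in>{1..n}. a v) = 0" and sum_a2: "(\<Sum>v\<in>{1..n}. (a v)\<^sup>2) = 1"
begin

text \<open>Sampling without replacement: given the first \<open>k\<close> draws, the next weight is
  uniform among the \<open>n - k\<close> remaining ones, which add up to
  \<open>- psum a \<sigma> k\<close> because all weights add up to 0.\<close>

lemma sum_next:
  assumes Y: "\<And>\<sigma> i j. \<sigma> \<in> perms n \<Longrightarrow> i \<in> {k<..n} \<Longrightarrow> j \<in> {k<..n} \<Longrightarrow> Y (Transposition.transpose i j \<circ> \<sigma>) = Y \<sigma>"
    and k: "k < n"
  shows "(\<Sum>\<sigma>\<in>perms n. Y \<sigma> * a (inv \<sigma> (Suc k))) = - (\<Sum>\<sigma>\<in>perms n. Y \<sigma> * psum a \<sigma> k) / (real n - real k)"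
proof -
  have "real (n - k) * (\<Sum>\<sigma>\<in>perms n. Y \<sigma> * a (inv \<sigma> (Suc k))) =
      (\<Sum>\<sigma>\<in>perms n. Y \<sigma> * (\<Sum>j\<in>{k<..n}. a (inv \<sigma> j)))"
    using Y k by (intro exchangeable_average) auto
  also have "\<dots> = - (\<Sum>\<sigma>\<in>perms n. Y \<sigma> * psum a \<sigma> k)"
    unfolding sum_negf[symmetric] using k by (intro sum.cong) (auto simp: sum_tail_perm sum_a)
  finally show ?thesis using k by (simp add: field_simps of_nat_diff)
qed

lemma sum_next_sq:
  assumes Y: "\<And>\<sigma> i j. \<sigma> \<in> perms n \<Longrightarrow> i \<in> {k<..n} \<Longrightarrow> j \<in> {k<..n} \<Longrightarrow> Y (Transposition.transpose i j \<circ> \<sigma>) = Y \<sigma>"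
    and k: "k < n" and nonneg: "\<And>\<sigma>. 0 \<le> Y \<sigma>"
  shows "(\<Sum>\<sigma>\<in>perms n. Y \<sigma> * (a (inv \<sigma> (Suc k)))\<^sup>2) \<le> (\<Sum>\<sigma>\<in>perms n. Y \<sigma>) / (real n - real k)"
proof -
  have "real (n - k) * (\<Sum>\<sigma>\<in>perms n. Y \<sigma> * (a (inv \<sigma> (Suc k)))\<^sup>2) =
      (\<Sum>\<sigma>\<in>perms n. Y \<sigma> * (\<Sum>j\<in>{k<..n}. (a (inv \<sigma> j))\<^sup>2))"
    using Y k exchangeable_average[of n k Y "Suc k" "\<lambda>v. (a v)\<^sup>2"] by auto
  also have "\<dots> \<le> (\<Sum>\<sigma>\<in>perms n. Y \<sigma> * 1)"
  proof (intro sum_mono mult_left_mono nonneg)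
    fix \<sigma> assume "\<sigma> \<in> perms n"
    then have "(\<Sum>j\<in>{k<..n}. (a (inv \<sigma> j))\<^sup>2) = 1 - psum (\<lambda>v. (a v)\<^sup>2) \<sigma> k"
      using sum_tail_perm[of \<sigma> n k "\<lambda>v. (a v)\<^sup>2"] k by (simp add: sum_a2)
    also have "\<dots> \<le> 1" by (simp add: psum_def sum_nonneg)
    finally show "(\<Sum>j\<in>{k<..n}. (a (inv \<sigma> j))\<^sup>2) \<le> 1" .
  qed
  finally show ?thesis using k by (simp add: field_simps of_nat_diff)
qed

lemma sum_psum_eq_0: "t \<le> n \<Longrightarrow> (\<Sum>\<sigma>\<in>perms n. psum a \<sigma> t) = 0"
proof (induction t)
  case (Suc t)
  have "(\<Sum>\<sigma>\<in>perms n. 1 * a (inv \<sigma> (Suc t))) = - (\<Sum>\<sigma>\<in>perms n. 1 * psum a \<sigma> t) / (real n - real t)"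
    using Suc.prems by (intro sum_next) auto
  then show ?case using Suc by (simp add: psum_Suc sum.distrib)
qed (simp add: psum_0)

text \<open>The variance of sampling without replacement. By the negative correlation in
  \<open>sum_next\<close>, one more draw multiplies the old second moment by
  \<open>1 - 2 / (n - t)\<close>; it adds \<open>1 / n\<close>, the mean of a single squared weight.
  The closed form solves this recursion.\<close>

lemma sum_psum_sq:
  assumes "2 \<le> n"
  shows "t \<le> n \<Longrightarrow> (\<Sum>\<sigma>\<in>perms n. (psum a \<sigma> t)\<^sup>2)
    = real (card (perms n)) * (real t * (real n - real t) / (real n * (real n - 1)))"
proof (induction t)
  case (Suc t)
  let ?C = "real (card (perms n))"
  let ?e = "\<Sum>\<sigma>\<in>perms n. (psum a \<sigma> t)\<^sup>2"
  have 1: "(\<Sum>\<sigma>\<in>perms n. psum a \<sigma> t * a (inv \<sigma> (Suc t))) = - ?e / (real n - real t)"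
    using Suc.prems sum_next[of t "\<lambda>\<sigma>. psum a \<sigma> t"]
    by (simp add: psum_transpose power2_eq_square)
  have "real (n - 0) * (\<Sum>\<sigma>\<in>perms n. 1 * (a (inv \<sigma> (Suc t)))\<^sup>2) =
      (\<Sum>\<sigma>\<in>perms n. 1 * (\<Sum>j\<in>{0<..n}. (a (inv \<sigma> j))\<^sup>2))"
    using Suc.prems exchangeable_average[of n 0 "\<lambda>_. 1" "Suc t" "\<lambda>v. (a v)\<^sup>2"] by auto
  also have "\<dots> = ?C"
    using sum_tail_perm[of _ n 0 "\<lambda>v. (a v)\<^sup>2"] by (simp add: sum_a2 psum_0)
  finally have 2: "(\<Sum>\<sigma>\<in>perms n. (a (inv \<sigma> (Suc t)))\<^sup>2) = ?C / real n"
    using assms by (simp add: field_simps)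
  have "(\<Sum>\<sigma>\<in>perms n. (psum a \<sigma> (Suc t))\<^sup>2) =
      ?e + 2 * (\<Sum>\<sigma>\<in>perms n. psum a \<sigma> t * a (inv \<sigma> (Suc t))) + (\<Sum>\<sigma>\<in>perms n. (a (inv \<sigma> (Suc t)))\<^sup>2)"
    by (simp add: psum_Suc power2_sum sum.distrib sum_distrib_left mult_ac)
  also have "\<dots> = ?e * (1 - 2 / (real n - real t)) + ?C / real n"
    unfolding 1 2 by (simp add: algebra_simps)
  also have "?e = ?C * (real t * (real n - real t) / (real n * (real n - 1)))"
    using Suc by simp
  also have "\<dots> * (1 - 2 / (real n - real t)) + ?C / real n =
      ?C * (real (Suc t) * (real n - real (Suc t)) / (real n * (real n - 1)))"
  proof -
    have nz: "real n - real t \<noteq> 0" "real n \<noteq> 0" "real n - 1 \<noteq> 0" using Suc.prems assms by auto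
    have "?C * (real t * (real n - real t) / (real n * (real n - 1))) * (1 - 2 / (real n - real t))
        = ?C * (real t * (real n - real t - 2) / (real n * (real n - 1)))"
    proof -
      have "d * (1 - 2 / d) = d - 2" if "d \<noteq> 0" for d :: real
        using that by (simp add: field_simps)
      then show ?thesis using nz(1) by (simp add: mult.assoc)
    qed
    moreover have "?C / real n = ?C * ((real n - 1) / (real n * (real n - 1)))"
      using nz by simp
    ultimately show ?thesis
      by (simp add: algebra_simps flip: add_divide_distrib)
  qed
  finally show ?case .
qed (simp add: psum_0)

text \<open>By \<open>sum_next\<close> the next partial sum has conditional mean
  \<open>(n - k - 1) / (n - k)\<close> times the present one; dividing by \<open>n - k\<close>
  removes this drift. The numerator \<open>n\<close> keeps the factor between 1 and
  \<open>1 / \<epsilon>\<close> in the window.\<close>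

definition mg :: "nat \<Rightarrow> (nat \<Rightarrow> nat) \<Rightarrow> real" where
  "mg k \<sigma> = real n / (real n - real k) * psum a \<sigma> k"

lemma mg_0: "mg 0 \<sigma> = 0"
  by (simp add: mg_def psum_0)

lemma mg_diff:
  assumes "Suc k < n"
  shows "mg (Suc k) \<sigma> - mg k \<sigma> =
    real n / (real n - real (Suc k)) * (a (inv \<sigma> (Suc k)) + psum a \<sigma> k / (real n - real k))"
proof -
  have nz: "real n - real (Suc k) \<noteq> 0" "real n - real k \<noteq> 0" using assms by auto
  show ?thesis
    unfolding mg_def psum_Suc using nz by (simp add: field_simps)
qed

text \<open>Given the past, the next centred weight has variance at most \<open>1 / (n - k)\<close>,
  and the prefactor of the increment enters squared; both are bounded by their values at
  \<open>K\<close>. With \<open>n - K \<ge> n * \<epsilon>\<close> this gives the constant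
  \<open>1 / (\<epsilon> ^ 3 * n)\<close>.\<close>

lemma mg_martingale:
  assumes "K < n"
  shows "finite_martingale (perms n) mg K ((real n / (real n - real K))\<^sup>2 / (real n - real K))"
proof
  show "finite (perms n)" by (rule finite_perms)
next
  fix k and \<Phi> :: "(nat \<Rightarrow> real) \<Rightarrow> real"
  assume k: "k < K"
  define Y where "Y \<sigma> = \<Phi> (\<lambda>i. mg (min i k) \<sigma>)" for \<sigma>
  have Y: "Y (Transposition.transpose i j \<circ> \<sigma>) = Y \<sigma>" if "\<sigma> \<in> perms n" "i \<in> {k<..n}" "j \<in> {k<..n}" for \<sigma> i j
    using that by (auto simp: Y_def mg_def psum_transpose intro!: arg_cong[of _ _ \<Phi>])
  have YS: "Y (Transposition.transpose i j \<circ> \<sigma>) * psum a (Transposition.transpose i j \<circ> \<sigma>) k = Y \<sigma> * psum a \<sigma> k"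
    if "\<sigma> \<in> perms n" "i \<in> {k<..n}" "j \<in> {k<..n}" for \<sigma> i j
    using that Y by (simp add: psum_transpose)
  have kn: "k < n" "Suc k < n" using k assms by auto
  let ?c = "real n / (real n - real (Suc k))"
  define r where "r = real n - real k"
  have r: "r > 0" using kn by (simp add: r_def)
  have X: "(\<Sum>\<sigma>\<in>perms n. Y \<sigma> * a (inv \<sigma> (Suc k))) = - (\<Sum>\<sigma>\<in>perms n. Y \<sigma> * psum a \<sigma> k) / r"
    unfolding r_def using Y kn by (intro sum_next) auto
  have "(\<Sum>\<sigma>\<in>perms n. Y \<sigma> * (mg (Suc k) \<sigma> - mg k \<sigma>)) =
      ?c * ((\<Sum>\<sigma>\<in>perms n. Y \<sigma> * a (inv \<sigma> (Suc k))) + (\<Sum>\<sigma>\<in>perms n. Y \<sigma> * psum a \<sigma> k) / r)"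
    by (simp add: mg_diff[OF kn(2)] r_def sum_distrib_left sum.distrib distrib_left sum_divide_distrib mult_ac)
  then show "(\<Sum>\<sigma>\<in>perms n. \<Phi> (\<lambda>i. mg (min i k) \<sigma>) * (mg (Suc k) \<sigma> - mg k \<sigma>)) = 0"
    unfolding X by (simp add: Y_def)
  assume nonneg: "\<And>p. 0 \<le> \<Phi> p"
  have XS: "(\<Sum>\<sigma>\<in>perms n. Y \<sigma> * psum a \<sigma> k * a (inv \<sigma> (Suc k))) = - (\<Sum>\<sigma>\<in>perms n. Y \<sigma> * psum a \<sigma> k * psum a \<sigma> k) / r"
    unfolding r_def using YS kn by (intro sum_next) auto
  have X2: "(\<Sum>\<sigma>\<in>perms n. Y \<sigma> * (a (inv \<sigma> (Suc k)))\<^sup>2) \<le> (\<Sum>\<sigma>\<in>perms n. Y \<sigma>) / r"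
    unfolding r_def using Y kn nonneg by (intro sum_next_sq) (auto simp: Y_def)
  have SY: "0 \<le> (\<Sum>\<sigma>\<in>perms n. Y \<sigma>)" "0 \<le> (\<Sum>\<sigma>\<in>perms n. Y \<sigma> * psum a \<sigma> k * psum a \<sigma> k)"
    using nonneg by (auto intro!: sum_nonneg simp: Y_def mult.assoc)
  have "(\<Sum>\<sigma>\<in>perms n. Y \<sigma> * (a (inv \<sigma> (Suc k)) + psum a \<sigma> k / r)\<^sup>2) =
      (\<Sum>\<sigma>\<in>perms n. Y \<sigma> * (a (inv \<sigma> (Suc k)))\<^sup>2)
      + 2 / r * (\<Sum>\<sigma>\<in>perms n. Y \<sigma> * psum a \<sigma> k * a (inv \<sigma> (Suc k)))
      + (\<Sum>\<sigma>\<in>perms n. Y \<sigma> * psum a \<sigma> k * psum a \<sigma> k) / r\<^sup>2"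
    unfolding sum_distrib_left sum_divide_distrib sum.distrib[symmetric]
    by (intro sum.cong) (simp_all add: algebra_simps power2_eq_square)
  \<comment> \<open>The cross term is minus twice the last one, which leaves the second moment minus
    the squared conditional mean.\<close>
  also have "\<dots> = (\<Sum>\<sigma>\<in>perms n. Y \<sigma> * (a (inv \<sigma> (Suc k)))\<^sup>2)
      - (\<Sum>\<sigma>\<in>perms n. Y \<sigma> * psum a \<sigma> k * psum a \<sigma> k) / r\<^sup>2"
    unfolding XS by (simp add: power2_eq_square)
  also have "\<dots> \<le> (\<Sum>\<sigma>\<in>perms n. Y \<sigma>) / r"
    using X2 SY by (smt (verit) divide_nonneg_nonneg zero_le_power2)
  finally have main: "(\<Sum>\<sigma>\<in>perms n. Y \<sigma> * (a (inv \<sigma> (Suc k)) + psum a \<sigma> k / r)\<^sup>2) \<le> (\<Sum>\<sigma>\<in>perms n. Y \<sigma>) / r" .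
  have "(\<Sum>\<sigma>\<in>perms n. Y \<sigma> * (mg (Suc k) \<sigma> - mg k \<sigma>)\<^sup>2) =
      ?c\<^sup>2 * (\<Sum>\<sigma>\<in>perms n. Y \<sigma> * (a (inv \<sigma> (Suc k)) + psum a \<sigma> k / r)\<^sup>2)"
    by (simp add: mg_diff[OF kn(2)] r_def sum_distrib_left power_mult_distrib power_divide mult_ac)
  also have "\<dots> \<le> ?c\<^sup>2 * ((\<Sum>\<sigma>\<in>perms n. Y \<sigma>) / r)"
    using main by (intro mult_left_mono) auto
  also have "\<dots> \<le> (real n / (real n - real K))\<^sup>2 * ((\<Sum>\<sigma>\<in>perms n. Y \<sigma>) / (real n - real K))"
    using SY k kn assms r unfolding r_def
    by (intro mult_mono power_mono divide_left_mono) (auto intro!: mult_pos_pos)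
  finally show "(\<Sum>\<sigma>\<in>perms n. \<Phi> (\<lambda>i. mg (min i k) \<sigma>) * (mg (Suc k) \<sigma> - mg k \<sigma>)\<^sup>2)
      \<le> (real n / (real n - real K))\<^sup>2 / (real n - real K) * (\<Sum>\<sigma>\<in>perms n. \<Phi> (\<lambda>i. mg (min i k) \<sigma>))"
    by (simp add: Y_def)
qed

end

section \<open>The statistic as a linear rank statistic\<close>

text \<open>Double counting of incidences. With the indicator of early nodes as \<open>w\<close> it
  turns a count over edges into a linear statistic of the nodes.\<close>

lemma sum_degree:
  assumes "simple_graph_on n E"
  shows "(\<Sum>v\<in>{1..n}. real (degree E v) * w v) = (\<Sum>e\<in>E. \<Sum>v\<in>e. w v)"
proof -
  have sub: "E \<subseteq> Pow {1..n}" using assms by (auto simp: simple_graph_on_def)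
  then have fin: "finite E" by (rule finite_subset) simp
  have "(\<Sum>e\<in>E. \<Sum>v\<in>e. w v) = (\<Sum>e\<in>E. \<Sum>v\<in>{1..n}. if v \<in> e then w v else 0)"
  proof (rule sum.cong[OF refl])
    fix e assume "e \<in> E"
    then have "{1..n} \<inter> e = e" using sub by auto
    then show "(\<Sum>v\<in>e. w v) = (\<Sum>v\<in>{1..n}. if v \<in> e then w v else 0)"
      using sum.inter_restrict[of "{1..n}" w e] by simp
  qed
  also have "\<dots> = (\<Sum>v\<in>{1..n}. \<Sum>e\<in>E. if v \<in> e then w v else 0)"
    by (rule sum.swap)
  also have "\<dots> = (\<Sum>v\<in>{1..n}. real (degree E v) * w v)"
    using fin by (simp add: degree_def sum.If_cases Collect_conj_eq)
  finally show ?thesis by simp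
qed

text \<open>An edge contributes \<open>1\<close>, \<open>0\<close> or \<open>-1\<close> to the difference, which is the number of its
  early endpoints minus one.\<close>

lemma Rdiff_linear:
  assumes "simple_graph_on n E"
  shows "Rdiff E \<sigma> t = (\<Sum>v\<in>{1..n}. real (degree E v) * of_bool (\<sigma> v \<le> t)) - real (card E)"
proof -
  have "E \<subseteq> Pow {1..n}" using assms by (auto simp: simple_graph_on_def)
  then have fin: "finite E" by (rule finite_subset) simp
  have "of_bool (\<forall>v\<in>e. \<sigma> v \<le> t) - of_bool (\<forall>v\<in>e. \<sigma> v > t) = (\<Sum>v\<in>e. of_bool (\<sigma> v \<le> t)) - (1::real)"
    if "e \<in> E" for e
  proof -
    have "card e = 2" using that assms by (simp add: simple_graph_on_def)
    then obtain u v where "e = {u, v}" "u \<noteq> v" by (auto simp: card_2_iff)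
    then show ?thesis by auto
  qed
  then have "(\<Sum>e\<in>E. of_bool (\<forall>v\<in>e. \<sigma> v \<le> t) - of_bool (\<forall>v\<in>e. \<sigma> v > t)) =
      (\<Sum>e\<in>E. (\<Sum>v\<in>e. of_bool (\<sigma> v \<le> t)) - (1::real))"
    by (rule sum.cong[OF refl])
  moreover have "(\<Sum>e\<in>E. of_bool (\<forall>v\<in>e. \<sigma> v \<le> t) - of_bool (\<forall>v\<in>e. \<sigma> v > t)) = Rdiff E \<sigma> t"
    unfolding Rdiff_def R1_def R2_def using fin
    by (simp add: sum_subtractf sum_of_bool_eq Collect_conj_eq)
  ultimately show ?thesis
    by (simp add: sum_subtractf sum_degree[OF assms])
qed

text \<open>The mean degree is \<open>2 * card E / n\<close>, so this is the sum of the squared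
  deviations of the degrees from their mean.\<close>

definition deg_var :: "nat \<Rightarrow> nat set set \<Rightarrow> real" where
  "deg_var n E = (\<Sum>i=1..n. (real (degree E i))\<^sup>2) - 4 * (real (card E))\<^sup>2 / real n"

definition deg_weight :: "nat \<Rightarrow> nat set set \<Rightarrow> nat \<Rightarrow> real" where
  "deg_weight n E v = (real (degree E v) - 2 * real (card E) / real n) / sqrt (deg_var n E)"

lemma sum_degree_eq:
  assumes "simple_graph_on n E"
  shows "(\<Sum>v\<in>{1..n}. real (degree E v)) = 2 * real (card E)"
proof -
  have "(\<Sum>e\<in>E. \<Sum>v\<in>e. 1::real) = (\<Sum>e\<in>E. 2)"
    using assms by (intro sum.cong) (auto simp: simple_graph_on_def)
  then show ?thesis using sum_degree[OF assms, of "\<lambda>_. 1"] by simp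
qed

lemma centered_deg_weight:
  assumes "simple_graph_on n E" "deg_var n E > 0" "n > 0"
  shows "centered_weights n (deg_weight n E)"
proof
  let ?m = "2 * real (card E) / real n"
  have "(\<Sum>v\<in>{1..n}. real (degree E v) - ?m) = 0"
    using assms by (simp add: sum_subtractf sum_degree_eq)
  then show "(\<Sum>v\<in>{1..n}. deg_weight n E v) = 0"
    unfolding deg_weight_def by (simp flip: sum_divide_distrib)
  have "(\<Sum>v\<in>{1..n}. (real (degree E v) - ?m)\<^sup>2) =
      (\<Sum>v\<in>{1..n}. (real (degree E v))\<^sup>2) - 2 * ?m * (\<Sum>v\<in>{1..n}. real (degree E v)) + real n * ?m\<^sup>2"
    by (simp add: power2_diff sum.distrib sum_subtractf sum_distrib_left sum_divide_distrib mult_ac)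
  also have "\<dots> = deg_var n E"
    unfolding sum_degree_eq[OF assms(1)] deg_var_def
    using assms(3) by (simp add: power2_eq_square field_simps)
  finally show "(\<Sum>v\<in>{1..n}. (deg_weight n E v)\<^sup>2) = 1"
    unfolding deg_weight_def using assms(2)
    by (simp add: power_divide real_sqrt_pow2 flip: sum_divide_distrib)
qed

lemma Rdiff_psum:
  assumes E: "simple_graph_on n E" "deg_var n E > 0" and \<sigma>: "\<sigma> \<in> perms n" and t: "t \<le> n"
  shows "Rdiff E \<sigma> t = sqrt (deg_var n E) * psum (deg_weight n E) \<sigma> t
    + (2 * real (card E) / real n * real t - real (card E))"
proof -
  have p: "\<sigma> permutes {1..n}" using \<sigma> by (simp add: perms_def)
  have "(\<Sum>v\<in>{1..n}. real (degree E v) * of_bool (\<sigma> v \<le> t)) =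
      (\<Sum>j\<in>{1..n}. real (degree E (inv \<sigma> j)) * of_bool (\<sigma> (inv \<sigma> j) \<le> t))"
    using sum_inv_perm[OF \<sigma>, of "\<lambda>v. real (degree E v) * of_bool (\<sigma> v \<le> t)"] by simp
  also have "\<dots> = (\<Sum>j\<in>{1..t}. real (degree E (inv \<sigma> j)))"
    using t by (intro sum.mono_neutral_cong_right) (auto simp: permutes_inverses(1)[OF p])
  also have "\<dots> = (\<Sum>j\<in>{1..t}. sqrt (deg_var n E) * deg_weight n E (inv \<sigma> j) + 2 * real (card E) / real n)"
    using E(2) by (intro sum.cong) (simp_all add: deg_weight_def)
  also have "\<dots> = sqrt (deg_var n E) * psum (deg_weight n E) \<sigma> t + 2 * real (card E) / real n * real t"
    by (simp add: sum.distrib psum_def sum_distrib_left)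
  finally show ?thesis by (simp add: Rdiff_linear[OF E(1)])
qed

text \<open>Standardisation removes the constants of \<open>Rdiff_psum\<close>: the shift is the
  mean, and \<open>sqrt (deg_var n E)\<close> cancels against the standard deviation.\<close>

lemma Zdiff_psum:
  assumes E: "simple_graph_on n E" "deg_var n E > 0" and \<sigma>: "\<sigma> \<in> perms n" and t: "t \<le> n" and n: "2 \<le> n"
  shows "Zdiff n E t \<sigma> = psum (deg_weight n E) \<sigma> t / sqrt (real t * (real n - real t) / (real n * (real n - 1)))"
proof -
  interpret centered_weights n "deg_weight n E"
    using centered_deg_weight E n by simp
  let ?V = "deg_var n E" and ?S = "\<lambda>\<sigma>. psum (deg_weight n E) \<sigma> t"
  let ?c = "2 * real (card E) / real n * real t - real (card E)"
  let ?v = "real t * (real n - real t) / (real n * (real n - 1))"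
  have R: "Rdiff E \<tau> t = sqrt ?V * ?S \<tau> + ?c" if "\<tau> \<in> perms n" for \<tau>
    using Rdiff_psum[OF E that t] .
  have "(\<Sum>\<tau>\<in>perms n. Rdiff E \<tau> t) = (\<Sum>\<tau>\<in>perms n. sqrt ?V * ?S \<tau> + ?c)"
    using R by (rule sum.cong[OF refl])
  also have "\<dots> = real (card (perms n)) * ?c"
    using sum_psum_eq_0[OF t] by (simp add: sum.distrib flip: sum_distrib_left)
  finally have mean: "perm_E n (\<lambda>\<tau>. Rdiff E \<tau> t) = ?c"
    using card_perms_pos[of n] by (simp add: perm_E_def)
  have "(\<Sum>\<tau>\<in>perms n. (Rdiff E \<tau> t - ?c)\<^sup>2) = (\<Sum>\<tau>\<in>perms n. ?V * (?S \<tau>)\<^sup>2)"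
    using R E(2) by (intro sum.cong) (simp_all add: power_mult_distrib real_sqrt_pow2)
  also have "\<dots> = real (card (perms n)) * (?V * ?v)"
    using sum_psum_sq[OF n t] by (simp flip: sum_distrib_left)
  finally have "perm_Var n (\<lambda>\<tau>. Rdiff E \<tau> t) = ?V * ?v"
    unfolding perm_Var_def mean using card_perms_pos[of n] by (simp add: perm_E_def)
  then show ?thesis
    unfolding Zdiff_def mean R[OF \<sigma>] using E(2)
    by (simp add: real_sqrt_mult real_sqrt_divide)
qed

lemma floor_step_cadlag:
  "(\<lambda>u. if u \<in> {a..b} then F (nat \<lfloor>real n * u\<rfloor>) else 0) \<in> cadlag a b" (is "?x \<in> _")
proof -
  have out: "?x u = 0" if "u \<notin> {a..b}" for u
    using that by auto
  show ?thesis
  proof (cases "n = 0")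
  case True
  have right: "(?x \<longlongrightarrow> ?x u) (at_right u)" if "u \<in> {a..<b}" for u
    using that True
    by (intro tendsto_eventually) (auto simp: eventually_at_right_field intro!: exI[of _ b])
  have left: "(?x \<longlongrightarrow> F 0) (at_left u)" if "u \<in> {a<..b}" for u
    using that True
    by (intro tendsto_eventually) (auto simp: eventually_at_left_field intro!: exI[of _ a])
  show ?thesis unfolding cadlag_def using out right left by blast
next
  case False
  have right: "(?x \<longlongrightarrow> ?x u) (at_right u)" if u: "u \<in> {a..<b}" for u
  proof (rule tendsto_eventually)
    define r where "r = min b ((real_of_int \<lfloor>real n * u\<rfloor> + 1) / real n)"
    have "u < (real_of_int \<lfloor>real n * u\<rfloor> + 1) / real n"
      using False by (simp add: pos_less_divide_eq mult.commute)
    then have "r > u" using u by (simp add: r_def)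
    moreover have "?x w = ?x u" if "u < w" "w < r" for w
    proof -
      have "real n * u \<le> real n * w" using that by (simp add: mult_left_mono)
      moreover have "real n * w < real_of_int \<lfloor>real n * u\<rfloor> + 1"
        using that False by (simp add: r_def pos_less_divide_eq mult.commute)
      ultimately have "\<lfloor>real n * w\<rfloor> = \<lfloor>real n * u\<rfloor>" by linarith
      then show ?thesis using u that by (simp add: r_def)
    qed
    ultimately show "\<forall>\<^sub>F w in at_right u. ?x w = ?x u"
      unfolding eventually_at_right_field by blast
  qed
  \<comment> \<open>Just before \<open>u\<close> the rounded time is the largest integer strictly
    below \<open>n * u\<close>, also when \<open>n * u\<close> is itself an integer.\<close>
  have left: "(?x \<longlongrightarrow> F (nat (\<lceil>real n * u\<rceil> - 1))) (at_left u)" if u: "u \<in> {a<..b}" for u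
  proof (rule tendsto_eventually)
    define r where "r = max a ((real_of_int \<lceil>real n * u\<rceil> - 1) / real n)"
    have "(real_of_int \<lceil>real n * u\<rceil> - 1) / real n < u"
      using False ceiling_correct[of "real n * u"] by (simp add: pos_divide_less_eq mult.commute)
    then have "r < u" using u by (simp add: r_def)
    moreover have "?x w = F (nat (\<lceil>real n * u\<rceil> - 1))" if "r < w" "w < u" for w
    proof -
      have "real n * w < real n * u" using that False by simp
      moreover have "real_of_int \<lceil>real n * u\<rceil> - 1 < real n * w"
        using that False by (simp add: r_def pos_divide_less_eq mult.commute)
      ultimately have "\<lfloor>real n * w\<rfloor> = \<lceil>real n * u\<rceil> - 1" by linarith
      then show ?thesis using u that by (simp add: r_def)
    qed
    ultimately show "\<forall>\<^sub>F w in at_left u. ?x w = F (nat (\<lceil>real n * u\<rceil> - 1))"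
      unfolding eventually_at_left_field by blast
  qed
  show ?thesis unfolding cadlag_def using out right left by blast
qed
qed

section \<open>Modulus of continuity of the standardised process\<close>

text \<open>Stops become knots of a partition of the interval. A stop may come too close to the
  right end, so stops after \<open>fl b - d\<close> are dropped and the last interval is extended to
  \<open>b\<close>. It then joins a piece following a stop with the last \<open>d\<close> times,
  whence the bounds \<open>2 * h\<close> and \<open>2 * D\<close>.\<close>

lemma stops_osc_chain:
  fixes p F x :: "_ \<Rightarrow> real" and n :: nat
  defines "fl \<equiv> \<lambda>u. nat \<lfloor>real n * u\<rfloor>"
  assumes n: "n > 0" and ab: "0 \<le> a" "a < b"
    and x: "\<And>u. u \<in> {a..b} \<Longrightarrow> x u = F (fl u)"
    and close: "\<And>i j. fl a \<le> i \<Longrightarrow> i \<le> j \<Longrightarrow> j \<le> fl b \<Longrightarrow> \<bar>p j - p i\<bar> \<le> 2 * h \<Longrightarrow> j - i \<le> 2 * D \<Longrightarrow> \<bar>F j - F i\<bar> \<le> e"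
    and gaps: "\<And>k j. fl a \<le> k \<Longrightarrow> k < j \<Longrightarrow> j \<le> fl b \<Longrightarrow> last_stop (fl a) h D p k = k \<Longrightarrow>
      last_stop (fl a) h D p j = j \<Longrightarrow> k + d \<le> j"
    and last: "\<And>j. fl b - d < j \<Longrightarrow> j \<le> fl b \<Longrightarrow> \<bar>p j - p (fl b - d)\<bar> < h"
    and d: "d \<le> D" "fl a + d \<le> fl b" "\<delta> * real n + 1 \<le> real d" and pos: "h > 0" "D > 0"
  shows "(osc_step x \<delta> e)\<^sup>*\<^sup>* a b"
proof -
  define K0 where "K0 = fl a"
  define K1 where "K1 = fl b"
  define ls where "ls = last_stop K0 h D p"
  \<comment> \<open>Because of rounding, \<open>K0 / n\<close> may lie to the left of
    \<open>a\<close>, so the first knot is \<open>a\<close> itself. It moves by less than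
    \<open>1 / n\<close>.\<close>
  define tt where "tt j = (if j = K0 then a else real j / real n)" for j
  have K0: "real K0 \<le> real n * a" "real n * a < real K0 + 1"
    unfolding K0_def fl_def using ab n by (auto simp: of_nat_nat)
  have K1: "real K1 \<le> real n * b" "real n * b < real K1 + 1"
    unfolding K1_def fl_def using ab n by (auto simp: of_nat_nat)
  have fl_eq: "fl w = i" if "real i \<le> real n * w" "real n * w < real i + 1" for w i
    unfolding fl_def using that by (simp add: floor_eq_iff nat_eq_iff)
  have fl_bounds: "real (fl w) \<le> real n * w" "real n * w < real (fl w) + 1" if "0 \<le> w" for w
    unfolding fl_def using that n by (auto simp: of_nat_nat)
  have tt_ge: "real j / real n \<le> tt j" and tt_a: "K0 \<le> j \<Longrightarrow> a \<le> tt j" and tt_le: "tt j \<le> (real j + 1) / real n"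
    and fl_tt: "fl (tt j) = j" for j
  proof -
    show "real j / real n \<le> tt j"
      using K0 n by (simp add: tt_def field_simps)
    show "tt j \<le> (real j + 1) / real n"
      using K0 n by (simp add: tt_def field_simps)
    show "a \<le> tt j" if "K0 \<le> j"
    proof (cases "j = K0")
      case False
      then have "real K0 + 1 \<le> real j" using that by linarith
      then show ?thesis using K0 n False by (simp add: tt_def field_simps)
    qed (simp add: tt_def)
    show "fl (tt j) = j"
    proof (cases "j = K0")
      case False
      then show ?thesis using n by (intro fl_eq) (auto simp: tt_def)
    qed (simp add: tt_def K0_def)
  qed
  \<comment> \<open>The summand 1 in \<open>\<delta> * real n + 1 \<le> real d\<close> pays for the
    shift of the left knot.\<close>
  have step_gap: "(u + 1) / real n + \<delta> \<le> v" if "u + real d \<le> real n * v" for u v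
  proof -
    have "(u + 1) / real n + \<delta> = (u + 1 + \<delta> * real n) / real n"
      using n by (simp add: add_divide_distrib)
    also have "\<dots> \<le> v" using n that d(3) by (simp add: pos_divide_le_eq mult.commute)
    finally show ?thesis .
  qed
  have osc: "\<bar>x w - x (tt s)\<bar> \<le> e"
    if "K0 \<le> s" "tt s \<le> w" "w \<le> b" "\<bar>p (fl w) - p s\<bar> \<le> 2 * h" "fl w - s \<le> 2 * D" for s w
  proof -
    have wa: "a \<le> w" "tt s \<in> {a..b}" using tt_a[of s] that by auto
    have "real s \<le> real n * w"
      using tt_ge[of s] that(2) n by (simp add: divide_le_eq mult.commute order_trans)
    then have "s \<le> fl w" using fl_bounds(2)[of w] wa ab by linarith
    moreover have "real n * w \<le> real n * b" using that by (simp add: mult_left_mono)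
    then have "fl w \<le> K1" using fl_bounds(1)[of w] wa ab K1(2) by linarith
    ultimately have "\<bar>F (fl w) - F s\<bar> \<le> e"
      using that by (intro close) (auto simp: K0_def K1_def)
    then show ?thesis using x[of w] x[of "tt s"] wa that fl_tt by auto
  qed
  have fl_range: "s \<le> fl w" "fl w \<le> k" if "K0 \<le> s" "tt s \<le> w" "w < real (Suc k) / real n" for s w k
  proof -
    have wa: "a \<le> w" using tt_a[of s] that by auto
    have "real s \<le> real n * w"
      using tt_ge[of s] that(2) n by (simp add: divide_le_eq mult.commute order_trans)
    then show "s \<le> fl w" using fl_bounds(2)[of w] wa ab by linarith
    have "real n * w < real (Suc k)" using that n by (simp add: pos_less_divide_eq mult.commute)
    then show "fl w \<le> k" using fl_bounds(1)[of w] wa ab by linarith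
  qed
  have near: "\<bar>p i - p (ls k)\<bar> < h" "i - ls k < D" if "ls k \<le> i" "i \<le> k" for i k
    using last_stop_close[of h D K0 p k i] that pos by (auto simp: ls_def)
  have ls_ge: "K0 \<le> ls k" if "K0 \<le> k" for k
    using last_stop_ge that by (simp add: ls_def)
  have ls_le: "ls k \<le> k" for k
    by (simp add: ls_def last_stop_le)
  have ls_idem: "ls (ls k) = ls k" for k
    unfolding ls_def by (intro last_stop_between last_stop_le) simp
  \<comment> \<open>Induction over times instead of stops: the chain reaches the last stop up to
    \<open>k\<close> and is prolonged only when \<open>Suc k\<close> is a new one.\<close>
  have chain: "(osc_step x \<delta> e)\<^sup>*\<^sup>* a (tt (ls k))" if "K0 \<le> k" "k \<le> K1 - d" for k
    using that
  proof (induction k rule: dec_induct)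
    case base
    have "ls K0 = K0" using ls_ge[of K0] ls_le[of K0] by simp
    then show ?case by (simp add: tt_def)
  next
    case (step k)
    define s where "s = ls k"
    have IH: "(osc_step x \<delta> e)\<^sup>*\<^sup>* a (tt s)" using step by (simp add: s_def)
    have s: "K0 \<le> s" "s \<le> k" using ls_ge ls_le step by (auto simp: s_def)
    show ?case
    proof (cases "ls (Suc k) = s")
      case False
      then have j: "ls (Suc k) = Suc k" by (auto simp: ls_def s_def split: if_splits)
      have "s + d \<le> Suc k"
        using gaps[of s "Suc k"] s step j ls_idem[of k]
        by (simp add: ls_def s_def K0_def K1_def)
      then have "real s + real d \<le> real (Suc k)" by linarith
      then have "(real s + 1) / real n + \<delta> \<le> real (Suc k) / real n"
        using n by (intro step_gap) simp
      then have gap: "tt s + \<delta> \<le> tt (Suc k)"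
        using tt_le[of s] tt_ge[of "Suc k"] by linarith
      have ttk: "tt (Suc k) = real (Suc k) / real n" using step by (simp add: tt_def)
      have "real (Suc k) \<le> real K1" using step by linarith
      then have kb: "real (Suc k) / real n \<le> b"
        using K1(1) n by (simp add: pos_divide_le_eq mult.commute)
      have "\<bar>x w - x (tt s)\<bar> \<le> e" if w: "tt s \<le> w" "w < tt (Suc k)" for w
      proof (rule osc)
        have i: "s \<le> fl w" "fl w \<le> k" using fl_range[OF s(1) w(1)] w(2) by (auto simp: ttk)
        show "\<bar>p (fl w) - p s\<bar> \<le> 2 * h" "fl w - s \<le> 2 * D"
          using near[of k "fl w"] i pos by (auto simp: s_def)
      qed (use w s kb in \<open>auto simp: ttk\<close>)
      then have "osc_step x \<delta> e (tt s) (tt (Suc k))" using gap by (auto simp: osc_step_def)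
      then show ?thesis using IH j by (simp add: rtranclp.rtrancl_into_rtrancl)
    qed (use IH in simp)
  qed
  define k1 where "k1 = K1 - d"
  have k1: "K0 \<le> k1" "k1 + d = K1" using d(2) by (auto simp: k1_def K0_def K1_def)
  define s where "s = ls k1"
  have s: "K0 \<le> s" "s \<le> k1" using ls_ge[OF k1(1)] ls_le[of k1] by (auto simp: s_def)
  have "real s + real d \<le> real K1" using s k1 by linarith
  then have "(real s + 1) / real n + \<delta> \<le> b"
    using K1(1) by (intro step_gap) simp
  then have gap: "tt s + \<delta> \<le> b" using tt_le[of s] by linarith
  have "\<bar>x w - x (tt s)\<bar> \<le> e" if w: "tt s \<le> w" "w < b" for w
  proof (rule osc)
    have "b \<le> real (Suc K1) / real n" using K1(2) n by (simp add: field_simps)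
    then have "w < real (Suc K1) / real n" using w(2) by linarith
    then have i: "s \<le> fl w" "fl w \<le> K1" using fl_range[OF s(1) w(1)] by blast+
    show "\<bar>p (fl w) - p s\<bar> \<le> 2 * h" "fl w - s \<le> 2 * D"
    proof (atomize(full), cases "fl w \<le> k1")
      case True
      then show "\<bar>p (fl w) - p s\<bar> \<le> 2 * h \<and> fl w - s \<le> 2 * D"
        using near[of k1 "fl w"] i pos by (auto simp: s_def)
    next
      case False
      then have "\<bar>p (fl w) - p k1\<bar> < h"
        using last[of "fl w"] i by (simp add: k1_def K1_def)
      moreover have "\<bar>p k1 - p s\<bar> < h" "k1 - s < D" using near[of k1 k1] s by (auto simp: s_def)
      moreover have "fl w \<le> k1 + D" using i k1 d(1) by simp
      ultimately show "\<bar>p (fl w) - p s\<bar> \<le> 2 * h \<and> fl w - s \<le> 2 * D" by linarith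
    qed
  qed (use w s in auto)
  then have "osc_step x \<delta> e (tt s) b" using gap by (auto simp: osc_step_def)
  then show ?thesis
    using chain[of k1] k1 by (simp add: s_def k1_def rtranclp.rtrancl_into_rtrancl)
qed

text \<open>With \<open>u = k / n\<close> this is \<open>sqrt ((1 - 1 / n) * (1 - u) / u)\<close>, a
  fixed profile up to a factor tending to 1, bounded for \<open>u\<close> away from 0.\<close>

definition scale :: "nat \<Rightarrow> nat \<Rightarrow> real" where
  "scale n k = sqrt ((real n - 1) * (real n - real k) / (real n * real k))"

lemma scale_le:
  assumes "n > 0" "\<epsilon> > 0" "real n * \<epsilon> / 2 \<le> real k" "k \<le> n"
  shows "0 \<le> scale n k" "scale n k \<le> sqrt (2 / \<epsilon>)"
proof -
  have k: "real k > 0" using assms by (smt (verit) divide_pos_pos mult_pos_pos of_nat_0_less_iff)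
  have "(real n - 1) * (real n - real k) / (real n * real k) \<le> real n * real n / (real n * real k)"
    using assms k by (intro divide_right_mono mult_mono) auto
  also have "\<dots> = real n / real k" using assms k by simp
  also have "\<dots> \<le> 2 / \<epsilon>" using assms k by (simp add: field_simps)
  finally show "scale n k \<le> sqrt (2 / \<epsilon>)" by (simp add: scale_def)
  show "0 \<le> scale n k" using assms k by (simp add: scale_def)
qed

text \<open>Subadditivity of the square root. It yields a modulus without a positive lower bound on
  the arguments, which in \<open>scale_diff\<close> may reach 0 at time \<open>n\<close>.\<close>

lemma sqrt_diff_le: "0 \<le> x \<Longrightarrow> 0 \<le> y \<Longrightarrow> \<bar>sqrt x - sqrt y\<bar> \<le> sqrt \<bar>x - y\<bar>"
proof (induction x y rule: linorder_wlog)
  case (le x y)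
  have "sqrt y \<le> sqrt x + sqrt (y - x)"
    using sqrt_add_le_add_sqrt[of x "y - x"] le by simp
  then show ?case using le by (simp add: abs_if)
qed (simp add: abs_minus_commute)

lemma scale_diff:
  assumes "n > 0" "\<epsilon> > 0" "real n * \<epsilon> / 2 \<le> real i" "i \<le> j" "j \<le> n" "real j - real i \<le> c * real n"
  shows "\<bar>scale n j - scale n i\<bar> \<le> 2 / \<epsilon> * sqrt c"
proof -
  have i: "real i > 0" using assms by (smt (verit) divide_pos_pos mult_pos_pos of_nat_0_less_iff)
  then have j: "real j > 0" using assms by linarith
  let ?A = "\<lambda>k. (real n - 1) * (real n - real k) / (real n * real k)"
  have nonneg: "0 \<le> ?A k" if "k \<le> n" for k using that assms by simp
  have A_diff: "?A i - ?A j = (real n - 1) * (real j - real i) / (real i * real j)"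
    using i j assms by (simp add: field_simps)
  also have "\<dots> \<le> real n * (c * real n) / ((real n * \<epsilon> / 2) * (real n * \<epsilon> / 2))"
    using assms i j by (intro frac_le mult_mono mult_pos_pos) auto
  also have "\<dots> = (2 / \<epsilon>)\<^sup>2 * c" using assms by (simp add: power2_eq_square field_simps)
  finally have ub: "?A i - ?A j \<le> (2 / \<epsilon>)\<^sup>2 * c" .
  have "0 \<le> ?A i - ?A j"
    unfolding A_diff using assms by simp
  then have "\<bar>?A j - ?A i\<bar> \<le> (2 / \<epsilon>)\<^sup>2 * c" using ub by simp
  then have "sqrt \<bar>?A j - ?A i\<bar> \<le> sqrt ((2 / \<epsilon>)\<^sup>2 * c)" by simp
  also have "\<dots> = 2 / \<epsilon> * sqrt c" using assms by (simp add: real_sqrt_mult)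
  finally show ?thesis
    unfolding scale_def using sqrt_diff_le[of "?A j" "?A i"] nonneg assms by (auto intro: order_trans)
qed

text \<open>The factor \<open>n / (n - k)\<close> that turns the partial sums into a martingale is undone by the
  deterministic \<open>scale\<close>, whose modulus of continuity is uniform in \<open>n\<close>.\<close>

lemma Zdiff_scale:
  assumes E: "simple_graph_on n E" "deg_var n E > 0" and \<sigma>: "\<sigma> \<in> perms n" and k: "0 < k" "k < n"
  shows "Zdiff n E k \<sigma> = scale n k * centered_weights.mg n (deg_weight n E) k \<sigma>"
proof -
  interpret centered_weights n "deg_weight n E"
    using centered_deg_weight E k by simp
  define r where "r = real n - real k"
  have pos: "r > 0" "real n > 0" "real n - 1 > 0" "real k > 0" using k by (auto simp: r_def)
  let ?B = "real k * r / (real n * (real n - 1))"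
  have "scale n k * sqrt ?B = sqrt ((real n - 1) * r / (real n * real k) * ?B)"
    unfolding scale_def r_def by (rule real_sqrt_mult[symmetric])
  also have "(real n - 1) * r / (real n * real k) * ?B = (r / real n)\<^sup>2"
    using pos by (simp add: power2_eq_square field_simps)
  also have "sqrt \<dots> = r / real n" using pos by simp
  finally have "scale n k * sqrt ?B = r / real n" .
  moreover have "sqrt ?B > 0" using pos by simp
  ultimately have inv: "1 / sqrt ?B = scale n k * (real n / r)"
    using pos by (simp add: field_simps)
  have "Zdiff n E k \<sigma> = psum (deg_weight n E) \<sigma> k * (1 / sqrt ?B)"
    using Zdiff_psum[OF E \<sigma>, of k] k by (simp add: r_def)
  also have "\<dots> = scale n k * mg k \<sigma>"
    unfolding inv by (simp add: mg_def r_def)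
  finally show ?thesis .
qed

section \<open>Tightness\<close>

locale graph_window =
  fixes n :: nat and E :: "nat set set" and \<epsilon> :: real
  assumes graph: "simple_graph_on n E" and deg_var_pos: "deg_var n E > 0"
    and eps: "0 < \<epsilon>" "\<epsilon> < 1/2" and n_large: "2 / \<epsilon> \<le> real n"
begin

definition K0 :: nat where "K0 = nat \<lfloor>real n * \<epsilon>\<rfloor>"
definition K1 :: nat where "K1 = nat \<lfloor>real n * (1 - \<epsilon>)\<rfloor>"

lemma n_eps: "2 \<le> real n * \<epsilon>"
  using n_large eps by (simp add: divide_le_eq)

lemma n_pos: "n > 0"
  using n_eps by (cases n) auto

text \<open>Rounding down at most halves \<open>n * \<epsilon>\<close> once this is at least 2;
  hence the \<open>\<epsilon> / 2\<close> in the bounds on \<open>scale\<close>.\<close>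

lemma K0_bounds: "real K0 \<le> real n * \<epsilon>" "real n * \<epsilon> / 2 \<le> real K0" "0 < K0"
proof -
  have K0: "real K0 = real_of_int \<lfloor>real n * \<epsilon>\<rfloor>"
    using eps by (simp add: K0_def)
  show "real K0 \<le> real n * \<epsilon>" "real n * \<epsilon> / 2 \<le> real K0" "0 < K0"
    using K0 n_eps by linarith+
qed

lemma K1_bounds: "real K1 \<le> real n * (1 - \<epsilon>)" "real n * (1 - \<epsilon>) < real K1 + 1" "K1 < n" "real n * \<epsilon> \<le> real n - real K1"
proof -
  have K1: "real K1 = real_of_int \<lfloor>real n * (1 - \<epsilon>)\<rfloor>"
    using eps by (simp add: K1_def)
  show 1: "real K1 \<le> real n * (1 - \<epsilon>)" "real n * (1 - \<epsilon>) < real K1 + 1"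
    using K1 by linarith+
  then show 2: "real n * \<epsilon> \<le> real n - real K1" by (simp add: algebra_simps)
  then show "K1 < n" using n_eps by linarith
qed

lemma floor_range:
  assumes "u \<in> {\<epsilon>..1 - \<epsilon>}"
  shows "K0 \<le> nat \<lfloor>real n * u\<rfloor>" "nat \<lfloor>real n * u\<rfloor> \<le> K1"
  using assms unfolding K0_def K1_def by (auto intro!: nat_mono floor_mono mult_left_mono)

sublocale centered_weights n "deg_weight n E"
  using centered_deg_weight graph deg_var_pos n_pos by blast

sublocale finite_martingale "perms n" mg K1 "1 / (\<epsilon> ^ 3 * real n)"
proof (rule finite_martingale.weaken[OF mg_martingale])
  show "K1 < n" by (rule K1_bounds)
  have "(real n / (real n - real K1))\<^sup>2 / (real n - real K1) \<le> (real n / (real n * \<epsilon>))\<^sup>2 / (real n * \<epsilon>)"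
    using K1_bounds(4) n_eps n_pos eps
    by (intro frac_le power_mono) auto
  also have "\<dots> = 1 / (\<epsilon> ^ 3 * real n)"
    using n_pos eps by (simp add: power2_eq_square power3_eq_cube field_simps)
  finally show "(real n / (real n - real K1))\<^sup>2 / (real n - real K1) \<le> 1 / (\<epsilon> ^ 3 * real n)" .
qed

abbreviation q :: real where "q \<equiv> 1 / (\<epsilon> ^ 3 * real n)"

lemma q_nonneg: "0 \<le> q"
  using eps by simp

lemma Zpath_scale:
  assumes "\<sigma> \<in> perms n" "u \<in> {\<epsilon>..1 - \<epsilon>}"
  shows "Zpath n E \<epsilon> (1 - \<epsilon>) \<sigma> u = scale n (nat \<lfloor>real n * u\<rfloor>) * mg (nat \<lfloor>real n * u\<rfloor>) \<sigma>"
proof -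
  have "0 < nat \<lfloor>real n * u\<rfloor>" "nat \<lfloor>real n * u\<rfloor> < n"
    using floor_range[OF assms(2)] K0_bounds(3) K1_bounds(3) by linarith+
  then have "Zdiff n E (nat \<lfloor>real n * u\<rfloor>) \<sigma> = scale n (nat \<lfloor>real n * u\<rfloor>) * mg (nat \<lfloor>real n * u\<rfloor>) \<sigma>"
    using assms(1) by (intro Zdiff_scale graph deg_var_pos)
  then show ?thesis using assms(2) by (simp add: Zpath_def)
qed

text \<open>The maximal inequality started at time 0, where the martingale vanishes; the total
  variance is at most \<open>q * n = 1 / \<epsilon> ^ 3\<close>.\<close>

lemma mg_large:
  assumes "L > 0"
  shows "real (card {\<sigma>\<in>perms n. \<exists>j\<le>K1. L \<le> \<bar>mg j \<sigma>\<bar>}) \<le> real (card (perms n)) / (\<epsilon> ^ 3 * L\<^sup>2)"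
proof -
  have "{\<sigma>\<in>perms n. \<exists>j\<le>K1. L \<le> \<bar>mg j \<sigma>\<bar>} = {\<sigma>\<in>perms n. True \<and> (\<exists>j. 0 < j \<and> j \<le> K1 \<and> L \<le> \<bar>mg j \<sigma> - mg 0 \<sigma>\<bar>)}"
    using assms by (auto simp: mg_0 gr0_conv_Suc) (metis abs_zero leD mg_0 not0_implies_Suc)
  then have "L\<^sup>2 * real (card {\<sigma>\<in>perms n. \<exists>j\<le>K1. L \<le> \<bar>mg j \<sigma>\<bar>}) \<le> q * real (K1 - 0) * real (card {\<sigma>\<in>perms n. True})"
    using maximal_inequality[of 0 K1 L "\<lambda>_. True"] assms by simp
  also have "\<dots> \<le> q * real n * real (card (perms n))"
  proof -
    have "q * real (K1 - 0) \<le> q * real n"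
      using K1_bounds(3) by (intro mult_left_mono q_nonneg) simp
    from mult_right_mono[OF this, of "real (card (perms n))"] show ?thesis by simp
  qed
  also have "\<dots> = real (card (perms n)) / \<epsilon> ^ 3" using n_pos by simp
  finally show ?thesis using assms eps by (simp add: field_simps)
qed

lemma Zpath_bounded:
  assumes "L > 0"
  shows "real (card {\<sigma>\<in>perms n. \<not> (\<forall>u\<in>{\<epsilon>..1 - \<epsilon>}. \<bar>Zpath n E \<epsilon> (1 - \<epsilon>) \<sigma> u\<bar> \<le> sqrt (2 / \<epsilon>) * L)})
    \<le> real (card (perms n)) / (\<epsilon> ^ 3 * L\<^sup>2)"
proof -
  have "\<bar>Zpath n E \<epsilon> (1 - \<epsilon>) \<sigma> u\<bar> \<le> sqrt (2 / \<epsilon>) * L"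
    if \<sigma>: "\<sigma> \<in> perms n" and small: "\<not> (\<exists>j\<le>K1. L \<le> \<bar>mg j \<sigma>\<bar>)" and u: "u \<in> {\<epsilon>..1 - \<epsilon>}" for \<sigma> u
  proof -
    let ?k = "nat \<lfloor>real n * u\<rfloor>"
    have k: "real n * \<epsilon> / 2 \<le> real ?k" "?k \<le> n" "?k \<le> K1"
      using floor_range[OF u] K0_bounds(2) K1_bounds(3) by linarith+
    have "\<bar>Zpath n E \<epsilon> (1 - \<epsilon>) \<sigma> u\<bar> = scale n ?k * \<bar>mg ?k \<sigma>\<bar>"
      using Zpath_scale[OF \<sigma> u] scale_le(1)[OF n_pos eps(1) k(1,2)] by (simp add: abs_mult)
    moreover have "\<bar>mg ?k \<sigma>\<bar> \<le> L" using small k(3) by (meson less_imp_le not_le)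
    then have "scale n ?k * \<bar>mg ?k \<sigma>\<bar> \<le> sqrt (2 / \<epsilon>) * L"
      using scale_le[OF n_pos eps(1) k(1,2)] eps by (intro mult_mono) auto
    ultimately show ?thesis by simp
  qed
  then have "card {\<sigma>\<in>perms n. \<not> (\<forall>u\<in>{\<epsilon>..1 - \<epsilon>}. \<bar>Zpath n E \<epsilon> (1 - \<epsilon>) \<sigma> u\<bar> \<le> sqrt (2 / \<epsilon>) * L)}
      \<le> card {\<sigma>\<in>perms n. \<exists>j\<le>K1. L \<le> \<bar>mg j \<sigma>\<bar>}"
    by (intro card_perms_mono) blast
  then show ?thesis using mg_large[OF assms] by linarith
qed

text \<open>Outside three bad events the stops form a suitable partition: the martingale is large
  (\<open>B0\<close>), two stops are closer than \<open>d\<close> (\<open>B1\<close>), the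
  martingale moves by \<open>e1\<close> during the last \<open>d\<close> times (\<open>B2\<close>).
  \<open>B0\<close> matters because the variation of \<open>scale\<close> is multiplied by the size
  of the martingale.\<close>

lemma Zpath_osc:
  assumes e1: "e1 > 0" and L: "L > 0" and D: "0 < D" "real D \<le> \<gamma> * real n" "q * real D \<le> e1\<^sup>2 / 2"
    and d: "d \<le> D" "K0 + d \<le> K1" "\<delta> * real n + 1 \<le> real d"
    and e: "sqrt (2 / \<epsilon>) * (2 * e1) + 2 / \<epsilon> * sqrt (2 * \<gamma>) * L \<le> e"
  shows "real (card {\<sigma>\<in>perms n. \<not> (osc_step (Zpath n E \<epsilon> (1 - \<epsilon>) \<sigma>) \<delta> e)\<^sup>*\<^sup>* \<epsilon> (1 - \<epsilon>)})
    \<le> real (card (perms n)) * (1 / (\<epsilon> ^ 3 * L\<^sup>2) + q * real d * (2 * (real (K1 - K0) / real D) + 3) / e1\<^sup>2)"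
proof -
  let ?C = "real (card (perms n))"
  define B0 where "B0 = {\<sigma>\<in>perms n. \<exists>j\<le>K1. L \<le> \<bar>mg j \<sigma>\<bar>}"
  define B1 where "B1 = {\<sigma>\<in>perms n. \<exists>k j. K0 \<le> k \<and> k < j \<and> j < k + d \<and> j \<le> K1 \<and> stop K0 e1 D \<sigma> k \<and> stop K0 e1 D \<sigma> j}"
  define B2 where "B2 = {\<sigma>\<in>perms n. \<exists>j. K1 - d < j \<and> j \<le> K1 \<and> e1 \<le> \<bar>mg j \<sigma> - mg (K1 - d) \<sigma>\<bar>}"
  have fin: "finite B0" "finite B1" "finite B2"
    using finite_perms by (auto simp: B0_def B1_def B2_def)
  have b0: "real (card B0) \<le> ?C / (\<epsilon> ^ 3 * L\<^sup>2)"
    unfolding B0_def by (rule mg_large[OF L])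
  \<comment> \<open>The 3 consists of 2 from the additive term in \<open>some_short_gap\<close> and
    1 from \<open>B2\<close>.\<close>
  have combine: "x * (y + z) \<le> c * (w * (2 * v + 3))"
    if "x * y \<le> w * (2 * (v + 1) * c)" "x * z \<le> w * c" for x y z c w v :: real
    using that by (simp add: algebra_simps)
  have divide: "y \<le> c * (w / x)" if "x * y \<le> c * w" "x > 0" for x y c w :: real
    using that by (simp add: pos_le_divide_eq mult.commute)
  have "e1\<^sup>2 * real (card B1) \<le> q * real d * (2 * (real (K1 - K0) / real D + 1) * ?C)"
    unfolding B1_def using assms q_nonneg by (intro some_short_gap) auto
  moreover have "e1\<^sup>2 * real (card B2) \<le> q * real d * ?C"
  proof -
    have "e1\<^sup>2 * real (card B2) \<le> q * real (K1 - (K1 - d)) * ?C"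
      using maximal_inequality[of "K1 - d" K1 e1 "\<lambda>_. True"] e1 by (simp add: B2_def)
    also have "K1 - (K1 - d) = d" using d by simp
    finally show ?thesis .
  qed
  ultimately have "e1\<^sup>2 * (real (card B1) + real (card B2)) \<le> ?C * (q * real d * (2 * (real (K1 - K0) / real D) + 3))"
    by (rule combine)
  then have b12: "real (card B1) + real (card B2) \<le> ?C * (q * real d * (2 * (real (K1 - K0) / real D) + 3) / e1\<^sup>2)"
    by (rule divide) (use e1 in simp)
  have good: "(osc_step (Zpath n E \<epsilon> (1 - \<epsilon>) \<sigma>) \<delta> e)\<^sup>*\<^sup>* \<epsilon> (1 - \<epsilon>)"
    if \<sigma>: "\<sigma> \<in> perms n" "\<sigma> \<notin> B0" "\<sigma> \<notin> B1" "\<sigma> \<notin> B2" for \<sigma>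
  proof (rule stops_osc_chain[where n=n and a=\<epsilon> and b="1 - \<epsilon>" and p="\<lambda>k. mg k \<sigma>" and F="\<lambda>k. scale n k * mg k \<sigma>" and h=e1 and D=D and d=d, folded K0_def K1_def])
    fix i j assume ij: "K0 \<le> i" "i \<le> j" "j \<le> K1" "\<bar>mg j \<sigma> - mg i \<sigma>\<bar> \<le> 2 * e1" "j - i \<le> 2 * D"
    have i: "real n * \<epsilon> / 2 \<le> real i" "real n * \<epsilon> / 2 \<le> real j" "j \<le> n"
      using ij K0_bounds(2) K1_bounds(3) by linarith+
    have "real j - real i \<le> 2 * real D" using ij by linarith
    also have "\<dots> \<le> 2 * \<gamma> * real n" using D by simp
    finally have "\<bar>scale n j - scale n i\<bar> \<le> 2 / \<epsilon> * sqrt (2 * \<gamma>)"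
      using scale_diff[OF n_pos eps(1) i(1) ij(2) i(3)] by blast
    moreover have "\<not> L \<le> \<bar>mg i \<sigma>\<bar>" using \<sigma>(1,2) ij(2,3) unfolding B0_def by auto
    ultimately have 1: "\<bar>scale n j - scale n i\<bar> * \<bar>mg i \<sigma>\<bar> \<le> 2 / \<epsilon> * sqrt (2 * \<gamma>) * L"
      by (intro mult_mono) auto
    have 2: "scale n j * \<bar>mg j \<sigma> - mg i \<sigma>\<bar> \<le> sqrt (2 / \<epsilon>) * (2 * e1)"
      using scale_le[OF n_pos eps(1) i(2,3)] ij eps by (intro mult_mono) auto
    \<comment> \<open>Discrete product rule: the stopping rule controls the first term, the bound on
      \<open>j - i\<close> and the modulus of \<open>scale\<close> the second.\<close>
    have eq: "scale n j * mg j \<sigma> - scale n i * mg i \<sigma> =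
        scale n j * (mg j \<sigma> - mg i \<sigma>) + (scale n j - scale n i) * mg i \<sigma>"
      by (simp add: algebra_simps)
    have "\<bar>scale n j * mg j \<sigma> - scale n i * mg i \<sigma>\<bar>
        \<le> scale n j * \<bar>mg j \<sigma> - mg i \<sigma>\<bar> + \<bar>scale n j - scale n i\<bar> * \<bar>mg i \<sigma>\<bar>"
      unfolding eq by (rule order_trans[OF abs_triangle_ineq])
        (use scale_le(1)[OF n_pos eps(1) i(2,3)] in \<open>simp add: abs_mult\<close>)
    then show "\<bar>scale n j * mg j \<sigma> - scale n i * mg i \<sigma>\<bar> \<le> e"
      using add_mono[OF 2 1] e by (rule order_trans[OF order_trans])
  next
    fix k j assume kj: "K0 \<le> k" "k < j" "j \<le> K1" "last_stop K0 e1 D (\<lambda>k. mg k \<sigma>) k = k" "last_stop K0 e1 D (\<lambda>k. mg k \<sigma>) j = j"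
    show "k + d \<le> j"
    proof (rule ccontr)
      assume "\<not> k + d \<le> j"
      then have "\<sigma> \<in> B1"
        unfolding B1_def using kj \<sigma>(1) by (intro CollectI conjI exI[of _ k] exI[of _ j]) auto
      then show False using \<sigma>(3) by contradiction
    qed
  next
    fix j assume "K1 - d < j" "j \<le> K1"
    then show "\<bar>mg j \<sigma> - mg (K1 - d) \<sigma>\<bar> < e1" using \<sigma> unfolding B2_def by (auto simp: not_le)
  qed (use assms n_pos eps Zpath_scale[OF \<sigma>(1)] in auto)
  have "card {\<sigma>\<in>perms n. \<not> (osc_step (Zpath n E \<epsilon> (1 - \<epsilon>) \<sigma>) \<delta> e)\<^sup>*\<^sup>* \<epsilon> (1 - \<epsilon>)} \<le> card (B0 \<union> (B1 \<union> B2))"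
    using good fin by (intro card_mono) blast+
  also have "\<dots> \<le> card B0 + (card B1 + card B2)"
    by (rule order_trans[OF card_Un_le add_left_mono[OF card_Un_le]])
  finally have "real (card {\<sigma>\<in>perms n. \<not> (osc_step (Zpath n E \<epsilon> (1 - \<epsilon>) \<sigma>) \<delta> e)\<^sup>*\<^sup>* \<epsilon> (1 - \<epsilon>)})
      \<le> real (card B0) + (real (card B1) + real (card B2))" by linarith
  also have "\<dots> \<le> ?C / (\<epsilon> ^ 3 * L\<^sup>2) + ?C * (q * real d * (2 * (real (K1 - K0) / real D) + 3) / e1\<^sup>2)"
    using b0 b12 by (rule add_mono)
  finally show ?thesis by (simp add: distrib_left)
qed

text \<open>\<open>D\<close> is about \<open>\<gamma> * n\<close> and \<open>d\<close> about
  \<open>\<delta> * n\<close>. As \<open>q\<close> is of order \<open>1 / n\<close>, the bound for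
  \<open>B1\<close> and \<open>B2\<close> is linear in \<delta>, with a coefficient that depends
  only on \<gamma>, \<open>e1\<close> and \<epsilon>; so \<delta> can be chosen last.\<close>

lemma Zpath_modulus:
  assumes e1: "e1 > 0" and L: "L > 0" and \<gamma>: "\<gamma> > 0" "\<gamma> / \<epsilon> ^ 3 \<le> e1\<^sup>2 / 2"
    and \<delta>: "\<delta> > 0" "\<delta> \<le> \<gamma> / 4" "\<delta> \<le> (1 - 2 * \<epsilon>) / 4"
    and n: "2 / \<gamma> \<le> real n" "2 / \<delta> \<le> real n"
    and e: "sqrt (2 / \<epsilon>) * (2 * e1) + 2 / \<epsilon> * sqrt (2 * \<gamma>) * L \<le> e"
  shows "real (card {\<sigma>\<in>perms n. \<not> (osc_step (Zpath n E \<epsilon> (1 - \<epsilon>) \<sigma>) \<delta> e)\<^sup>*\<^sup>* \<epsilon> (1 - \<epsilon>)})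
    \<le> real (card (perms n)) * (1 / (\<epsilon> ^ 3 * L\<^sup>2) + \<delta> * (2 * (4 / \<gamma> + 3) / (\<epsilon> ^ 3 * e1\<^sup>2)))"
proof -
  define D where "D = nat \<lfloor>\<gamma> * real n\<rfloor>"
  define d where "d = nat \<lceil>\<delta> * real n\<rceil> + 1"
  have \<gamma>n: "2 \<le> \<gamma> * real n" using n \<gamma> by (simp add: divide_le_eq mult.commute)
  have \<delta>n: "2 \<le> \<delta> * real n" using n \<delta> by (simp add: divide_le_eq mult.commute)
  have "real D = real_of_int \<lfloor>\<gamma> * real n\<rfloor>" using \<gamma>n by (simp add: D_def)
  then have D: "real D \<le> \<gamma> * real n" "\<gamma> * real n / 2 \<le> real D" using \<gamma>n by linarith+
  have "real d = real_of_int \<lceil>\<delta> * real n\<rceil> + 1" using \<delta>n by (simp add: d_def)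
  then have d: "\<delta> * real n + 1 \<le> real d" "real d \<le> 2 * (\<delta> * real n)" using \<delta>n by linarith+
  \<comment> \<open>The 4 in \<open>\<delta> \<le> \<gamma> / 4\<close> covers two roundings,
    \<open>d \<le> 2 * \<delta> * n\<close> and \<open>D \<ge> \<gamma> * n / 2\<close>.\<close>
  have "2 * (\<delta> * real n) \<le> \<gamma> * real n / 2"
    using \<delta>(2) mult_right_mono[OF \<delta>(2), of "real n"] by simp
  then have dD: "d \<le> D" using d D by linarith
  have "\<delta> * real n \<le> (1 - 2 * \<epsilon>) / 4 * real n"
    using \<delta>(3) by (intro mult_right_mono) auto
  then have w: "4 * (\<delta> * real n) + 2 * (real n * \<epsilon>) \<le> real n" by (simp add: algebra_simps)
  have "real n * (1 - \<epsilon>) = real n - real n * \<epsilon>" by (simp add: algebra_simps)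
  then have "real K0 + real d < real K1 + 1"
    using w K0_bounds(1) K1_bounds(2) d(2) \<delta>n by linarith
  then have dK: "K0 + d \<le> K1" by linarith
  have "q * real D \<le> q * (\<gamma> * real n)" using D(1) q_nonneg by (rule mult_left_mono)
  also have "\<dots> = \<gamma> / \<epsilon> ^ 3" using n_pos by simp
  also note \<gamma>(2)
  finally have qD: "q * real D \<le> e1\<^sup>2 / 2" .
  have Dpos: "0 < D" using D(2) \<gamma>n by linarith
  have "real (K1 - K0) / real D \<le> real n / (\<gamma> * real n / 2)"
    using K1_bounds(3) D(2) \<gamma>n by (intro frac_le) auto
  also have "\<dots> = 2 / \<gamma>" using n_pos by simp
  finally have r: "2 * (real (K1 - K0) / real D) + 3 \<le> 4 / \<gamma> + 3" by simp
  have "q * real d \<le> q * (2 * (\<delta> * real n))" using d(2) q_nonneg by (rule mult_left_mono)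
  also have "\<dots> = 2 * \<delta> / \<epsilon> ^ 3" using n_pos by simp
  finally have qd: "q * real d \<le> 2 * \<delta> / \<epsilon> ^ 3" .
  have "q * real d * (2 * (real (K1 - K0) / real D) + 3) / e1\<^sup>2 \<le> 2 * \<delta> / \<epsilon> ^ 3 * (4 / \<gamma> + 3) / e1\<^sup>2"
    using qd r \<delta>(1) eps by (intro divide_right_mono mult_mono) auto
  also have "\<dots> = \<delta> * (2 * (4 / \<gamma> + 3) / (\<epsilon> ^ 3 * e1\<^sup>2))" by simp
  finally have "1 / (\<epsilon> ^ 3 * L\<^sup>2) + q * real d * (2 * (real (K1 - K0) / real D) + 3) / e1\<^sup>2
      \<le> 1 / (\<epsilon> ^ 3 * L\<^sup>2) + \<delta> * (2 * (4 / \<gamma> + 3) / (\<epsilon> ^ 3 * e1\<^sup>2))" by simp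
  then have "real (card (perms n)) * (1 / (\<epsilon> ^ 3 * L\<^sup>2) + q * real d * (2 * (real (K1 - K0) / real D) + 3) / e1\<^sup>2)
      \<le> real (card (perms n)) * (1 / (\<epsilon> ^ 3 * L\<^sup>2) + \<delta> * (2 * (4 / \<gamma> + 3) / (\<epsilon> ^ 3 * e1\<^sup>2)))"
    by (rule mult_left_mono) simp
  then show ?thesis
    using Zpath_osc[OF e1 L Dpos D(1) qD dD dK d(1) e] by linarith
qed

end

theorem theorem3p2:
  fixes G :: "nat \<Rightarrow> nat set set" and k :: "nat \<Rightarrow> real" and \<epsilon> :: real
  assumes graphs: "\<And>n. simple_graph_on n (G n)"
    and size: "\<exists>c1>0. \<exists>c2>0. \<forall>\<^sub>F n in sequentially.
                 c1 * (k n * real n) \<le> real (card (G n)) \<and> real (card (G n)) \<le> c2 * (k n * real n)"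
    and k_lower: "\<exists>c>0. \<forall>\<^sub>F n in sequentially. k n \<ge> c"
    and deg_cond: "\<exists>c>0. \<forall>\<^sub>F n in sequentially.
                 (\<Sum>i=1..n. (real (degree (G n) i))\<^sup>2) - 4 * (real (card (G n)))\<^sup>2 / real n \<ge> c * (k n)\<^sup>2"
    and eps: "0 < \<epsilon>" "\<epsilon> < 1/2"
  shows "tight_perm \<epsilon> (1 - \<epsilon>) (\<lambda>n \<sigma>. Zpath n (G n) \<epsilon> (1 - \<epsilon>) \<sigma>)"
proof -
  obtain c c' where c: "c > 0" "\<forall>\<^sub>F n in sequentially. k n \<ge> c"
    and c': "c' > 0" "\<forall>\<^sub>F n in sequentially. deg_var n (G n) \<ge> c' * (k n)\<^sup>2"
    using k_lower deg_cond unfolding deg_var_def by blast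
  have large: "\<forall>\<^sub>F n in sequentially. r \<le> real n" for r
    using filterlim_real_sequentially by (simp add: filterlim_at_top)
  \<comment> \<open>Since \<open>k\<close> stays away from 0, the assumed lower bound on the degree
    variance is strictly positive.\<close>
  have window: "\<forall>\<^sub>F n in sequentially. graph_window n (G n) \<epsilon>"
    using c(2) c'(2) large[of "2 / \<epsilon>"]
  proof eventually_elim
    case (elim n)
    then have "k n > 0" using c(1) by linarith
    then have "deg_var n (G n) > 0" using elim c'(1) by (smt (verit) mult_pos_pos zero_less_power)
    then show ?case using graphs eps elim by (simp add: graph_window_def)
  qed
  show ?thesis
  proof (rule tight_permI)
    show "\<epsilon> < 1 - \<epsilon>" using eps by simp
    show "Zpath n (G n) \<epsilon> (1 - \<epsilon>) \<sigma> \<in> cadlag \<epsilon> (1 - \<epsilon>)" for n \<sigma>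
      unfolding Zpath_def by (rule floor_step_cadlag)
  next
    fix \<eta> :: real assume "\<eta> > 0"
    \<comment> \<open>Chosen so that the failure bound of \<open>Zpath_bounded\<close> is exactly
      \<eta>.\<close>
    define L where "L = sqrt (1 / (\<epsilon> ^ 3 * \<eta>))"
    have L: "L > 0" "1 / (\<epsilon> ^ 3 * L\<^sup>2) = \<eta>" using \<open>\<eta> > 0\<close> eps by (auto simp: L_def)
    show "\<exists>L. \<forall>\<^sub>F n in sequentially. real (card {\<sigma>\<in>perms n. \<not> (\<forall>u\<in>{\<epsilon>..1 - \<epsilon>}. \<bar>Zpath n (G n) \<epsilon> (1 - \<epsilon>) \<sigma> u\<bar> \<le> L)})
        \<le> \<eta> * real (card (perms n))"
    proof (intro exI eventually_mono[OF window])
      fix n assume "graph_window n (G n) \<epsilon>"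
      from graph_window.Zpath_bounded[OF this L(1)]
      show "real (card {\<sigma>\<in>perms n. \<not> (\<forall>u\<in>{\<epsilon>..1 - \<epsilon>}. \<bar>Zpath n (G n) \<epsilon> (1 - \<epsilon>) \<sigma> u\<bar> \<le> sqrt (2 / \<epsilon>) * L)})
          \<le> \<eta> * real (card (perms n))"
        by (simp add: L(2)[symmetric])
    qed
  next
    fix e \<eta> :: real assume e: "e > 0" and \<eta>: "\<eta> > 0"
    \<comment> \<open>\<open>L\<close> gives \<open>B0\<close> half of \<eta>, and \<open>e1\<close>
      gives the movement between stops half of \<open>e\<close>. The first entry of \<gamma> makes a
      further stop within \<open>D\<close> at most an even chance; the second gives the variation of
      \<open>scale\<close> the other half of \<open>e\<close>. The last entry of \<delta> leaves
      half of \<eta> for \<open>B1\<close> and \<open>B2\<close>.\<close>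
    define L where "L = sqrt (2 / (\<epsilon> ^ 3 * \<eta>))"
    define e1 where "e1 = e / (4 * sqrt (2 / \<epsilon>))"
    define \<gamma> where "\<gamma> = min (\<epsilon> ^ 3 * (e1\<^sup>2 / 2)) ((e * \<epsilon> / (4 * L))\<^sup>2 / 2)"
    define C where "C = 2 * (4 / \<gamma> + 3) / (\<epsilon> ^ 3 * e1\<^sup>2)"
    define \<delta> where "\<delta> = min (min (\<gamma> / 4) ((1 - 2 * \<epsilon>) / 4)) (\<eta> / (2 * C))"
    have L: "L > 0" "1 / (\<epsilon> ^ 3 * L\<^sup>2) = \<eta> / 2" using \<eta> eps by (auto simp: L_def)
    have e1: "e1 > 0" "sqrt (2 / \<epsilon>) * (2 * e1) = e / 2" using e eps by (auto simp: e1_def)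
    have \<gamma>: "\<gamma> > 0" "\<gamma> \<le> \<epsilon> ^ 3 * (e1\<^sup>2 / 2)" "2 * \<gamma> \<le> (e * \<epsilon> / (4 * L))\<^sup>2"
      using e e1 L eps by (auto simp: \<gamma>_def)
    have "\<gamma> / \<epsilon> ^ 3 \<le> e1\<^sup>2 / 2" using \<gamma>(2) eps by (simp add: pos_divide_le_eq mult.commute)
    have "sqrt (2 * \<gamma>) \<le> e * \<epsilon> / (4 * L)"
      using real_sqrt_le_mono[OF \<gamma>(3)] e eps L by simp
    then have "2 / \<epsilon> * sqrt (2 * \<gamma>) * L \<le> 2 / \<epsilon> * (e * \<epsilon> / (4 * L)) * L"
      using eps L by (intro mult_right_mono mult_left_mono) auto
    also have "\<dots> = e / 2" using eps L by (simp add: field_simps)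
    finally have osc: "sqrt (2 / \<epsilon>) * (2 * e1) + 2 / \<epsilon> * sqrt (2 * \<gamma>) * L \<le> e"
      using e1(2) by simp
    have C: "C > 0" using \<gamma> e1 eps by (auto simp: C_def intro!: divide_pos_pos mult_pos_pos add_pos_pos)
    have "\<eta> / (2 * C) > 0" using C \<eta> by simp
    then have "\<delta> > 0" using \<gamma>(1) eps(2) by (simp add: \<delta>_def)
    moreover have "\<delta> \<le> \<gamma> / 4" "\<delta> \<le> (1 - 2 * \<epsilon>) / 4" "\<delta> \<le> \<eta> / (2 * C)"
      unfolding \<delta>_def by (meson min.cobounded1 min.cobounded2 order_trans)+
    ultimately have \<delta>: "\<delta> > 0" "\<delta> \<le> \<gamma> / 4" "\<delta> \<le> (1 - 2 * \<epsilon>) / 4" "\<delta> \<le> \<eta> / (2 * C)" .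
    have "\<delta> * C \<le> \<eta> / 2" using \<delta>(4) C by (simp add: field_simps)
    have "\<forall>\<^sub>F n in sequentially. real (card {\<sigma>\<in>perms n. \<not> (osc_step (Zpath n (G n) \<epsilon> (1 - \<epsilon>) \<sigma>) \<delta> e)\<^sup>*\<^sup>* \<epsilon> (1 - \<epsilon>)})
        \<le> \<eta> * real (card (perms n))"
      using window large[of "2 / \<gamma>"] large[of "2 / \<delta>"]
    proof eventually_elim
      case (elim n)
      have "real (card {\<sigma>\<in>perms n. \<not> (osc_step (Zpath n (G n) \<epsilon> (1 - \<epsilon>) \<sigma>) \<delta> e)\<^sup>*\<^sup>* \<epsilon> (1 - \<epsilon>)})
          \<le> real (card (perms n)) * (1 / (\<epsilon> ^ 3 * L\<^sup>2) + \<delta> * C)"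
        unfolding C_def
        by (rule graph_window.Zpath_modulus[OF elim(1) e1(1) L(1) \<gamma>(1) \<open>\<gamma> / \<epsilon> ^ 3 \<le> e1\<^sup>2 / 2\<close> \<delta>(1-3) elim(2,3) osc])
      also have "\<dots> \<le> real (card (perms n)) * \<eta>"
        using L(2) \<open>\<delta> * C \<le> \<eta> / 2\<close> by (intro mult_left_mono) auto
      finally show ?case by (simp add: mult.commute)
    qed
    then show "\<exists>\<delta>>0. \<forall>\<^sub>F n in sequentially. real (card {\<sigma>\<in>perms n. \<not> (osc_step (Zpath n (G n) \<epsilon> (1 - \<epsilon>) \<sigma>) \<delta> e)\<^sup>*\<^sup>* \<epsilon> (1 - \<epsilon>)})
        \<le> \<eta> * real (card (perms n))"
      using \<delta>(1) by blast
  qed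
qed

end
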